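(* Let $n,d\ge1$ and let $\mathcal B_\alpha$, $\alpha\in\{\mathrm D,\mathrm N,\mathrm R\}$, be the bilinear forms of the first-order system defined in the context. For $\alpha=\mathrm N,\mathrm R$ there exists a constant $C>0$ such that for all $\boldsymbol u=(\phi_0,\boldsymbol\psi_0,\dots,\phi_{n-1},\boldsymbol\psi_{n-1})\in(H^1(\Omega)\times H^1(\Omega)^d)^n$, $$\mathcal B_\alpha(\boldsymbol u,\boldsymbol u)\ge C\sum_{k=0}^{n-1}\Big(\|\boldsymbol\psi_k\|_{H(\mathrm{div};\Omega)}^2+\|\phi_k\|_{H^1(\Omega)}^2\Big),$$ and, for the Dirichlet boundary, there exists a constant $C>0$ such that for all such $\boldsymbol u$, $$\Big(\mathcal B_{\mathrm D}^{1/2}(\boldsymbol u,\boldsymbol u)+\sum_{k=0}^{n-1}\|\boldsymbol\psi_k\|_{L^2(\partial\Omega)}\Big)\mathcal B_{\mathrm D}^{1/2}(\boldsymbol u,\boldsymbol u)\ge C\sum_{k=0}^{n-1}\Big(\|\boldsymbol\psi_k\|_{H(\mathrm{div};\Omega)}^2+\|\phi_k\|_{H^1(\Omega)}^2\Big).$$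
   Context: $\Omega=[0,1]^d$, $\boldsymbol n$ is the outer unit normal of $\partial\Omega$, $\lambda,\mu>0$ are fixed constants. $\phi_k$ are scalar and $\boldsymbol\psi_k$ $\mathbb R^d$-valued. $\|\boldsymbol v\|_{H(\mathrm{div};\Omega)}=(\|\boldsymbol v\|_{L^2(\Omega)}^2+\|\mathrm{div}\,\boldsymbol v\|_{L^2(\Omega)}^2)^{1/2}$. Write $\boldsymbol w=(\theta_0,\boldsymbol\xi_0,\dots,\theta_{n-1},\boldsymbol\xi_{n-1})$ for a second argument. $\mathcal P\boldsymbol u=(\nabla\phi_0-\boldsymbol\psi_0,\ \mathrm{div}\,\boldsymbol\psi_0-\phi_1,\ \nabla\phi_1-\boldsymbol\psi_1,\dots,\mathrm{div}\,\boldsymbol\psi_{n-2}-\phi_{n-1},\ \nabla\phi_{n-1}-\boldsymbol\psi_{n-1},\ \mathrm{div}\,\boldsymbol\psi_{n-1})$. On $\partial\Omega$: $S_{\mathrm D}\boldsymbol u=(\phi_0,\dots,\phi_{n-1})$, $S_{\mathrm N}\boldsymbol u=(\boldsymbol n\cdot\boldsymbol\psi_0,\dots,\boldsymbol n\cdot\boldsymbol\psi_{n-1})$, $S_{\mathrm R}=S_{\mathrm D}+S_{\mathrm N}$ (traces). For $\alpha=\mathrm D,\mathrm R$: $\mathcal B_\alpha(\boldsymbol u,\boldsymbol w)=(\mathcal P\boldsymbol u,\mathcal P\boldsymbol w)_{L^2(\Omega)}+\lambda(S_\alpha\boldsymbol u,S_\alpha\boldsymbol w)_{L^2(\partial\Omega)}$.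 For $\alpha=\mathrm N$: $\mathcal B_{\mathrm N}(\boldsymbol u,\boldsymbol w)=(\mathcal P\boldsymbol u,\mathcal P\boldsymbol w)_{L^2(\Omega)}+\lambda(S_{\mathrm N}\boldsymbol u,S_{\mathrm N}\boldsymbol w)_{L^2(\partial\Omega)}+\mu\int_\Omega\phi_0\,\mathrm dx\int_\Omega\theta_0\,\mathrm dx$. $\mathcal B_{\mathrm D}^{1/2}(\boldsymbol u,\boldsymbol u)$ denotes $\sqrt{\mathcal B_{\mathrm D}(\boldsymbol u,\boldsymbol u)}$. *)

theory Defs
  imports "HOL-Analysis.Analysis"
begin

section \<open>Square-integrable functions\<close>

definition L2 :: "'a measure \<Rightarrow> ('a \<Rightarrow> 'b::euclidean_space) set" where
  "L2 M = {f \<in> borel_measurable M. integrable M (\<lambda>x. (norm (f x))\<^sup>2)}"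

definition L2_inner :: "'a measure \<Rightarrow> ('a \<Rightarrow> 'b::euclidean_space) \<Rightarrow> ('a \<Rightarrow> 'b) \<Rightarrow> real" where
  "L2_inner M f g = (\<integral>x. f x \<bullet> g x \<partial>M)"

definition L2_norm :: "'a measure \<Rightarrow> ('a \<Rightarrow> 'b::euclidean_space) \<Rightarrow> real" where
  "L2_norm M f = sqrt (\<integral>x. (norm (f x))\<^sup>2 \<partial>M)"


section \<open>The unit cube and its boundary\<close>

text \<open>
  The dimension \<open>d\<close> is \<open>DIM('a)\<close>. The boundary of the cube has measure zero, so integrals over the
  open and over the closed cube agree.
\<close>

definition cube_measure :: "'a::euclidean_space measure" where
  "cube_measure = lebesgue_on (cbox 0 One)"

definition face_proj :: "'a::euclidean_space \<Rightarrow> real \<Rightarrow> 'a \<Rightarrow> 'a" where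
  "face_proj b c x = x + (c - x \<bullet> b) *\<^sub>R b"

text \<open>
  The faces of the cube are \<open>{x \<in> cbox 0 One. x \<bullet> b = c}\<close> for \<open>b \<in> Basis\<close> and \<open>c \<in> {0, 1}\<close>. The
  projection \<open>face_proj b c\<close> maps the cube onto such a face, and its fibres are segments of length 1.
  By Fubini the image of \<open>d\<close>-dimensional Lebesgue measure under it is therefore
  \<open>(d - 1)\<close>-dimensional Lebesgue measure on the face (a unit point mass if \<open>d = 1\<close>). The surface
  measure is the sum of these images over all faces, see \<open>emeasure_surface_measure\<close> below.
\<close>

definition surface_measure :: "'a::euclidean_space measure" where
  "surface_measure =
     distr (count_space (Basis \<times> {0, 1}) \<Otimes>\<^sub>M restrict_space lborel (cbox 0 One)) borel
       (\<lambda>(i, x). face_proj (fst i) (snd i) x)"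

text \<open>
  The outer unit normal in the relative interior of each face; the values on the lower-dimensional
  faces, a null set for the surface measure, are irrelevant.
\<close>

definition outer_normal :: "'a::euclidean_space \<Rightarrow> 'a" where
  "outer_normal x = (\<Sum>b\<in>Basis. (if x \<bullet> b = 1 then b else if x \<bullet> b = 0 then - b else 0))"

lemma measurable_face_proj:
  "(\<lambda>(i, x). face_proj (fst i) (snd i) x)
     \<in> count_space (Basis \<times> {0, 1}) \<Otimes>\<^sub>M restrict_space lborel (cbox 0 One)
        \<rightarrow>\<^sub>M (borel :: 'a::euclidean_space measure)"
proof (rule measurable_pair_measure_countable1)
  show "countable ((Basis :: 'a set) \<times> {0, 1 :: real})"
    by (intro countable_finite finite_SigmaI) auto
next
  fix i :: "'a \<times> real"
  show "(\<lambda>y. case (i, y) of (i, x) \<Rightarrow> face_proj (fst i) (snd i) x)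
          \<in> restrict_space lborel (cbox 0 One) \<rightarrow>\<^sub>M borel"
    unfolding face_proj_def split
    by (rule measurable_restrict_space1) measurable
qed

lemma emeasure_surface_measure:
  fixes A :: "'a::euclidean_space set"
  assumes "A \<in> sets borel"
  shows "emeasure surface_measure A =
    (\<Sum>b\<in>Basis. \<Sum>c\<in>{0, 1}. emeasure lborel {x \<in> cbox 0 One. face_proj b c x \<in> A})"
proof -
  let ?L = "restrict_space lborel (cbox 0 One) :: 'a measure"
  let ?I = "(Basis :: 'a set) \<times> {0, 1 :: real}"
  let ?f = "\<lambda>(i, x). face_proj (fst i) (snd i) (x :: 'a)"
  have finI: "finite ?I" by simp
  have L: "sigma_finite_measure ?L"
    by (rule sigma_finite_measure_restrict_space) (auto simp: lborel.sigma_finite_measure_axioms)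
  interpret sigma_finite_measure ?L by (fact L)
  let ?V = "?f -` A \<inter> space (count_space ?I \<Otimes>\<^sub>M ?L)"
  have V: "?V \<in> sets (count_space ?I \<Otimes>\<^sub>M ?L)"
    by (rule measurable_sets[OF measurable_face_proj assms])
  have "emeasure surface_measure A = emeasure (count_space ?I \<Otimes>\<^sub>M ?L) ?V"
    unfolding surface_measure_def by (rule emeasure_distr[OF measurable_face_proj assms])
  also have "\<dots> = (\<integral>\<^sup>+i. emeasure ?L (Pair i -` ?V) \<partial>count_space ?I)"
    by (rule emeasure_pair_measure_alt[OF V])
  also have "\<dots> = (\<Sum>i\<in>?I. emeasure ?L (Pair i -` ?V))"
    by (rule nn_integral_count_space_finite[OF finI])
  also have "\<dots> = (\<Sum>i\<in>?I. emeasure lborel {x \<in> cbox 0 One. face_proj (fst i) (snd i) x \<in> A})"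
  proof (rule sum.cong[OF refl])
    fix i assume "i \<in> ?I"
    then have "Pair i -` ?V = {x \<in> cbox 0 One. face_proj (fst i) (snd i) x \<in> A}"
      by (auto simp: space_pair_measure space_restrict_space)
    then show "emeasure ?L (Pair i -` ?V) =
        emeasure lborel {x \<in> cbox 0 One. face_proj (fst i) (snd i) x \<in> A}"
      by (simp add: emeasure_restrict_space)
  qed
  also have "\<dots> = (\<Sum>b\<in>Basis. \<Sum>c\<in>{0, 1}. emeasure lborel {x \<in> cbox 0 One. face_proj b c x \<in> A})"
    by (simp only: sum.cartesian_product split_def)
  finally show ?thesis .
qed


section \<open>Weak derivatives and the Sobolev space \<open>H\<^sup>1\<close>\<close>

definition partial_deriv :: "'a::euclidean_space \<Rightarrow> ('a \<Rightarrow> real) \<Rightarrow> 'a \<Rightarrow> real" where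
  "partial_deriv b f x = frechet_derivative f (at x) b"

definition C1 :: "('a::euclidean_space \<Rightarrow> real) set" where
  "C1 = {f. (\<forall>x. f differentiable at x) \<and> (\<forall>b\<in>Basis. continuous_on UNIV (partial_deriv b f))}"

definition test_functions :: "('a::euclidean_space \<Rightarrow> real) set" where
  "test_functions = {\<eta> \<in> C1. \<exists>K. compact K \<and> K \<subseteq> box 0 One \<and> (\<forall>x. x \<notin> K \<longrightarrow> \<eta> x = 0)}"

text \<open>
  As in Gilbarg and Trudinger, first-order weak derivatives are tested with compactly supported
  \<open>C\<^sup>1\<close> functions; by mollification this is the same as testing with \<open>C\<^sup>\<infinity>\<close> functions.
\<close>

definition is_weak_deriv ::
    "'a::euclidean_space \<Rightarrow> ('a \<Rightarrow> real) \<Rightarrow> ('a \<Rightarrow> real) \<Rightarrow> bool" where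
  "is_weak_deriv b u g \<longleftrightarrow> g \<in> L2 cube_measure \<and>
     (\<forall>\<eta>\<in>test_functions.
        (\<integral>x. u x * partial_deriv b \<eta> x \<partial>cube_measure) = - (\<integral>x. g x * \<eta> x \<partial>cube_measure))"

definition H1 :: "('a::euclidean_space \<Rightarrow> real) set" where
  "H1 = {u \<in> L2 cube_measure. \<forall>b\<in>Basis. \<exists>g. is_weak_deriv b u g}"

definition H1_vec :: "('a::euclidean_space \<Rightarrow> 'a) set" where
  "H1_vec = {v. \<forall>b\<in>Basis. (\<lambda>x. v x \<bullet> b) \<in> H1}"

text \<open>The weak derivative is unique almost everywhere; the choice of representative is irrelevant.\<close>

definition weak_deriv :: "'a::euclidean_space \<Rightarrow> ('a \<Rightarrow> real) \<Rightarrow> 'a \<Rightarrow> real" where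
  "weak_deriv b u = (SOME g. is_weak_deriv b u g)"

definition weak_grad :: "('a::euclidean_space \<Rightarrow> real) \<Rightarrow> 'a \<Rightarrow> 'a" where
  "weak_grad u x = (\<Sum>b\<in>Basis. weak_deriv b u x *\<^sub>R b)"

definition weak_div :: "('a::euclidean_space \<Rightarrow> 'a) \<Rightarrow> 'a \<Rightarrow> real" where
  "weak_div v x = (\<Sum>b\<in>Basis. weak_deriv b (\<lambda>y. v y \<bullet> b) x)"

definition H1_norm :: "('a::euclidean_space \<Rightarrow> real) \<Rightarrow> real" where
  "H1_norm u = sqrt ((L2_norm cube_measure u)\<^sup>2 + (L2_norm cube_measure (weak_grad u))\<^sup>2)"

definition Hdiv_norm :: "('a::euclidean_space \<Rightarrow> 'a) \<Rightarrow> real" where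
  "Hdiv_norm v = sqrt ((L2_norm cube_measure v)\<^sup>2 + (L2_norm cube_measure (weak_div v))\<^sup>2)"


section \<open>Traces\<close>

text \<open>
  The trace operator is the continuous extension to \<open>H\<^sup>1\<close> of the restriction to the boundary of functions
  that are \<open>C\<^sup>1\<close> up to the boundary: the trace of \<open>u\<close> is the limit, in \<open>L\<^sup>2\<close> of the boundary, of the
  restrictions of \<open>C\<^sup>1\<close> functions converging to \<open>u\<close> in \<open>H\<^sup>1\<close>. By the trace theorem it exists for every
  \<open>u \<in> H1\<close> and is unique almost everywhere with respect to the surface measure.
\<close>

definition is_trace :: "('a::euclidean_space \<Rightarrow> real) \<Rightarrow> ('a \<Rightarrow> real) \<Rightarrow> bool" where
  "is_trace u g \<longleftrightarrow> g \<in> L2 surface_measure \<and>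
     (\<exists>v. (\<forall>m::nat. v m \<in> C1) \<and>
        (\<lambda>m. L2_norm cube_measure (\<lambda>x. v m x - u x)) \<longlonglongrightarrow> 0 \<and>
        (\<forall>b\<in>Basis. (\<lambda>m. L2_norm cube_measure (\<lambda>x. partial_deriv b (v m) x - weak_deriv b u x))
           \<longlonglongrightarrow> 0) \<and>
        (\<lambda>m. L2_norm surface_measure (\<lambda>x. v m x - g x)) \<longlonglongrightarrow> 0)"

definition bdry_trace :: "('a::euclidean_space \<Rightarrow> real) \<Rightarrow> 'a \<Rightarrow> real" where
  "bdry_trace u = (SOME g. is_trace u g)"

definition bdry_trace_vec :: "('a::euclidean_space \<Rightarrow> 'a) \<Rightarrow> 'a \<Rightarrow> 'a" where
  "bdry_trace_vec v x = (\<Sum>b\<in>Basis. bdry_trace (\<lambda>y. v y \<bullet> b) x *\<^sub>R b)"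


section \<open>The first-order system and its bilinear forms\<close>

text \<open>
  A tuple \<open>(\<phi>\<^sub>0, \<psi>\<^sub>0, \<dots>, \<phi>\<^sub>n\<^sub>-\<^sub>1, \<psi>\<^sub>n\<^sub>-\<^sub>1)\<close> is a sequence of pairs \<open>(\<phi>\<^sub>k, \<psi>\<^sub>k)\<close>, of which only the entries
  with \<open>k < n\<close> are ever used.
\<close>

type_synonym 'a tuple_field = "nat \<Rightarrow> ('a \<Rightarrow> real) \<times> ('a \<Rightarrow> 'a)"

abbreviation (input) phi :: "'a tuple_field \<Rightarrow> nat \<Rightarrow> 'a \<Rightarrow> real" where
  "phi u k \<equiv> fst (u k)"

abbreviation (input) psi :: "'a tuple_field \<Rightarrow> nat \<Rightarrow> 'a \<Rightarrow> 'a" where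
  "psi u k \<equiv> snd (u k)"

definition H1_tuples :: "nat \<Rightarrow> 'a::euclidean_space tuple_field set" where
  "H1_tuples n = {u. \<forall>k<n. phi u k \<in> H1 \<and> psi u k \<in> H1_vec}"

text \<open>
  The entries of \<open>\<P> u\<close> are grouped in consecutive pairs: \<open>sys_op n u k\<close> is
  \<open>(\<nabla>\<phi>\<^sub>k - \<psi>\<^sub>k, div \<psi>\<^sub>k - \<phi>\<^sub>k\<^sub>+\<^sub>1)\<close>, where the last pair has second component \<open>div \<psi>\<^sub>n\<^sub>-\<^sub>1\<close>. The inner
  product of the product type \<open>'a \<times> real\<close> is the sum of those of the components.
\<close>

definition sys_op :: "nat \<Rightarrow> 'a::euclidean_space tuple_field \<Rightarrow> nat \<Rightarrow> 'a \<Rightarrow> 'a \<times> real" where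
  "sys_op n u k x =
     (weak_grad (phi u k) x - psi u k x,
      weak_div (psi u k) x - (if Suc k < n then phi u (Suc k) x else 0))"

datatype bdry_cond = Dirichlet | Neumann | Robin

definition bdry_op :: "bdry_cond \<Rightarrow> 'a::euclidean_space tuple_field \<Rightarrow> nat \<Rightarrow> 'a \<Rightarrow> real" where
  "bdry_op \<alpha> u k x =
     (case \<alpha> of
        Dirichlet \<Rightarrow> bdry_trace (phi u k) x
      | Neumann \<Rightarrow> outer_normal x \<bullet> bdry_trace_vec (psi u k) x
      | Robin \<Rightarrow> bdry_trace (phi u k) x + outer_normal x \<bullet> bdry_trace_vec (psi u k) x)"

definition bilin ::
    "bdry_cond \<Rightarrow> nat \<Rightarrow> real \<Rightarrow> real \<Rightarrow>
      'a::euclidean_space tuple_field \<Rightarrow> 'a tuple_field \<Rightarrow> real" where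
  "bilin \<alpha> n lam mu u w =
     (\<Sum>k<n. L2_inner cube_measure (sys_op n u k) (sys_op n w k))
     + lam * (\<Sum>k<n. L2_inner surface_measure (bdry_op \<alpha> u k) (bdry_op \<alpha> w k))
     + (if \<alpha> = Neumann
        then mu * (\<integral>x. phi u 0 x \<partial>cube_measure) * (\<integral>x. phi w 0 x \<partial>cube_measure) else 0)"

end

theory Submission
  imports Defs
begin

text \<open>
  Write \<open>f\<^sub>k = \<nabla>\<phi>\<^sub>k - \<psi>\<^sub>k\<close> and \<open>g\<^sub>k = div \<psi>\<^sub>k - \<phi>\<^sub>k\<^sub>+\<^sub>1\<close> for the residuals, whose norms the bilinear form
  controls. Testing \<open>\<nabla>\<phi>\<^sub>k = \<psi>\<^sub>k + f\<^sub>k\<close> with \<open>\<nabla>\<phi>\<^sub>k\<close> and applying Green's formula bounds \<open>\<parallel>\<nabla>\<phi>\<^sub>k\<parallel>\<^sup>2\<close>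
  by the residuals, \<open>\<phi>\<^sub>k\<^sub>+\<^sub>1\<close> and the boundary integral of \<open>(n \<bullet> \<psi>\<^sub>k) \<phi>\<^sub>k\<close>. That integral is controlled
  through the trace inequality (Neumann), produces the good term \<open>- \<parallel>\<phi>\<^sub>k\<parallel>\<^sup>2\<close> (Robin), or costs the extra factor
  \<open>\<parallel>\<psi>\<^sub>k\<parallel>\<close> on the boundary (Dirichlet). A Friedrichs or Poincare inequality then bounds \<open>\<phi>\<^sub>k\<close> in \<open>H\<^sup>1\<close> by
  \<open>\<phi>\<^sub>k\<^sub>+\<^sub>1\<close>; in the Neumann case the mean of \<open>\<phi>\<^sub>k\<^sub>+\<^sub>1\<close> comes from the divergence theorem for \<open>\<psi>\<^sub>k\<close>. The estimates
  are chained from \<open>k = n - 1\<close> downwards.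

  All inequalities reduce to the divergence theorem for \<open>C\<^sup>1\<close> functions on the cube, because \<open>C\<^sup>1\<close> functions are
  dense in \<open>H\<^sup>1\<close>: mollifying after shrinking the cube towards its centre keeps the kernel compactly
  supported in the interior, hence an admissible test function. For \<open>C\<^sup>1\<close> functions \<open>v\<close> the trace and the Friedrichs
  inequality follow from the divergence theorem for \<open>(2 x\<^sub>b - 1) v\<^sup>2\<close> and \<open>x\<^sub>b v\<^sup>2\<close>.
\<close>

section \<open>Square-integrable functions\<close>

text \<open>Weak derivatives and traces are representatives picked by \<open>SOME\<close>, so the
  boundary terms become accessible only through a trace theorem: the trace inequality makes the
  boundary values of an approximating sequence Cauchy, and completeness of \<open>L2\<close>
  supplies the limit. Since the surface measure is an image of volume measure under the face
  projections, surface integrals are volume integrals of functions constant along the normal, and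
  the divergence theorem is the fundamental theorem of calculus in one coordinate. The chain can
  start at k = n - 1 because the last divergence equation has no successor term. It carries only
  \<phi>; bounds on \<psi> and its divergence are read off from the two equations. All three cases
  share the form \<open>N\<^sup>2 \<le> A * (c * \<beta> + Q) * N + M * X\<close>, with
  \<open>N\<close> the H1 norm of the current \<phi>, \<open>Q\<close> the L2 norm of the next one
  and \<open>\<beta>\<^sup>2\<close> the bilinear form at u. For Neumann and Robin, \<open>X\<close>
  is that form. In the Dirichlet case the form controls on the boundary the trace of \<phi> alone,
  so the boundary integral is only linear in \<beta>; there \<open>X\<close> is the mixed product of
  the claim.\<close>

lemma L2_measurable: "f \<in> L2 M \<Longrightarrow> f \<in> borel_measurable M"
  and L2_integrable_power2: "f \<in> L2 M \<Longrightarrow> integrable M (\<lambda>x. (norm (f x))\<^sup>2)"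
  by (auto simp: L2_def)

lemma L2_norm_nonneg [simp]: "0 \<le> L2_norm M f"
  by (simp add: L2_norm_def)

lemma L2_norm_power2: "(L2_norm M f)\<^sup>2 = (\<integral>x. (norm (f x))\<^sup>2 \<partial>M)"
  by (simp add: L2_norm_def)

lemma L2_inner_self: "L2_inner M f f = (L2_norm M f)\<^sup>2"
  by (simp add: L2_norm_power2 L2_inner_def dot_square_norm)

text \<open>A non-integrable function has Bochner integral 0, so \<open>L2_norm\<close> is
  meaningful only on \<open>L2\<close>. Membership therefore accompanies every estimate, and
  pointwise domination is one of its main sources.\<close>

lemma L2_bound:
  fixes f :: "'a \<Rightarrow> 'b::euclidean_space" and g :: "'a \<Rightarrow> 'c::euclidean_space"
  assumes "g \<in> L2 M" "f \<in> borel_measurable M" "\<And>x. x \<in> space M \<Longrightarrow> norm (f x) \<le> K * norm (g x)"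
  shows "f \<in> L2 M"
proof -
  have "integrable M (\<lambda>x. K\<^sup>2 * (norm (g x))\<^sup>2)"
    using L2_integrable_power2[OF assms(1)] by simp
  then have "integrable M (\<lambda>x. (norm (f x))\<^sup>2)"
  proof (rule Bochner_Integration.integrable_bound)
    show "AE x in M. norm ((norm (f x))\<^sup>2) \<le> norm (K\<^sup>2 * (norm (g x))\<^sup>2)"
      using assms(3) by (auto intro!: AE_I2 power_mono simp flip: power_mult_distrib)
  qed (use assms(2) in measurable)
  with assms(2) show ?thesis by (simp add: L2_def)
qed

lemma L2_norm_bound:
  fixes f :: "'a \<Rightarrow> 'b::euclidean_space" and g :: "'a \<Rightarrow> 'c::euclidean_space"
  assumes "g \<in> L2 M" "f \<in> borel_measurable M" "\<And>x. x \<in> space M \<Longrightarrow> norm (f x) \<le> K * norm (g x)" "0 \<le> K"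
  shows "L2_norm M f \<le> K * L2_norm M g"
proof (rule power2_le_imp_le)
  have "f \<in> L2 M" by (rule L2_bound[OF assms(1-3)])
  then have "(\<integral>x. (norm (f x))\<^sup>2 \<partial>M) \<le> (\<integral>x. K\<^sup>2 * (norm (g x))\<^sup>2 \<partial>M)"
    using assms(1,3) L2_integrable_power2[OF assms(1)]
    by (intro integral_mono L2_integrable_power2 integrable_mult_right)
       (auto simp flip: power_mult_distrib intro!: power_mono)
  then show "(L2_norm M f)\<^sup>2 \<le> (K * L2_norm M g)\<^sup>2"
    by (simp add: L2_norm_power2 power_mult_distrib)
qed (use assms in auto)

lemma L2_norm_cong:
  assumes "\<And>x. x \<in> space M \<Longrightarrow> f x = g x" 
  shows "L2_norm M f = L2_norm M g"
proof -
  have "(\<integral>x. (norm (f x))\<^sup>2 \<partial>M) = (\<integral>x. (norm (g x))\<^sup>2 \<partial>M)"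
    by (rule Bochner_Integration.integral_cong[OF refl]) (simp add: assms)
  then show ?thesis by (simp add: L2_norm_def)
qed

lemma L2_inner_integrable:
  assumes "f \<in> L2 M" "g \<in> L2 M"
  shows "integrable M (\<lambda>x. f x \<bullet> g x)"
proof (rule Bochner_Integration.integrable_bound)
  show "integrable M (\<lambda>x. (norm (f x))\<^sup>2 + (norm (g x))\<^sup>2)"
    by (intro Bochner_Integration.integrable_add L2_integrable_power2 assms)
  show "(\<lambda>x. f x \<bullet> g x) \<in> borel_measurable M"
    using assms[THEN L2_measurable] by measurable
  have "\<bar>x \<bullet> y\<bar> \<le> (norm x)\<^sup>2 + (norm y)\<^sup>2" for x y :: 'b
  proof -
    have "\<bar>x \<bullet> y\<bar> \<le> norm x * norm y" by (rule Cauchy_Schwarz_ineq2)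
    moreover have "2 * norm x * norm y \<le> (norm x)\<^sup>2 + (norm y)\<^sup>2" by (rule sum_squares_bound)
    moreover have "0 \<le> norm x * norm y" by simp
    ultimately show ?thesis by linarith
  qed
  then show "AE x in M. norm (f x \<bullet> g x) \<le> norm ((norm (f x))\<^sup>2 + (norm (g x))\<^sup>2)"
    unfolding real_norm_def by (intro AE_I2) (rule order_trans[OF _ abs_ge_self])
qed

lemma L2_mult_integrable:
  fixes f g :: "'a \<Rightarrow> real"
  assumes "f \<in> L2 M" "g \<in> L2 M"
  shows "integrable M (\<lambda>x. f x * g x)"
  using L2_inner_integrable[OF assms] by simp

lemma L2_Cauchy_Schwarz:
  assumes f: "f \<in> L2 M" and g: "g \<in> L2 M"
  shows "\<bar>\<integral>x. f x \<bullet> g x \<partial>M\<bar> \<le> L2_norm M f * L2_norm M g"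
proof -
  let ?A = "(L2_norm M f)\<^sup>2" and ?B = "(L2_norm M g)\<^sup>2" and ?C = "\<integral>x. f x \<bullet> g x \<partial>M"
  have q: "0 \<le> ?A * s\<^sup>2 - 2 * s * t * ?C + ?B * t\<^sup>2" for s t :: real
  proof -
    have "0 \<le> (\<integral>x. (norm (s *\<^sub>R f x - t *\<^sub>R g x))\<^sup>2 \<partial>M)" by simp
    also have "\<dots> = (\<integral>x. s\<^sup>2 * (norm (f x))\<^sup>2 - 2 * s * t * (f x \<bullet> g x) + t\<^sup>2 * (norm (g x))\<^sup>2 \<partial>M)"
      by (intro Bochner_Integration.integral_cong refl)
         (unfold power2_norm_eq_inner, simp add: inner_diff algebra_simps inner_commute power2_eq_square)
    also have "\<dots> = s\<^sup>2 * ?A - 2 * s * t * ?C + t\<^sup>2 * ?B"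
      using f g by (simp add: L2_norm_power2 L2_inner_integrable L2_integrable_power2)
    finally show ?thesis by (simp add: algebra_simps)
  qed
  have "?C\<^sup>2 \<le> ?A * ?B"
  proof (cases "?B = 0")
    case True
    show ?thesis
    proof (rule ccontr)
      assume "\<not> ?thesis"
      then have C: "?C \<noteq> 0" using True by auto
      \<comment> \<open>With \<open>?B = 0\<close> the form is linear in t; this t makes it equal to
        \<open>?A - (?A + 1) = - 1\<close>.\<close>
      have "0 \<le> ?A * 1\<^sup>2 - 2 * 1 * ((?A + 1) / (2 * ?C)) * ?C + ?B * ((?A + 1) / (2 * ?C))\<^sup>2"
        by (rule q)
      then show False using True C by simp
    qed
  next
    case False
    then have "?B > 0" by simp
    \<comment> \<open>At s = B, t = C the form factors as
      \<open>?B * (?A * ?B - ?C\<^sup>2)\<close>.\<close>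
    have "0 \<le> ?A * ?B\<^sup>2 - 2 * ?B * ?C * ?C + ?B * ?C\<^sup>2" by (rule q)
    then have "0 \<le> ?B * (?A * ?B - ?C\<^sup>2)" by (simp add: algebra_simps power2_eq_square)
    with \<open>?B > 0\<close> show ?thesis by (simp add: zero_le_mult_iff)
  qed
  then have "\<bar>?C\<bar>\<^sup>2 \<le> (L2_norm M f * L2_norm M g)\<^sup>2" by (simp add: power_mult_distrib)
  then show ?thesis by (rule power2_le_imp_le) simp
qed

lemma L2_add:
  assumes "f \<in> L2 M" "g \<in> L2 M"
  shows "(\<lambda>x. f x + g x) \<in> L2 M"
proof -
  have "integrable M (\<lambda>x. (norm (f x))\<^sup>2 + 2 * (f x \<bullet> g x) + (norm (g x))\<^sup>2)"
    by (intro Bochner_Integration.integrable_add integrable_mult_right L2_integrable_power2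
        L2_inner_integrable assms)
  then have "integrable M (\<lambda>x. (norm (f x + g x))\<^sup>2)"
    by (simp add: power2_norm_eq_inner inner_add algebra_simps inner_commute)
  with assms[THEN L2_measurable] show ?thesis by (simp add: L2_def)
qed

lemma L2_scaleR: "f \<in> L2 M \<Longrightarrow> (\<lambda>x. c *\<^sub>R f x) \<in> L2 M"
  using L2_measurable[of f M] by (intro L2_bound[where K = "\<bar>c\<bar>" and g = f and f = "\<lambda>x. c *\<^sub>R f x"]) auto

lemma L2_norm_scaleR: "L2_norm M (\<lambda>x. c *\<^sub>R f x) = \<bar>c\<bar> * L2_norm M f"
  by (simp add: L2_norm_def power_mult_distrib real_sqrt_mult)

lemma L2_zero: "(\<lambda>x. 0) \<in> L2 M"
  by (simp add: L2_def)

lemma L2_sum: "(\<And>i. i \<in> I \<Longrightarrow> f i \<in> L2 M) \<Longrightarrow> (\<lambda>x. \<Sum>i\<in>I. f i x) \<in> L2 M"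
  by (induction I rule: infinite_finite_induct) (auto intro: L2_zero L2_add)

lemma L2_diff:
  assumes "f \<in> L2 M" "g \<in> L2 M"
  shows "(\<lambda>x. f x - g x) \<in> L2 M"
  using L2_add[OF assms(1) L2_scaleR[OF assms(2), of "-1"]] by simp

lemma L2_norm_triangle:
  assumes f: "f \<in> L2 M" and g: "g \<in> L2 M"
  shows "L2_norm M (\<lambda>x. f x + g x) \<le> L2_norm M f + L2_norm M g"
proof (rule power2_le_imp_le)
  have "(L2_norm M (\<lambda>x. f x + g x))\<^sup>2 = (\<integral>x. (norm (f x))\<^sup>2 + 2 * (f x \<bullet> g x) + (norm (g x))\<^sup>2 \<partial>M)"
    unfolding L2_norm_power2 by (intro Bochner_Integration.integral_cong refl)
         (simp add: power2_norm_eq_inner inner_add algebra_simps inner_commute)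
  also have "\<dots> = (L2_norm M f)\<^sup>2 + 2 * (\<integral>x. f x \<bullet> g x \<partial>M) + (L2_norm M g)\<^sup>2"
    using f g by (simp add: L2_norm_power2 L2_inner_integrable L2_integrable_power2)
  also have "\<dots> \<le> (L2_norm M f + L2_norm M g)\<^sup>2"
    using L2_Cauchy_Schwarz[OF f g] by (simp add: power2_sum)
  finally show "(L2_norm M (\<lambda>x. f x + g x))\<^sup>2 \<le> (L2_norm M f + L2_norm M g)\<^sup>2" .
qed simp

lemma L2_norm_minus_commute: "L2_norm M (\<lambda>x. f x - g x) = L2_norm M (\<lambda>x. g x - f x)"
  by (simp add: L2_norm_def norm_minus_commute)

lemma L2_norm_triangle3:
  assumes "f \<in> L2 M" "g \<in> L2 M" "h \<in> L2 M"
  shows "L2_norm M (\<lambda>x. f x - h x) \<le> L2_norm M (\<lambda>x. f x - g x) + L2_norm M (\<lambda>x. g x - h x)"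
  using L2_norm_triangle[OF L2_diff[OF assms(1,2)] L2_diff[OF assms(2,3)]] by simp

lemma L2_norm_diff_ge:
  assumes "f \<in> L2 M" "g \<in> L2 M"
  shows "\<bar>L2_norm M f - L2_norm M g\<bar> \<le> L2_norm M (\<lambda>x. f x - g x)"
  using L2_norm_triangle3[OF assms L2_zero] L2_norm_triangle3[OF assms(2,1) L2_zero]
  by (simp add: L2_norm_minus_commute[of M f g])

lemma tendsto_L2_norm:
  assumes "\<And>m. f m \<in> L2 M" "g \<in> L2 M" "(\<lambda>m. L2_norm M (\<lambda>x. f m x - g x)) \<longlonglongrightarrow> 0"
  shows "(\<lambda>m. L2_norm M (f m)) \<longlonglongrightarrow> L2_norm M g"
proof (rule LIMSEQ_I)
  fix e :: real assume "0 < e"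
  then obtain N where "\<And>m. m \<ge> N \<Longrightarrow> L2_norm M (\<lambda>x. f m x - g x) < e"
    using LIMSEQ_D[OF assms(3) \<open>0 < e\<close>] by auto
  then show "\<exists>N. \<forall>m\<ge>N. norm (L2_norm M (f m) - L2_norm M g) < e"
    using le_less_trans[OF L2_norm_diff_ge[OF assms(1,2)]] by auto
qed

text \<open>Polarization reduces inner products to the norms of f + g and f - g, whose convergence
  is \<open>tendsto_L2_norm\<close>. This is what carries Green's formula over to limits.\<close>

lemma tendsto_L2_inner:
  fixes f g :: "nat \<Rightarrow> 'a \<Rightarrow> 'b::euclidean_space"
  assumes f: "\<And>m. f m \<in> L2 M" "f' \<in> L2 M" "(\<lambda>m. L2_norm M (\<lambda>x. f m x - f' x)) \<longlonglongrightarrow> 0"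
    and g: "\<And>m. g m \<in> L2 M" "g' \<in> L2 M" "(\<lambda>m. L2_norm M (\<lambda>x. g m x - g' x)) \<longlonglongrightarrow> 0"
  shows "(\<lambda>m. \<integral>x. f m x \<bullet> g m x \<partial>M) \<longlonglongrightarrow> (\<integral>x. f' x \<bullet> g' x \<partial>M)"
proof -
  have pol: "4 * (\<integral>x. u x \<bullet> v x \<partial>M) =
      (L2_norm M (\<lambda>x. u x + v x))\<^sup>2 - (L2_norm M (\<lambda>x. u x - v x))\<^sup>2"
    if u: "u \<in> L2 M" and v: "v \<in> L2 M" for u v :: "'a \<Rightarrow> 'b"
  proof -
    have "(L2_norm M (\<lambda>x. u x + v x))\<^sup>2 - (L2_norm M (\<lambda>x. u x - v x))\<^sup>2
        = (\<integral>x. (norm (u x + v x))\<^sup>2 - (norm (u x - v x))\<^sup>2 \<partial>M)"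
      unfolding L2_norm_power2
      by (rule Bochner_Integration.integral_diff[symmetric])
         (rule L2_integrable_power2 L2_add L2_diff u v)+
    also have "\<dots> = (\<integral>x. 4 * (u x \<bullet> v x) \<partial>M)"
      by (intro Bochner_Integration.integral_cong refl)
         (simp add: power2_norm_eq_inner inner_add inner_diff algebra_simps inner_commute)
    finally show ?thesis by simp
  qed
  have sq: "(\<lambda>m. L2_norm M (\<lambda>x. (f m x - f' x) + (g m x - g' x))) \<longlonglongrightarrow> 0"
    by (rule real_tendsto_sandwich[OF _ _ tendsto_const tendsto_add_zero[OF f(3) g(3)]])
       (intro always_eventually allI L2_norm_nonneg L2_norm_triangle L2_diff f g)+
  have sq': "(\<lambda>m. L2_norm M (\<lambda>x. (f m x - f' x) - (g m x - g' x))) \<longlonglongrightarrow> 0"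
  proof (rule real_tendsto_sandwich[OF _ _ tendsto_const tendsto_add_zero[OF f(3) g(3)]])
    show "\<forall>\<^sub>F m in sequentially. L2_norm M (\<lambda>x. (f m x - f' x) - (g m x - g' x))
        \<le> L2_norm M (\<lambda>x. f m x - f' x) + L2_norm M (\<lambda>x. g m x - g' x)"
    proof (intro always_eventually allI)
      fix m
      show "L2_norm M (\<lambda>x. (f m x - f' x) - (g m x - g' x))
          \<le> L2_norm M (\<lambda>x. f m x - f' x) + L2_norm M (\<lambda>x. g m x - g' x)"
        using L2_norm_triangle3[OF L2_diff[OF f(1,2)] L2_zero L2_diff[OF g(1,2)], of m m]
        by (simp add: L2_norm_minus_commute[of M "g m" g'])
    qed
  qed auto
  have "(\<lambda>m. ((L2_norm M (\<lambda>x. f m x + g m x))\<^sup>2 - (L2_norm M (\<lambda>x. f m x - g m x))\<^sup>2) / 4)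
     \<longlonglongrightarrow> ((L2_norm M (\<lambda>x. f' x + g' x))\<^sup>2 - (L2_norm M (\<lambda>x. f' x - g' x))\<^sup>2) / 4"
    by (intro tendsto_divide tendsto_diff tendsto_power tendsto_const tendsto_L2_norm L2_add L2_diff f g)
       (use sq sq' in \<open>auto simp: algebra_simps\<close>)
  then show ?thesis
    unfolding pol[OF f(1) g(1), symmetric] pol[OF f(2) g(2), symmetric] by simp
qed

lemma tendsto_L2_mult:
  fixes f g :: "nat \<Rightarrow> 'a \<Rightarrow> real"
  assumes "\<And>m. f m \<in> L2 M" "f' \<in> L2 M" "(\<lambda>m. L2_norm M (\<lambda>x. f m x - f' x)) \<longlonglongrightarrow> 0"
    and "\<And>m. g m \<in> L2 M" "g' \<in> L2 M" "(\<lambda>m. L2_norm M (\<lambda>x. g m x - g' x)) \<longlonglongrightarrow> 0"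
  shows "(\<lambda>m. \<integral>x. f m x * g m x \<partial>M) \<longlonglongrightarrow> (\<integral>x. f' x * g' x \<partial>M)"
  using tendsto_L2_inner[OF assms] by simp

lemma (in finite_measure) L2_bounded:
  assumes "f \<in> borel_measurable M" "\<And>x. x \<in> space M \<Longrightarrow> norm (f x) \<le> K"
  shows "f \<in> L2 M"
proof -
  have "(norm (f x))\<^sup>2 \<le> K\<^sup>2" if "x \<in> space M" for x
    using assms(2)[OF that] by (intro power_mono) auto
  then have "integrable M (\<lambda>x. (norm (f x))\<^sup>2)"
    using assms(1) by (intro integrable_const_bound[where B = "K\<^sup>2"]) auto
  with assms(1) show ?thesis by (simp add: L2_def)
qed

lemma (in finite_measure) L2_const: "(\<lambda>x. c) \<in> L2 M"
  by (rule L2_bounded[where K = "norm c"]) auto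

text \<open>Riesz-Fischer for a finite measure. Cauchy-Schwarz against the constant 1 turns an
  L2-Cauchy sequence into an L1-Cauchy one, which has an almost everywhere convergent subsequence;
  its pointwise limit is the candidate.\<close>

lemma (in finite_measure) L2_complete:
  fixes v :: "nat \<Rightarrow> 'a \<Rightarrow> real"
  assumes v: "\<And>m. v m \<in> L2 M"
    and cau: "\<And>e. 0 < e \<Longrightarrow> \<exists>N. \<forall>m\<ge>N. \<forall>n\<ge>N. L2_norm M (\<lambda>x. v m x - v n x) < e"
  obtains g where "g \<in> L2 M" "(\<lambda>m. L2_norm M (\<lambda>x. v m x - g x)) \<longlonglongrightarrow> 0"
proof -
  note [measurable] = L2_measurable[OF v]
  have int: "integrable M f" if "f \<in> L2 M" for f :: "'a \<Rightarrow> real"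
    using L2_mult_integrable[OF that L2_const[of 1]] by simp
  have L1: "(\<integral>x. norm (f x) \<partial>M) \<le> L2_norm M f * L2_norm M (\<lambda>x. 1::real)" if f: "f \<in> L2 M" for f :: "'a \<Rightarrow> real"
  proof -
    have "(\<lambda>x. norm (f x)) \<in> L2 M"
      using L2_measurable[OF f] by (intro L2_bound[where K = 1, OF f]) auto
    then have "(\<integral>x. norm (f x) \<bullet> (1::real) \<partial>M) \<le> L2_norm M (\<lambda>x. norm (f x)) * L2_norm M (\<lambda>x. 1::real)"
      by (intro order_trans[OF abs_ge_self L2_Cauchy_Schwarz] L2_const)
    then show ?thesis by (simp add: L2_norm_def)
  qed
  have "\<exists>N. \<forall>i\<ge>N. \<forall>j\<ge>N. (LINT x|M. norm (v i x - v j x)) < e" if "0 < e" for e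
  proof -
    let ?K = "L2_norm M (\<lambda>x. 1::real)"
    have K: "0 \<le> ?K" by simp
    \<comment> \<open>Adding 1 to the denominator covers a space of measure 0, where
      \<open>?K\<close> vanishes.\<close>
    then have "0 < e / (?K + 1)" using that by (intro divide_pos_pos) linarith+
    from cau[OF this] obtain N where N: "\<And>i j. i \<ge> N \<Longrightarrow> j \<ge> N \<Longrightarrow> L2_norm M (\<lambda>x. v i x - v j x) < e / (?K + 1)"
      by blast
    show ?thesis
    proof (intro exI allI impI)
      fix i j assume "N \<le> i" "N \<le> j"
      then have "L2_norm M (\<lambda>x. v i x - v j x) * ?K \<le> e / (?K + 1) * ?K"
        using N[of i j] by (intro mult_right_mono) auto
      also have "\<dots> < e" using that K by (simp add: divide_less_eq distrib_left add_nonneg_pos)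
      finally show "(LINT x|M. norm (v i x - v j x)) < e"
        using L1[OF L2_diff[OF v v], of i j] by linarith
    qed
  qed
  from cauchy_L1_AE_cauchy_subseq[OF int[OF v] this]
  obtain r where r: "strict_mono r" and ae: "AE x in M. Cauchy (\<lambda>i. v (r i) x)" by auto
  define g where "g x = lim (\<lambda>i. v (r i) x)" for x
  have gm [measurable]: "g \<in> borel_measurable M"
    unfolding g_def by measurable
  have ptw: "AE x in M. (\<lambda>i. v (r i) x) \<longlonglongrightarrow> g x"
    using ae unfolding g_def by (auto simp: Cauchy_convergent_iff convergent_LIMSEQ_iff)
  \<comment> \<open>Fatou's lemma along the subsequence: for fixed m the bound on
    \<open>v m - v (r i)\<close> survives the limit in i, but only as a non-strict inequality. This
    is why e / 2 is used at the end.\<close>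
  have key: "integrable M (\<lambda>x. (v m x - g x)\<^sup>2) \<and> (\<integral>x. (v m x - g x)\<^sup>2 \<partial>M) \<le> e\<^sup>2"
    if e: "0 < e" and N: "\<And>i j. i \<ge> N \<Longrightarrow> j \<ge> N \<Longrightarrow> L2_norm M (\<lambda>x. v i x - v j x) < e" and m: "m \<ge> N" for m N e
  proof -
    have "(\<integral>\<^sup>+x. ennreal ((v m x - g x)\<^sup>2) \<partial>M) = (\<integral>\<^sup>+x. liminf (\<lambda>i. ennreal ((v m x - v (r i) x)\<^sup>2)) \<partial>M)"
    proof (rule nn_integral_cong_AE)
      show "AE x in M. ennreal ((v m x - g x)\<^sup>2) = liminf (\<lambda>i. ennreal ((v m x - v (r i) x)\<^sup>2))"
        using ptw
      proof eventually_elim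
        case (elim x)
        then have "(\<lambda>i. ennreal ((v m x - v (r i) x)\<^sup>2)) \<longlonglongrightarrow> ennreal ((v m x - g x)\<^sup>2)"
          by (intro tendsto_ennrealI tendsto_intros)
        then show ?case by (rule lim_imp_Liminf[OF sequentially_bot, symmetric])
      qed
    qed
    also have "\<dots> \<le> liminf (\<lambda>i. \<integral>\<^sup>+x. ennreal ((v m x - v (r i) x)\<^sup>2) \<partial>M)"
      by (rule nn_integral_liminf) measurable
    also have "\<dots> \<le> ennreal (e\<^sup>2)"
    proof (rule Liminf_le[OF sequentially_bot])
      show "\<forall>\<^sub>F i in sequentially. (\<integral>\<^sup>+x. ennreal ((v m x - v (r i) x)\<^sup>2) \<partial>M) \<le> ennreal (e\<^sup>2)"
      proof (rule eventually_sequentiallyI[of N])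
        fix i assume "N \<le> i"
        also have "i \<le> r i" using r by (rule seq_suble)
        finally have "L2_norm M (\<lambda>x. v m x - v (r i) x) < e" using N m by blast
        then have "(L2_norm M (\<lambda>x. v m x - v (r i) x))\<^sup>2 \<le> e\<^sup>2"
          by (intro power_mono) auto
        moreover have "integrable M (\<lambda>x. (v m x - v (r i) x)\<^sup>2)"
          using L2_integrable_power2[OF L2_diff[OF v v], of m "r i"] by simp
        ultimately show "(\<integral>\<^sup>+x. ennreal ((v m x - v (r i) x)\<^sup>2) \<partial>M) \<le> ennreal (e\<^sup>2)"
          by (subst nn_integral_eq_integral) (auto simp: L2_norm_power2 intro!: ennreal_leI)
      qed
    qed
    finally have le: "(\<integral>\<^sup>+x. ennreal ((v m x - g x)\<^sup>2) \<partial>M) \<le> ennreal (e\<^sup>2)" .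
    have "integrable M (\<lambda>x. (v m x - g x)\<^sup>2)"
      by (rule integrableI_nonneg) (use le in \<open>auto intro: le_less_trans\<close>)
    moreover from this le have "(\<integral>x. (v m x - g x)\<^sup>2 \<partial>M) \<le> e\<^sup>2"
      by (subst (asm) nn_integral_eq_integral) auto
    ultimately show ?thesis by blast
  qed
  obtain N1 where "\<And>i j. i \<ge> N1 \<Longrightarrow> j \<ge> N1 \<Longrightarrow> L2_norm M (\<lambda>x. v i x - v j x) < 1"
    using cau[OF zero_less_one] by blast
  from key[OF _ this, of N1] have "(\<lambda>x. v N1 x - g x) \<in> L2 M"
    by (simp add: L2_def)
  from L2_diff[OF v this, of N1] have g: "g \<in> L2 M" by simp
  have "(\<lambda>m. L2_norm M (\<lambda>x. v m x - g x)) \<longlonglongrightarrow> 0"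
  proof (rule LIMSEQ_I)
    fix e :: real assume "0 < e"
    then have e2: "0 < e / 2" by simp
    from cau[OF e2] obtain N where N: "\<And>i j. i \<ge> N \<Longrightarrow> j \<ge> N \<Longrightarrow> L2_norm M (\<lambda>x. v i x - v j x) < e / 2"
      by blast
    show "\<exists>N. \<forall>m\<ge>N. norm (L2_norm M (\<lambda>x. v m x - g x) - 0) < e"
    proof (intro exI allI impI)
      fix m assume "N \<le> m"
      from key[OF e2 N this] have "(L2_norm M (\<lambda>x. v m x - g x))\<^sup>2 \<le> (e/2)\<^sup>2"
        by (simp add: L2_norm_power2)
      then have "L2_norm M (\<lambda>x. v m x - g x) \<le> e / 2"
        by (rule power2_le_imp_le) (use e2 in simp)
      then show "norm (L2_norm M (\<lambda>x. v m x - g x) - 0) < e" using \<open>0 < e\<close> by simp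
    qed
  qed
  with g show ?thesis by (rule that)
qed

section \<open>Integration over the cube and its boundary\<close>

lemma space_cube_measure [simp]: "space cube_measure = cbox 0 One"
  by (simp add: cube_measure_def space_restrict_space)

lemma borel_measurable_cube_measure [intro]:
  "f \<in> borel_measurable borel \<Longrightarrow> f \<in> borel_measurable cube_measure"
  unfolding cube_measure_def by (intro measurable_restrict_space1 measurable_completion) simp

lemma nn_integral_cube_measure:
  assumes "f \<in> borel_measurable borel"
  shows "(\<integral>\<^sup>+x. f x \<partial>cube_measure) = (\<integral>\<^sup>+x. f x * indicator (cbox 0 One) x \<partial>lborel)"
  unfolding cube_measure_def
  by (subst nn_integral_restrict_space) (auto simp: nn_integral_completion)

lemma emeasure_cube_measure:
  "emeasure (cube_measure :: 'a::euclidean_space measure) (cbox 0 One) = 1"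
proof -
  have "emeasure (cube_measure :: 'a measure) (cbox 0 One) = emeasure lborel (cbox 0 One :: 'a set)"
    unfolding cube_measure_def
    by (subst emeasure_restrict_space) (auto simp: emeasure_completion)
  also have "\<dots> = 1"
    by (subst emeasure_lborel_cbox) auto
  finally show ?thesis .
qed

interpretation cube: finite_measure "cube_measure :: 'a::euclidean_space measure"
  by (rule finite_measureI) (simp add: emeasure_cube_measure)

lemma AE_cube_measure_box: "AE x in cube_measure. x \<in> box 0 (One :: 'a::euclidean_space)"
proof -
  have "negligible (cbox 0 One - box 0 (One::'a))" by (simp add: negligible_frontier_interval)
  then have "cbox 0 One - box 0 (One::'a) \<in> null_sets lebesgue" by (simp add: negligible_iff_null_sets)
  then have "AE x in lebesgue. x \<notin> cbox 0 One - box 0 (One::'a)" by (rule AE_not_in)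
  then have "AE x in cube_measure. x \<notin> cbox 0 One - box 0 (One::'a)"
    unfolding cube_measure_def by (subst AE_restrict_space_iff) auto
  then show ?thesis using AE_space by eventually_elim auto
qed

text \<open>\<open>cube_measure\<close> restricts the completed measure, whereas
  \<open>surface_measure\<close> and the product measures of the slicing argument are built from
  \<open>lborel\<close>; Borel integrands do not see the difference.\<close>

lemma integral_cube_measure_restrict:
  fixes f :: "'a::euclidean_space \<Rightarrow> real"
  assumes "f \<in> borel_measurable borel"
  shows "(\<integral>x. f x \<partial>cube_measure) = (\<integral>x. f x \<partial>restrict_space lborel (cbox 0 One))"
  unfolding cube_measure_def
  by (subst (1 2) integral_restrict_space) (use assms in \<open>auto intro!: integral_completion\<close>)

lemma integrable_cube_measure_bounded:
  fixes f :: "'a::euclidean_space \<Rightarrow> 'b::euclidean_space"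
  assumes "f \<in> borel_measurable borel" "\<And>x. x \<in> cbox 0 One \<Longrightarrow> norm (f x) \<le> K"
  shows "integrable cube_measure f"
  using assms by (intro cube.integrable_const_bound[where B = K]) (auto intro!: AE_I2)

lemma continuous_bounded_on_cube:
  fixes f :: "'a::euclidean_space \<Rightarrow> 'b::euclidean_space"
  assumes "continuous_on UNIV f"
  obtains K where "0 \<le> K" "\<And>x. x \<in> cbox 0 One \<Longrightarrow> norm (f x) \<le> K"
proof -
  have "compact (f ` cbox 0 One)"
    by (intro compact_continuous_image compact_cbox continuous_on_subset[OF assms]) auto
  then obtain K where "\<And>y. y \<in> f ` cbox 0 One \<Longrightarrow> norm y \<le> K"
    using compact_imp_bounded bounded_iff by metis
  then show ?thesis using that[of "\<bar>K\<bar>"] by fastforce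
qed

lemma integrable_cube_measure_continuous:
  fixes f :: "'a::euclidean_space \<Rightarrow> 'b::euclidean_space"
  assumes "continuous_on UNIV f"
  shows "integrable cube_measure f"
  using continuous_bounded_on_cube[OF assms] integrable_cube_measure_bounded
    borel_measurable_continuous_onI[OF assms] by metis

lemma continuous_L2_cube:
  fixes f :: "'a::euclidean_space \<Rightarrow> 'b::euclidean_space"
  assumes "continuous_on UNIV f"
  shows "f \<in> L2 cube_measure"
  using continuous_bounded_on_cube[OF assms] cube.L2_bounded[of f]
    borel_measurable_continuous_onI[OF assms] by (metis borel_measurable_cube_measure space_cube_measure)

section \<open>Face projections and surface integrals\<close>

lemma face_proj_inner:
  assumes "b \<in> Basis" "i \<in> Basis"
  shows "face_proj b c x \<bullet> i = (if i = b then c else x \<bullet> i)"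
  using assms by (auto simp: face_proj_def inner_add_left inner_Basis)

lemma face_proj_in_cube:
  assumes "b \<in> Basis" "x \<in> cbox 0 One" "0 \<le> c" "c \<le> 1"
  shows "face_proj b c x \<in> cbox 0 One"
  using assms by (auto simp: mem_box face_proj_inner)

lemma continuous_face_proj [continuous_intros]:
  assumes "continuous_on S f" "continuous_on S g"
  shows "continuous_on S (\<lambda>x. face_proj b (f x) (g x))"
  unfolding face_proj_def by (intro continuous_intros assms)

lemma face_proj_measurable [measurable]: "face_proj b c \<in> borel_measurable borel"
  by (intro borel_measurable_continuous_onI continuous_intros)

abbreviation face_measure :: "(('a::euclidean_space \<times> real) \<times> 'a) measure" where
  "face_measure \<equiv> count_space (Basis \<times> {0, 1 :: real}) \<Otimes>\<^sub>M restrict_space lborel (cbox 0 One)"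

lemma sigma_finite_restrict_lborel:
  "A \<in> sets borel \<Longrightarrow> sigma_finite_measure (restrict_space lborel A)"
  by (rule sigma_finite_measure_restrict_space) (auto simp: lborel.sigma_finite_measure_axioms)

lemma finite_measure_restrict_lborel_cbox: "finite_measure (restrict_space lborel (cbox a b))"
  by (rule finite_measureI) (auto simp: emeasure_restrict_space space_restrict_space emeasure_lborel_cbox_eq)

lemma finite_face_measure: "finite_measure (face_measure :: (('a::euclidean_space \<times> real) \<times> 'a) measure)"
proof (rule finite_measure_pair_measure)
  show "finite_measure (count_space ((Basis :: 'a set) \<times> {0, 1 :: real}))"
    by (rule finite_measure_count_space) simp
qed (rule finite_measure_restrict_lborel_cbox)

interpretation surface: finite_measure "surface_measure :: 'a::euclidean_space measure"
  unfolding surface_measure_def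
  by (intro finite_measure.finite_measure_distr finite_face_measure measurable_face_proj)

lemma sets_surface_measure [simp, measurable_cong]: "sets surface_measure = sets borel"
  and space_surface_measure [simp]: "space surface_measure = UNIV"
  by (simp_all add: surface_measure_def)

lemma integrable_face_measure:
  fixes g :: "'a::euclidean_space \<Rightarrow> real"
  assumes [measurable]: "g \<in> borel_measurable borel" and K: "\<And>x. x \<in> cbox 0 One \<Longrightarrow> norm (g x) \<le> K"
  shows "integrable face_measure (\<lambda>z. g (case z of (i, x) \<Rightarrow> face_proj (fst i) (snd i) x))"
proof (rule finite_measure.integrable_const_bound[OF finite_face_measure, where B = K])
  show "AE z in face_measure. norm (g (case z of (i, x) \<Rightarrow> face_proj (fst i) (snd i) x)) \<le> K"
    by (intro AE_I2 K) (auto simp: space_pair_measure space_restrict_space intro!: face_proj_in_cube)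
  show "(\<lambda>z. g (case z of (i, x) \<Rightarrow> face_proj (fst i) (snd i) x)) \<in> borel_measurable face_measure"
    using measurable_compose[OF measurable_face_proj assms(1)] by simp
qed

lemma integrable_surface_measure_bounded:
  fixes g :: "'a::euclidean_space \<Rightarrow> real"
  assumes "g \<in> borel_measurable borel" "\<And>x. x \<in> cbox 0 One \<Longrightarrow> norm (g x) \<le> K"
  shows "integrable surface_measure g"
  unfolding surface_measure_def
  by (subst integrable_distr_eq[OF measurable_face_proj]) (use assms integrable_face_measure in auto)

text \<open>Fubini over the finite set of faces. Each face integral appears as an integral over the
  whole cube of a function constant in the normal direction, the format in which
  \<open>divergence_cube\<close> states its boundary terms. A bound on the closed cube suffices
  because the projections map the cube into itself.\<close>

lemma integral_surface_measure:
  fixes g :: "'a::euclidean_space \<Rightarrow> real"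
  assumes g: "g \<in> borel_measurable borel" and K: "\<And>x. x \<in> cbox 0 One \<Longrightarrow> norm (g x) \<le> K"
  shows "(\<integral>x. g x \<partial>surface_measure) =
    (\<Sum>b\<in>Basis. \<Sum>c\<in>{0, 1}. \<integral>x. g (face_proj b c x) \<partial>cube_measure)"
proof -
  let ?L = "restrict_space lborel (cbox 0 One) :: 'a measure"
  let ?I = "(Basis :: 'a set) \<times> {0, 1 :: real}"
  interpret L: sigma_finite_measure ?L by (rule sigma_finite_restrict_lborel) simp
  interpret C: sigma_finite_measure "count_space ?I" by (rule sigma_finite_measure_count_space_finite) simp
  interpret P: pair_sigma_finite "count_space ?I" ?L ..
  have "(\<integral>x. g x \<partial>surface_measure) = (\<integral>z. g (case z of (i, x) \<Rightarrow> face_proj (fst i) (snd i) x) \<partial>face_measure)"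
    unfolding surface_measure_def by (rule integral_distr[OF measurable_face_proj g])
  also have "\<dots> = (\<integral>z. (case z of (i, x) \<Rightarrow> g (face_proj (fst i) (snd i) x)) \<partial>face_measure)"
    by (simp add: split_def)
  also have "\<dots> = (\<integral>i. \<integral>x. g (face_proj (fst i) (snd i) x) \<partial>?L \<partial>count_space ?I)"
    using integrable_face_measure[OF assms] by (subst P.integral_fst'[symmetric]) (auto simp: split_def)
  also have "\<dots> = (\<Sum>i\<in>?I. \<integral>x. g (face_proj (fst i) (snd i) x) \<partial>?L)"
    by (rule lebesgue_integral_count_space_finite) simp
  also have "\<dots> = (\<Sum>i\<in>?I. \<integral>x. g (face_proj (fst i) (snd i) x) \<partial>cube_measure)"
    by (intro sum.cong refl integral_cube_measure_restrict[symmetric]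
        measurable_compose[OF face_proj_measurable g])
  also have "\<dots> = (\<Sum>b\<in>Basis. \<Sum>c\<in>{0, 1}. \<integral>x. g (face_proj b c x) \<partial>cube_measure)"
    by (simp only: sum.cartesian_product split_def)
  finally show ?thesis .
qed

lemma continuous_L2_surface:
  fixes f :: "'a::euclidean_space \<Rightarrow> real"
  assumes "continuous_on UNIV f"
  shows "f \<in> L2 surface_measure"
proof -
  have "continuous_on UNIV (\<lambda>x. (f x)\<^sup>2)" by (intro continuous_intros assms)
  from continuous_bounded_on_cube[OF this] obtain K where "\<And>x. x \<in> cbox 0 One \<Longrightarrow> norm ((f x)\<^sup>2) \<le> K" by metis
  with borel_measurable_continuous_onI[OF assms] show ?thesis
    unfolding L2_def using integrable_surface_measure_bounded[of "\<lambda>x. (f x)\<^sup>2" K]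
    by simp
qed

section \<open>Slicing the cube in a coordinate direction\<close>

lemma nn_integral_lborel_slices:
  fixes h :: "'a::euclidean_space \<Rightarrow> ennreal"
  assumes b: "b \<in> Basis" and h [measurable]: "h \<in> borel_measurable borel"
  shows "(\<integral>\<^sup>+x. h x \<partial>lborel) = (\<integral>\<^sup>+\<omega>. \<integral>\<^sup>+t. h ((\<Sum>i\<in>Basis - {b}. \<omega> i *\<^sub>R i) + t *\<^sub>R b) \<partial>lborel
    \<partial>PiM (Basis - {b}) (\<lambda>_. lborel))"
proof -
  interpret product_sigma_finite "\<lambda>_::'a. lborel :: real measure"
    by standard
  have B: "insert b (Basis - {b}) = Basis" using b by auto
  have [measurable]: "(\<lambda>\<omega>. \<Sum>i\<in>Basis. \<omega> i *\<^sub>R i) \<in> PiM Basis (\<lambda>_::'a. lborel :: real measure) \<rightarrow>\<^sub>M borel"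
    by measurable
  have "(\<integral>\<^sup>+x. h x \<partial>lborel) = (\<integral>\<^sup>+\<omega>. h (\<Sum>i\<in>Basis. \<omega> i *\<^sub>R i) \<partial>PiM Basis (\<lambda>_. lborel))"
    by (subst lborel_eq, subst nn_integral_distr) auto
  also have "\<dots> = (\<integral>\<^sup>+\<omega>. h (\<Sum>i\<in>Basis. \<omega> i *\<^sub>R i) \<partial>PiM (insert b (Basis - {b})) (\<lambda>_. lborel))"
    by (simp only: B)
  also have "\<dots> = (\<integral>\<^sup>+\<omega>. \<integral>\<^sup>+t. h (\<Sum>i\<in>Basis. fun_upd \<omega> b t i *\<^sub>R i) \<partial>lborel \<partial>PiM (Basis - {b}) (\<lambda>_. lborel))"
    by (rule product_nn_integral_insert) (auto simp: B)
  also have "(\<lambda>\<omega> t. \<Sum>i\<in>Basis. fun_upd \<omega> b t i *\<^sub>R i) = (\<lambda>\<omega> t. (\<Sum>i\<in>Basis - {b}. \<omega> i *\<^sub>R i) + t *\<^sub>R b)"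
    by (intro ext, subst sum.remove[OF finite_Basis b]) (auto intro!: sum.cong simp: add.commute)
  finally show ?thesis by simp
qed

text \<open>The inner integral is constant in direction b, and the interval has length 1, so the
  outer integral may run over the cube instead of a face. The formula thus fits the volume
  representation of surface integrals.\<close>

lemma nn_integral_cube_slices:
  fixes f :: "'a::euclidean_space \<Rightarrow> ennreal"
  assumes b: "b \<in> Basis" and f [measurable]: "f \<in> borel_measurable borel"
  shows "(\<integral>\<^sup>+x. f x * indicator (cbox 0 One) x \<partial>lborel) =
    (\<integral>\<^sup>+x. (\<integral>\<^sup>+t. f (face_proj b t x) * indicator {0..1} t \<partial>lborel) * indicator (cbox 0 One) x \<partial>lborel)"
    (is "?l = ?r")
proof -
  let ?M = "PiM (Basis - {b}) (\<lambda>_. lborel :: real measure)"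
  define P where "P \<omega> = (\<Sum>i\<in>Basis - {b}. \<omega> i *\<^sub>R i)" for \<omega> :: "'a \<Rightarrow> real"
  define \<phi> where "\<phi> x = (\<integral>\<^sup>+t. f (face_proj b t x) * indicator {0..1} t \<partial>lborel)" for x
  have Pb: "P \<omega> \<bullet> b = 0" for \<omega>
    unfolding P_def inner_sum_left using b by (intro sum.neutral) (auto simp: inner_Basis)
  have fp: "face_proj b t (P \<omega> + s *\<^sub>R b) = P \<omega> + t *\<^sub>R b" for \<omega> s t
    using b by (simp add: face_proj_def inner_add_left Pb inner_Basis algebra_simps)
  have ind: "indicator (cbox 0 One) (P \<omega> + s *\<^sub>R b) =
      (indicator (cbox 0 One) (P \<omega>) * indicator {0..1} s :: ennreal)" for \<omega> s
  proof -
    have "(P \<omega> + s *\<^sub>R b) \<in> cbox 0 One \<longleftrightarrow> P \<omega> \<in> cbox 0 One \<and> s \<in> {0..1}"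
    proof -
      have inner: "(P \<omega> + s *\<^sub>R b) \<bullet> i = (if i = b then s else P \<omega> \<bullet> i)" if "i \<in> Basis" for i
        using that b by (auto simp: inner_add_left inner_Basis Pb)
      have "(\<forall>i\<in>Basis. 0 \<le> (P \<omega> + s *\<^sub>R b) \<bullet> i \<and> (P \<omega> + s *\<^sub>R b) \<bullet> i \<le> 1) \<longleftrightarrow>
          (\<forall>i\<in>Basis. 0 \<le> P \<omega> \<bullet> i \<and> P \<omega> \<bullet> i \<le> 1) \<and> 0 \<le> s \<and> s \<le> 1"
        using b by (simp add: inner if_distrib cong: if_cong ball_cong) (metis Pb order_refl zero_le_one)
      then show ?thesis by (simp add: mem_box)
    qed
    then show ?thesis by (auto simp: indicator_def)
  qed
  have fpm: "(\<lambda>(x, t). face_proj b t x) \<in> borel \<Otimes>\<^sub>M lborel \<rightarrow>\<^sub>M borel"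
    unfolding face_proj_def by measurable
  have "(\<lambda>(x, t). f (face_proj b t x) * indicator {0..1} t) \<in> borel_measurable (borel \<Otimes>\<^sub>M lborel)"
    using measurable_compose[OF fpm f] measurable_compose[OF measurable_snd, of "indicator {0..1}" lborel _ borel]
    by (simp add: split_def borel_measurable_times_ennreal)
  then have [measurable]: "\<phi> \<in> borel_measurable borel"
    unfolding \<phi>_def by (rule lborel.borel_measurable_nn_integral)
  have "?l = (\<integral>\<^sup>+\<omega>. \<integral>\<^sup>+t. f (P \<omega> + t *\<^sub>R b) * indicator (cbox 0 One) (P \<omega> + t *\<^sub>R b) \<partial>lborel \<partial>?M)"
    unfolding P_def by (rule nn_integral_lborel_slices[OF b]) measurable
  also have "\<dots> = (\<integral>\<^sup>+\<omega>. \<phi> (P \<omega>) * indicator (cbox 0 One) (P \<omega>) \<partial>?M)"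
  proof (intro nn_integral_cong)
    fix \<omega>
    have "(\<integral>\<^sup>+t. f (P \<omega> + t *\<^sub>R b) * indicator (cbox 0 One) (P \<omega> + t *\<^sub>R b) \<partial>lborel)
      = (\<integral>\<^sup>+t. (f (P \<omega> + t *\<^sub>R b) * indicator {0..1} t) * indicator (cbox 0 One) (P \<omega>) \<partial>lborel)"
      by (simp add: ind mult_ac)
    also have "\<dots> = (\<integral>\<^sup>+t. f (P \<omega> + t *\<^sub>R b) * indicator {0..1} t \<partial>lborel) * indicator (cbox 0 One) (P \<omega>)"
      by (rule nn_integral_multc) measurable
    also have "(\<integral>\<^sup>+t. f (P \<omega> + t *\<^sub>R b) * indicator {0..1} t \<partial>lborel) = \<phi> (P \<omega>)"
      unfolding \<phi>_def using fp[of _ \<omega> 0] by simp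
    finally show "(\<integral>\<^sup>+t. f (P \<omega> + t *\<^sub>R b) * indicator (cbox 0 One) (P \<omega> + t *\<^sub>R b) \<partial>lborel)
      = \<phi> (P \<omega>) * indicator (cbox 0 One) (P \<omega>)" .
  qed
  \<comment> \<open>The b-coordinate, just integrated out, is put back as a dummy variable of total
    mass 1.\<close>
  also have "\<dots> = (\<integral>\<^sup>+\<omega>. \<integral>\<^sup>+t. \<phi> (P \<omega> + t *\<^sub>R b) * indicator (cbox 0 One) (P \<omega> + t *\<^sub>R b) \<partial>lborel \<partial>?M)"
  proof (intro nn_integral_cong)
    fix \<omega>
    have "\<phi> (P \<omega> + t *\<^sub>R b) = \<phi> (P \<omega>)" for t
      unfolding \<phi>_def using fp[of _ \<omega> 0] by (simp add: fp)
    then have "(\<integral>\<^sup>+t. \<phi> (P \<omega> + t *\<^sub>R b) * indicator (cbox 0 One) (P \<omega> + t *\<^sub>R b) \<partial>lborel)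
      = (\<integral>\<^sup>+t. (\<phi> (P \<omega>) * indicator (cbox 0 One) (P \<omega>)) * indicator {0..1::real} t \<partial>lborel)"
      by (simp add: ind mult_ac)
    also have "\<dots> = \<phi> (P \<omega>) * indicator (cbox 0 One) (P \<omega>)"
      by (subst nn_integral_cmult_indicator) auto
    finally show "\<phi> (P \<omega>) * indicator (cbox 0 One) (P \<omega>) =
      (\<integral>\<^sup>+t. \<phi> (P \<omega> + t *\<^sub>R b) * indicator (cbox 0 One) (P \<omega> + t *\<^sub>R b) \<partial>lborel)" ..
  qed
  also have "\<dots> = (\<integral>\<^sup>+x. \<phi> x * indicator (cbox 0 One) x \<partial>lborel)"
    unfolding P_def by (rule nn_integral_lborel_slices[OF b, symmetric]) measurable
  finally show ?thesis by (simp add: \<phi>_def)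
qed

lemma integral_cube_slices:
  fixes f :: "'a::euclidean_space \<Rightarrow> real"
  assumes b: "b \<in> Basis" and f: "continuous_on UNIV f"
  shows "(\<integral>x. f x \<partial>cube_measure) =
    (\<integral>x. (\<integral>t. f (face_proj b t x) \<partial>restrict_space lborel {0..1}) \<partial>cube_measure)"
proof -
  let ?Q = "restrict_space lborel (cbox 0 One) :: 'a measure"
  let ?I = "restrict_space lborel {0..1} :: real measure"
  let ?F = "\<lambda>(x, t). face_proj b t x"
  interpret Q: finite_measure ?Q by (rule finite_measure_restrict_lborel_cbox)
  interpret I: finite_measure ?I by (metis finite_measure_restrict_lborel_cbox box_real(2))
  interpret P: pair_sigma_finite ?Q ?I ..
  have [measurable]: "f \<in> borel_measurable borel" by (rule borel_measurable_continuous_onI[OF f])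
  have [measurable]: "(\<lambda>x. x) \<in> ?Q \<rightarrow>\<^sub>M borel" "(\<lambda>x. x) \<in> ?I \<rightarrow>\<^sub>M borel"
    by (auto intro!: measurable_restrict_space1)
  have fst_m: "fst \<in> ?Q \<Otimes>\<^sub>M ?I \<rightarrow>\<^sub>M borel"
    using measurable_compose[OF measurable_fst, of "\<lambda>x. x" ?Q borel ?I] by simp
  have snd_m: "snd \<in> ?Q \<Otimes>\<^sub>M ?I \<rightarrow>\<^sub>M borel"
    using measurable_compose[OF measurable_snd, of "\<lambda>x. x" ?I borel ?Q] by simp
  have F [measurable]: "?F \<in> ?Q \<Otimes>\<^sub>M ?I \<rightarrow>\<^sub>M borel"
    unfolding face_proj_def split_def using fst_m snd_m by measurable
  \<comment> \<open>Applied to indicators, the slicing formula says that the cube is the image of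
    cube times interval under \<open>face_proj\<close>. As an identity of measures it also covers
    signed integrands.\<close>
  have eq: "distr ?Q borel (\<lambda>x. x) = distr (?Q \<Otimes>\<^sub>M ?I) borel ?F"
  proof (rule measure_eqI)
    fix A assume "A \<in> sets (distr ?Q borel (\<lambda>x. x))"
    then have A [measurable]: "A \<in> sets borel" by simp
    have "emeasure (distr ?Q borel (\<lambda>x. x)) A = (\<integral>\<^sup>+x. indicator A x \<partial>distr ?Q borel (\<lambda>x. x))" by simp
    also have "\<dots> = (\<integral>\<^sup>+x. indicator A x \<partial>?Q)" by (rule nn_integral_distr) auto
    also have "\<dots> = (\<integral>\<^sup>+x. indicator A x * indicator (cbox 0 One) x \<partial>lborel)"
      by (rule nn_integral_restrict_space) auto
    also have "\<dots> = (\<integral>\<^sup>+x. (\<integral>\<^sup>+t. indicator A (face_proj b t x) * indicator {0..1} t \<partial>lborel) * indicator (cbox 0 One) x \<partial>lborel)"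
      by (rule nn_integral_cube_slices[OF b]) auto
    also have "\<dots> = (\<integral>\<^sup>+x. (\<integral>\<^sup>+t. indicator A (face_proj b t x) \<partial>?I) \<partial>?Q)"
      by (simp add: nn_integral_restrict_space)
    also have "\<dots> = (\<integral>\<^sup>+z. indicator A (?F z) \<partial>(?Q \<Otimes>\<^sub>M ?I))"
      by (subst I.nn_integral_fst[symmetric]) (auto simp: split_def)
    also have "\<dots> = emeasure (distr (?Q \<Otimes>\<^sub>M ?I) borel ?F) A"
      by (subst nn_integral_distr[symmetric, OF F]) auto
    finally show "emeasure (distr ?Q borel (\<lambda>x. x)) A = emeasure (distr (?Q \<Otimes>\<^sub>M ?I) borel ?F) A" .
  qed simp
  obtain K where K: "\<And>x. x \<in> cbox 0 One \<Longrightarrow> norm (f x) \<le> K"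
    using continuous_bounded_on_cube[OF f] by metis
  interpret QI: finite_measure "?Q \<Otimes>\<^sub>M ?I"
    by (rule finite_measure_pair_measure) unfold_locales
  have "integrable (?Q \<Otimes>\<^sub>M ?I) (\<lambda>z. f (?F z))"
    using b by (intro QI.integrable_const_bound[where B = K] AE_I2 K)
      (auto simp: space_pair_measure space_restrict_space intro!: face_proj_in_cube)
  then have int: "integrable (?Q \<Otimes>\<^sub>M ?I) (\<lambda>(x, t). f (face_proj b t x))" by (simp add: split_def)
  have "(\<integral>x. f x \<partial>cube_measure) = (\<integral>x. f x \<partial>?Q)" by (rule integral_cube_measure_restrict) simp
  also have "\<dots> = (\<integral>x. f x \<partial>distr ?Q borel (\<lambda>x. x))" by (subst integral_distr) auto
  also have "\<dots> = (\<integral>z. f (?F z) \<partial>(?Q \<Otimes>\<^sub>M ?I))" unfolding eq by (subst integral_distr) auto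
  also have "\<dots> = (\<integral>x. (\<integral>t. f (face_proj b t x) \<partial>?I) \<partial>?Q)"
    using P.integral_fst'[OF int] by (simp add: split_def)
  also have "\<dots> = (\<integral>x. (\<integral>t. f (face_proj b t x) \<partial>?I) \<partial>cube_measure)"
  proof (rule integral_cube_measure_restrict[symmetric])
    show "(\<lambda>x. \<integral>t. f (face_proj b t x) \<partial>?I) \<in> borel_measurable borel"
      unfolding face_proj_def by measurable
  qed
  finally show ?thesis .
qed

section \<open>Continuously differentiable functions on the cube\<close>

lemma C1_D:
  assumes "f \<in> C1"
  shows C1_has_derivative: "(f has_derivative frechet_derivative f (at x)) (at x)"
    and C1_continuous_partial: "b \<in> Basis \<Longrightarrow> continuous_on UNIV (partial_deriv b f)"
  using assms frechet_derivative_works by (auto simp: C1_def)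

lemma C1_continuous: "f \<in> C1 \<Longrightarrow> continuous_on UNIV f"
  unfolding C1_def by (auto intro!: continuous_at_imp_continuous_on differentiable_imp_continuous_within)

lemma partial_deriv_eqI: "(f has_derivative f') (at x) \<Longrightarrow> partial_deriv b f x = f' b"
  unfolding partial_deriv_def by (simp flip: frechet_derivative_at)

lemma C1I:
  assumes "\<And>x. (f has_derivative f' x) (at x)" "\<And>b. b \<in> Basis \<Longrightarrow> continuous_on UNIV (\<lambda>x. f' x b)"
  shows "f \<in> C1"
proof -
  have "partial_deriv b f = (\<lambda>x. f' x b)" for b
    using partial_deriv_eqI[OF assms(1)] by auto
  with assms show ?thesis by (auto simp: C1_def differentiable_def)
qed

lemma frechet_derivative_partial:
  fixes f :: "'a::euclidean_space \<Rightarrow> real"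
  assumes "f differentiable at x"
  shows "frechet_derivative f (at x) h = (\<Sum>b\<in>Basis. (h \<bullet> b) * partial_deriv b f x)"
proof -
  have l: "linear (frechet_derivative f (at x))"
    using assms by (rule linear_frechet_derivative)
  have "frechet_derivative f (at x) h = frechet_derivative f (at x) (\<Sum>b\<in>Basis. (h \<bullet> b) *\<^sub>R b)"
    by (simp add: euclidean_representation)
  also have "\<dots> = (\<Sum>b\<in>Basis. (h \<bullet> b) * partial_deriv b f x)"
    unfolding partial_deriv_def by (simp add: linear_sum[OF l] linear_scale[OF l])
  finally show ?thesis .
qed

lemma C1_mult:
  assumes "f \<in> C1" "g \<in> C1"
  shows "(\<lambda>x. f x * g x) \<in> C1"
    and "partial_deriv b (\<lambda>x. f x * g x) x = f x * partial_deriv b g x + partial_deriv b f x * g x"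
proof -
  have d: "((\<lambda>x. f x * g x) has_derivative
      (\<lambda>h. f x * frechet_derivative g (at x) h + frechet_derivative f (at x) h * g x)) (at x)" for x
    by (rule has_derivative_mult[OF C1_has_derivative[OF assms(1)] C1_has_derivative[OF assms(2)]])
  show "(\<lambda>x. f x * g x) \<in> C1"
  proof (rule C1I[OF d])
    fix b :: 'a assume b: "b \<in> Basis"
    show "continuous_on UNIV (\<lambda>x. f x * frechet_derivative g (at x) b + frechet_derivative f (at x) b * g x)"
      unfolding partial_deriv_def[symmetric]
      by (intro continuous_intros C1_continuous[OF assms(1)] C1_continuous[OF assms(2)]
          C1_continuous_partial[OF assms(1) b] C1_continuous_partial[OF assms(2) b])
  qed
  show "partial_deriv b (\<lambda>x. f x * g x) x = f x * partial_deriv b g x + partial_deriv b f x * g x"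
    using partial_deriv_eqI[OF d] by (simp add: partial_deriv_def)
qed

lemma C1_affine:
  fixes a :: "'a::euclidean_space"
  shows "(\<lambda>x. c + a \<bullet> x) \<in> C1" "partial_deriv b (\<lambda>x. c + a \<bullet> x) x = a \<bullet> b"
proof -
  have d: "((\<lambda>x. c + a \<bullet> x) has_derivative (\<lambda>h. a \<bullet> h)) (at x)" for x
    by (auto intro!: derivative_eq_intros)
  show "(\<lambda>x. c + a \<bullet> x) \<in> C1" by (rule C1I[OF d]) simp
  show "partial_deriv b (\<lambda>x. c + a \<bullet> x) x = a \<bullet> b" by (rule partial_deriv_eqI[OF d])
qed

lemma C1_diff:
  assumes "f \<in> C1" "g \<in> C1"
  shows "(\<lambda>x. f x - g x) \<in> C1"
    and "partial_deriv b (\<lambda>x. f x - g x) x = partial_deriv b f x - partial_deriv b g x"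
proof -
  have d: "((\<lambda>x. f x - g x) has_derivative
      (\<lambda>h. frechet_derivative f (at x) h - frechet_derivative g (at x) h)) (at x)" for x
    by (rule has_derivative_diff[OF C1_has_derivative[OF assms(1)] C1_has_derivative[OF assms(2)]])
  show "(\<lambda>x. f x - g x) \<in> C1"
  proof (rule C1I[OF d])
    fix b :: 'a assume b: "b \<in> Basis"
    show "continuous_on UNIV (\<lambda>x. frechet_derivative f (at x) b - frechet_derivative g (at x) b)"
      unfolding partial_deriv_def[symmetric]
      by (intro continuous_intros C1_continuous_partial[OF assms(1) b] C1_continuous_partial[OF assms(2) b])
  qed
  show "partial_deriv b (\<lambda>x. f x - g x) x = partial_deriv b f x - partial_deriv b g x"
    using partial_deriv_eqI[OF d] by (simp add: partial_deriv_def)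
qed

text \<open>The fundamental theorem of calculus on every segment in direction b, averaged over the
  cube; the end points of the segments lie on the two opposite faces.\<close>

lemma divergence_cube:
  fixes f :: "'a::euclidean_space \<Rightarrow> real"
  assumes b: "b \<in> Basis" and f: "f \<in> C1"
  shows "(\<integral>x. partial_deriv b f x \<partial>cube_measure) =
    (\<integral>x. f (face_proj b 1 x) \<partial>cube_measure) - (\<integral>x. f (face_proj b 0 x) \<partial>cube_measure)"
proof -
  have cont: "continuous_on UNIV (\<lambda>x. f (face_proj b c x))" for c
    by (rule continuous_on_compose2[OF C1_continuous[OF f]]) (auto intro!: continuous_intros)
  have ftc: "(\<integral>t. partial_deriv b f (face_proj b t x) \<partial>restrict_space lborel {0..1}) =
      f (face_proj b 1 x) - f (face_proj b 0 x)" for x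
  proof -
    have "(\<integral>t. partial_deriv b f (face_proj b t x) \<partial>restrict_space lborel {0..1}) =
        (\<integral>t. indicator {0..1} t *\<^sub>R partial_deriv b f (face_proj b t x) \<partial>lborel)"
      by (rule integral_restrict_space) auto
    also have "\<dots> = f (face_proj b 1 x) - f (face_proj b 0 x)"
    proof (rule integral_FTC_atLeastAtMost)
      show "continuous_on {0..1} (\<lambda>t. partial_deriv b f (face_proj b t x))"
        by (rule continuous_on_compose2[OF C1_continuous_partial[OF f b]]) (auto intro!: continuous_intros)
      fix t :: real
      have "((\<lambda>t. face_proj b t x) has_derivative (\<lambda>h. h *\<^sub>R b)) (at t within {0..1})"
        unfolding face_proj_def by (auto intro!: derivative_eq_intros)
      from has_derivative_compose[OF this C1_has_derivative[OF f]]
      have "((\<lambda>t. f (face_proj b t x)) has_derivative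
          (\<lambda>h. frechet_derivative f (at (face_proj b t x)) (h *\<^sub>R b))) (at t within {0..1})" .
      moreover have "frechet_derivative f (at (face_proj b t x)) (h *\<^sub>R b) =
          h *\<^sub>R partial_deriv b f (face_proj b t x)" for h
        using linear_frechet_derivative[of f "at (face_proj b t x)"] f
        by (simp add: C1_def partial_deriv_def linear_scale)
      ultimately show "((\<lambda>t. f (face_proj b t x)) has_vector_derivative
          partial_deriv b f (face_proj b t x)) (at t within {0..1})"
        by (simp add: has_vector_derivative_def)
    qed simp
    finally show ?thesis .
  qed
  have "(\<integral>x. partial_deriv b f x \<partial>cube_measure) =
      (\<integral>x. f (face_proj b 1 x) - f (face_proj b 0 x) \<partial>cube_measure)"
    using integral_cube_slices[OF b C1_continuous_partial[OF f b]] by (simp add: ftc)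
  also have "\<dots> = (\<integral>x. f (face_proj b 1 x) \<partial>cube_measure) - (\<integral>x. f (face_proj b 0 x) \<partial>cube_measure)"
    by (intro Bochner_Integration.integral_diff integrable_cube_measure_continuous cont)
  finally show ?thesis .
qed

section \<open>Green's formula and boundary inequalities for continuously differentiable
  functions\<close>

definition grad_norm2 :: "('a::euclidean_space \<Rightarrow> real) \<Rightarrow> real" where
  "grad_norm2 v = (\<Sum>b\<in>Basis. (L2_norm cube_measure (partial_deriv b v))\<^sup>2)"

lemma outer_normal_inner:
  assumes i: "i \<in> Basis"
  shows "outer_normal x \<bullet> i = (if x \<bullet> i = 1 then 1 else if x \<bullet> i = 0 then - 1 else 0)"
proof -
  have "outer_normal x \<bullet> i = (\<Sum>j\<in>Basis. (if x \<bullet> j = 1 then j else if x \<bullet> j = 0 then - j else 0) \<bullet> i)"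
    unfolding outer_normal_def inner_sum_left ..
  also have "\<dots> = (\<Sum>j\<in>Basis. if j = i then (if x \<bullet> j = 1 then 1 else if x \<bullet> j = 0 then - 1 else 0) else 0)"
    using i by (intro sum.cong refl) (simp add: inner_Basis)
  finally show ?thesis using i by simp
qed

text \<open>A point of the open cube projects into the relative interior of the face, away from the
  edges where several summands of \<open>outer_normal\<close> are nonzero. Almost every point of the
  cube is of this kind, so the edges drop out of the integrals.\<close>

lemma outer_normal_face:
  assumes b: "b \<in> Basis" and i: "i \<in> Basis" and c: "c \<in> {0, 1}" and x: "x \<in> box 0 (One :: 'a::euclidean_space)"
  shows "outer_normal (face_proj b c x) \<bullet> i = (if i = b then 2 * c - 1 else 0)"
proof -
  have "0 < x \<bullet> i" "x \<bullet> i < 1" using x i by (auto simp: mem_box)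
  then show ?thesis using c face_proj_inner[OF b i, of c x] by (auto simp: outer_normal_inner[OF i])
qed

lemma outer_normal_measurable [measurable]: "outer_normal \<in> borel_measurable borel"
proof -
  have [measurable]: "(\<lambda>x. x \<bullet> b) \<in> borel_measurable borel" for b :: 'a
    by (intro borel_measurable_continuous_onI continuous_intros)
  show ?thesis
    unfolding outer_normal_def by (intro borel_measurable_sum) measurable
qed

lemma norm_outer_normal: "(norm (outer_normal (x::'a::euclidean_space)))\<^sup>2 \<le> DIM('a)"
proof -
  have "(norm (outer_normal x))\<^sup>2 = (\<Sum>i\<in>Basis. (outer_normal x \<bullet> i)\<^sup>2)"
    unfolding power2_norm_eq_inner by (subst euclidean_inner) (simp add: power2_eq_square)
  also have "\<dots> \<le> (\<Sum>i\<in>(Basis::'a set). 1)"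
    by (intro sum_mono) (simp add: outer_normal_inner)
  finally show ?thesis by simp
qed

lemma green_C1:
  fixes v w :: "'a::euclidean_space \<Rightarrow> real"
  assumes v: "v \<in> C1" and w: "w \<in> C1" and b: "b \<in> Basis"
  shows "(\<integral>x. v x * partial_deriv b w x \<partial>cube_measure) + (\<integral>x. partial_deriv b v x * w x \<partial>cube_measure)
    = (\<integral>x. (outer_normal x \<bullet> b) * v x * w x \<partial>surface_measure)"
proof -
  note [measurable] = borel_measurable_continuous_onI[OF C1_continuous[OF v]]
    borel_measurable_continuous_onI[OF C1_continuous[OF w]]
  let ?g = "\<lambda>x. (outer_normal x \<bullet> b) * v x * w x"
  have vw: "continuous_on UNIV (\<lambda>x. v x * w x)"
    by (intro continuous_intros C1_continuous v w)
  obtain K where K: "0 \<le> K" "\<And>x. x \<in> cbox 0 One \<Longrightarrow> norm (v x * w x) \<le> K"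
    using continuous_bounded_on_cube[OF vw] by metis
  have on: "\<bar>outer_normal x \<bullet> b\<bar> \<le> DIM('a)" for x :: 'a
  proof -
    have "\<bar>outer_normal x \<bullet> b\<bar> \<le> norm (outer_normal x)" using b by (rule Basis_le_norm)
    also have "\<dots> \<le> DIM('a)"
    proof (rule power2_le_imp_le)
      have "real DIM('a) \<le> (real DIM('a))\<^sup>2"
        using DIM_ge_Suc0[where 'a='a] by (intro self_le_power) linarith+
      with norm_outer_normal[of x] show "(norm (outer_normal x))\<^sup>2 \<le> (real DIM('a))\<^sup>2" by linarith
    qed simp
    finally show ?thesis .
  qed
  have bd: "norm (?g x) \<le> DIM('a) * K" if "x \<in> cbox 0 One" for x
  proof -
    have "norm (?g x) = \<bar>outer_normal x \<bullet> b\<bar> * norm (v x * w x)" by (simp add: abs_mult)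
    also have "\<dots> \<le> DIM('a) * K" using on[of x] K(2)[OF that] K(1) by (intro mult_mono) auto
    finally show ?thesis .
  qed
  \<comment> \<open>Only the two faces orthogonal to b survive; \<open>2 * c - 1\<close> is the sign
    of the normal on the face with coordinate c.\<close>
  have face: "(\<integral>x. ?g (face_proj i c x) \<partial>cube_measure) =
      (if i = b then (2 * c - 1) * (\<integral>x. v (face_proj b c x) * w (face_proj b c x) \<partial>cube_measure) else 0)"
    if i: "i \<in> Basis" and c: "c \<in> {0, 1}" for i c
  proof -
    have "(\<integral>x. ?g (face_proj i c x) \<partial>cube_measure) =
      (\<integral>x. (if i = b then (2 * c - 1) * (v (face_proj b c x) * w (face_proj b c x)) else 0) \<partial>cube_measure)"
    proof (rule integral_cong_AE)
      show "AE x in cube_measure. ?g (face_proj i c x) =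
          (if i = b then (2 * c - 1) * (v (face_proj b c x) * w (face_proj b c x)) else 0)"
        using AE_cube_measure_box
      proof eventually_elim
        case (elim x)
        then show ?case using outer_normal_face[OF i b c elim] by simp
      qed
    qed (intro borel_measurable_cube_measure, measurable)+
    then show ?thesis by simp
  qed
  have "(\<integral>x. ?g x \<partial>surface_measure) = (\<Sum>i\<in>Basis. \<Sum>c\<in>{0, 1}. \<integral>x. ?g (face_proj i c x) \<partial>cube_measure)"
    by (rule integral_surface_measure[OF _ bd]) measurable
  also have "\<dots> = (\<Sum>i\<in>Basis. if i = b then
     (\<integral>x. v (face_proj b 1 x) * w (face_proj b 1 x) \<partial>cube_measure) -
     (\<integral>x. v (face_proj b 0 x) * w (face_proj b 0 x) \<partial>cube_measure) else 0)"
    by (intro sum.cong refl) (simp add: face)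
  also have "\<dots> = (\<integral>x. v (face_proj b 1 x) * w (face_proj b 1 x) \<partial>cube_measure) -
     (\<integral>x. v (face_proj b 0 x) * w (face_proj b 0 x) \<partial>cube_measure)"
    using b by simp
  also have "\<dots> = (\<integral>x. partial_deriv b (\<lambda>x. v x * w x) x \<partial>cube_measure)"
    by (rule divergence_cube[OF b C1_mult(1)[OF v w], symmetric])
  also have "\<dots> = (\<integral>x. v x * partial_deriv b w x \<partial>cube_measure) + (\<integral>x. partial_deriv b v x * w x \<partial>cube_measure)"
    unfolding C1_mult(2)[OF v w]
    by (intro Bochner_Integration.integral_add integrable_cube_measure_continuous continuous_intros
       C1_continuous[OF v] C1_continuous[OF w]
       C1_continuous_partial[OF v b] C1_continuous_partial[OF w b])
  finally show ?thesis by simp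
qed

lemma L2_norm_surface_faces:
  fixes v :: "'a::euclidean_space \<Rightarrow> real"
  assumes v: "continuous_on UNIV v"
  shows "(L2_norm surface_measure v)\<^sup>2 =
    (\<Sum>b\<in>Basis. (\<integral>x. (v (face_proj b 0 x))\<^sup>2 \<partial>cube_measure) + (\<integral>x. (v (face_proj b 1 x))\<^sup>2 \<partial>cube_measure))"
proof -
  have v2: "continuous_on UNIV (\<lambda>x. (v x)\<^sup>2)" by (intro continuous_intros v)
  from continuous_bounded_on_cube[OF this] obtain K where "\<And>x. x \<in> cbox 0 One \<Longrightarrow> norm ((v x)\<^sup>2) \<le> K" by metis
  from integral_surface_measure[OF borel_measurable_continuous_onI[OF v2] this]
  show ?thesis by (simp add: L2_norm_power2)
qed

lemma abs_le_one_mult_bounds: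
  fixes a t :: real
  assumes "\<bar>a\<bar> \<le> 1"
  shows "a * t \<le> \<bar>t\<bar>" "- (a * t) \<le> \<bar>t\<bar>"
proof -
  have "\<bar>a * t\<bar> \<le> \<bar>t\<bar>"
    using mult_right_mono[OF assms abs_ge_zero[of t]] by (simp add: abs_mult)
  then show "a * t \<le> \<bar>t\<bar>" "- (a * t) \<le> \<bar>t\<bar>" by linarith+
qed

text \<open>The weight is -1 on the face at 0 and 1 on the face at 1, hence equal to the normal
  component: both faces enter the divergence theorem with a positive sign. Summing over b collects
  the entire boundary.\<close>

lemma trace_inequality_C1:
  fixes v :: "'a::euclidean_space \<Rightarrow> real"
  assumes v: "v \<in> C1"
  shows "(L2_norm surface_measure v)\<^sup>2 \<le> 3 * DIM('a) * ((L2_norm cube_measure v)\<^sup>2 + grad_norm2 v)"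
proof -
  have face: "(\<integral>x. (v (face_proj b 0 x))\<^sup>2 \<partial>cube_measure) + (\<integral>x. (v (face_proj b 1 x))\<^sup>2 \<partial>cube_measure)
      \<le> 3 * (L2_norm cube_measure v)\<^sup>2 + (L2_norm cube_measure (partial_deriv b v))\<^sup>2"
    if b: "b \<in> Basis" for b
  proof -
    let ?a = "\<lambda>x. - 1 + (2 *\<^sub>R b) \<bullet> x"
    have a: "?a \<in> C1" by (rule C1_affine)
    have vv: "(\<lambda>x. v x * v x) \<in> C1" by (rule C1_mult[OF v v])
    have f: "(\<lambda>x. ?a x * (v x * v x)) \<in> C1" by (rule C1_mult[OF a vv])
    note cont = C1_continuous[OF v] C1_continuous_partial[OF v b] C1_continuous[OF a]
    have fp: "?a (face_proj b c x) = 2 * c - 1" for c x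
      using b face_proj_inner[OF b b, of c x] by (simp add: inner_commute)
    have "(\<integral>x. (v (face_proj b 0 x))\<^sup>2 \<partial>cube_measure) + (\<integral>x. (v (face_proj b 1 x))\<^sup>2 \<partial>cube_measure)
        = (\<integral>x. partial_deriv b (\<lambda>x. ?a x * (v x * v x)) x \<partial>cube_measure)"
      unfolding divergence_cube[OF b f] fp by (simp add: power2_eq_square)
    also have "\<dots> = (\<integral>x. ?a x * (2 * v x * partial_deriv b v x) + 2 * (v x)\<^sup>2 \<partial>cube_measure)"
      unfolding C1_mult(2)[OF a vv] C1_mult(2)[OF v v] C1_affine(2)
      using b by (simp add: power2_eq_square algebra_simps)
    \<comment> \<open>The 3 is 2 from the derivative of the weight plus 1 from Young's inequality
      for the mixed term.\<close>
    also have "\<dots> \<le> (\<integral>x. 3 * (v x)\<^sup>2 + (partial_deriv b v x)\<^sup>2 \<partial>cube_measure)"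
    proof (rule integral_mono)
      fix x :: 'a assume "x \<in> space cube_measure"
      then have "0 \<le> x \<bullet> b" "x \<bullet> b \<le> 1" using b by (auto simp: mem_box)
      then have "\<bar>?a x\<bar> \<le> 1" by (simp add: inner_commute abs_le_iff)
      then have "?a x * (2 * v x * partial_deriv b v x) \<le> \<bar>2 * v x * partial_deriv b v x\<bar>"
        by (rule abs_le_one_mult_bounds)
      also have "\<dots> \<le> (v x)\<^sup>2 + (partial_deriv b v x)\<^sup>2"
        using sum_squares_bound[of "\<bar>v x\<bar>" "\<bar>partial_deriv b v x\<bar>"] by (simp add: abs_mult)
      finally show "?a x * (2 * v x * partial_deriv b v x) + 2 * (v x)\<^sup>2 \<le> 3 * (v x)\<^sup>2 + (partial_deriv b v x)\<^sup>2"
        by simp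
    qed (intro integrable_cube_measure_continuous continuous_intros cont)+
    also have "\<dots> = 3 * (L2_norm cube_measure v)\<^sup>2 + (L2_norm cube_measure (partial_deriv b v))\<^sup>2"
      unfolding L2_norm_power2
      by (subst Bochner_Integration.integral_add)
         (intro integrable_cube_measure_continuous continuous_intros cont | simp)+
    finally show ?thesis .
  qed
  have "(L2_norm surface_measure v)\<^sup>2 \<le>
      (\<Sum>b\<in>(Basis::'a set). 3 * (L2_norm cube_measure v)\<^sup>2 + (L2_norm cube_measure (partial_deriv b v))\<^sup>2)"
    unfolding L2_norm_surface_faces[OF C1_continuous[OF v]] by (intro sum_mono face)
  also have "\<dots> = 3 * DIM('a) * (L2_norm cube_measure v)\<^sup>2 + grad_norm2 v"
    by (simp add: sum.distrib grad_norm2_def)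
  also have "\<dots> \<le> 3 * DIM('a) * (L2_norm cube_measure v)\<^sup>2 + 3 * DIM('a) * grad_norm2 v"
  proof -
    have "1 * grad_norm2 v \<le> (3 * DIM('a)) * grad_norm2 v"
      by (intro mult_right_mono) (auto simp: grad_norm2_def Suc_le_eq sum_nonneg intro: order_trans[of _ "3 * 1"])
    then show ?thesis by simp
  qed
  finally show ?thesis by (simp add: algebra_simps)
qed

text \<open>A single direction b is enough. The weight vanishes on the face at 0 and is 1 on the
  face at 1, so the square of v over the cube is bounded by one face and a mixed term.\<close>

lemma friedrichs_inequality_C1:
  fixes v :: "'a::euclidean_space \<Rightarrow> real"
  assumes v: "v \<in> C1"
  shows "(L2_norm cube_measure v)\<^sup>2 \<le> 4 * grad_norm2 v + 2 * (L2_norm surface_measure v)\<^sup>2"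
proof -
  obtain b :: 'a where b: "b \<in> Basis" using nonempty_Basis by blast
  let ?a = "\<lambda>x. 0 + b \<bullet> x"
  have a: "?a \<in> C1" by (rule C1_affine)
  have vv: "(\<lambda>x. v x * v x) \<in> C1" by (rule C1_mult[OF v v])
  have f: "(\<lambda>x. ?a x * (v x * v x)) \<in> C1" by (rule C1_mult[OF a vv])
  note cont = C1_continuous[OF v] C1_continuous_partial[OF v b] C1_continuous[OF a]
  have fp: "?a (face_proj b c x) = c" for c x
    using b face_proj_inner[OF b b, of c x] by (simp add: inner_commute)
  have "(L2_norm cube_measure v)\<^sup>2 / 2 - 2 * (L2_norm cube_measure (partial_deriv b v))\<^sup>2
     = (\<integral>x. (v x)\<^sup>2 / 2 - 2 * (partial_deriv b v x)\<^sup>2 \<partial>cube_measure)"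
    unfolding L2_norm_power2
    by (subst Bochner_Integration.integral_diff)
       (intro integrable_cube_measure_continuous continuous_intros cont | simp)+
  also have "\<dots> \<le> (\<integral>x. ?a x * (2 * v x * partial_deriv b v x) + (v x)\<^sup>2 \<partial>cube_measure)"
  proof (rule integral_mono)
    fix x :: 'a assume "x \<in> space cube_measure"
    then have "0 \<le> x \<bullet> b" "x \<bullet> b \<le> 1" using b by (auto simp: mem_box)
    then have "\<bar>?a x\<bar> \<le> 1" by (simp add: inner_commute)
    then have "- (?a x * (2 * v x * partial_deriv b v x)) \<le> \<bar>2 * v x * partial_deriv b v x\<bar>"
      by (rule abs_le_one_mult_bounds)
    \<comment> \<open>Young's inequality is weighted so that half of the square of v remains;
      doubling at the end produces the constants 4 and 2.\<close>
    also have "\<dots> \<le> (v x)\<^sup>2 / 2 + 2 * (partial_deriv b v x)\<^sup>2"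
      using sum_squares_bound[of "\<bar>v x\<bar>" "2 * \<bar>partial_deriv b v x\<bar>"] by (simp add: abs_mult power_mult_distrib)
    finally show "(v x)\<^sup>2 / 2 - 2 * (partial_deriv b v x)\<^sup>2 \<le> ?a x * (2 * v x * partial_deriv b v x) + (v x)\<^sup>2"
      by (simp add: algebra_simps)
  qed (intro integrable_cube_measure_continuous continuous_intros cont, simp?)+
  also have "\<dots> = (\<integral>x. partial_deriv b (\<lambda>x. ?a x * (v x * v x)) x \<partial>cube_measure)"
    unfolding C1_mult(2)[OF a vv] C1_mult(2)[OF v v] C1_affine(2)
    using b by (simp add: power2_eq_square algebra_simps)
  also have "\<dots> = (\<integral>x. (v (face_proj b 1 x))\<^sup>2 \<partial>cube_measure)"
    unfolding divergence_cube[OF b f] fp by (simp add: power2_eq_square)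
  also have "\<dots> \<le> (L2_norm surface_measure v)\<^sup>2"
  proof -
    have "(\<integral>x. (v (face_proj b 0 x))\<^sup>2 \<partial>cube_measure) + (\<integral>x. (v (face_proj b 1 x))\<^sup>2 \<partial>cube_measure)
       \<le> (L2_norm surface_measure v)\<^sup>2"
      unfolding L2_norm_surface_faces[OF C1_continuous[OF v]]
      by (rule member_le_sum[OF b]) auto
    moreover have "0 \<le> (\<integral>x. (v (face_proj b 0 x))\<^sup>2 \<partial>cube_measure)" by simp
    ultimately show ?thesis by linarith
  qed
  finally have "(L2_norm cube_measure v)\<^sup>2 / 2 \<le>
    2 * (L2_norm cube_measure (partial_deriv b v))\<^sup>2 + (L2_norm surface_measure v)\<^sup>2" by simp
  moreover have "(L2_norm cube_measure (partial_deriv b v))\<^sup>2 \<le> grad_norm2 v"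
    unfolding grad_norm2_def by (rule member_le_sum[OF b]) auto
  ultimately show ?thesis by simp
qed

section \<open>The Poincare inequality for continuously differentiable functions\<close>

text \<open>Joint measurability is easiest for the Borel product; from there it passes to the
  products of restricted or completed measures on which Fubini is applied.\<close>

lemma measurable_pair_borel:
  assumes "g \<in> borel \<Otimes>\<^sub>M borel \<rightarrow>\<^sub>M N" "(\<lambda>x. x) \<in> M1 \<rightarrow>\<^sub>M borel" "(\<lambda>x. x) \<in> M2 \<rightarrow>\<^sub>M borel"
  shows "g \<in> M1 \<Otimes>\<^sub>M M2 \<rightarrow>\<^sub>M N"
proof -
  have "(\<lambda>p. (fst p, snd p)) \<in> M1 \<Otimes>\<^sub>M M2 \<rightarrow>\<^sub>M borel \<Otimes>\<^sub>M borel"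
    by (intro measurable_Pair measurable_compose[OF measurable_fst assms(2)]
        measurable_compose[OF measurable_snd assms(3)])
  from measurable_compose[OF this assms(1)] show ?thesis by simp
qed

lemma id_measurable_cube: "(\<lambda>x. x) \<in> cube_measure \<rightarrow>\<^sub>M borel"
  by (intro borel_measurable_cube_measure) simp

lemma nn_integral_lborel_affine:
  fixes f :: "'a::euclidean_space \<Rightarrow> ennreal"
  assumes "f \<in> borel_measurable borel" "c \<noteq> 0"
  shows "(\<integral>\<^sup>+x. f x \<partial>lborel) = ennreal (\<bar>c\<bar> ^ DIM('a)) * (\<integral>\<^sup>+x. f (a + c *\<^sub>R x) \<partial>lborel)"
proof -
  have m: "(\<lambda>x. a + c *\<^sub>R x) \<in> lborel \<rightarrow>\<^sub>M borel" by measurable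
  have "(\<integral>\<^sup>+x. f x \<partial>lborel) =
      (\<integral>\<^sup>+x. f x \<partial>density (distr lborel borel (\<lambda>x. a + c *\<^sub>R x)) (\<lambda>_. ennreal (\<bar>c\<bar> ^ DIM('a))))"
    using lborel_affine[OF assms(2), of a] by simp
  also have "\<dots> = (\<integral>\<^sup>+x. ennreal (\<bar>c\<bar> ^ DIM('a)) * f x \<partial>distr lborel borel (\<lambda>x. a + c *\<^sub>R x))"
    using assms(1) by (intro nn_integral_density) auto
  also have "\<dots> = (\<integral>\<^sup>+x. ennreal (\<bar>c\<bar> ^ DIM('a)) * f (a + c *\<^sub>R x) \<partial>lborel)"
    using assms(1) by (intro nn_integral_distr m) measurable
  also have "\<dots> = ennreal (\<bar>c\<bar> ^ DIM('a)) * (\<integral>\<^sup>+x. f (a + c *\<^sub>R x) \<partial>lborel)"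
    using measurable_compose[OF m assms(1)] by (intro nn_integral_cmult) simp
  finally show ?thesis .
qed

text \<open>By convexity the contraction towards y maps the cube into itself. Substitution costs the
  Jacobian, and enlarging the image to the full cube is harmless for a nonnegative
  integrand.\<close>

lemma nn_integral_cube_contraction:
  fixes f :: "'a::euclidean_space \<Rightarrow> ennreal"
  assumes f: "f \<in> borel_measurable borel" and t: "0 < t" "t \<le> 1" and y: "y \<in> cbox 0 One"
  shows "ennreal (t ^ DIM('a)) * (\<integral>\<^sup>+x. f ((1 - t) *\<^sub>R y + t *\<^sub>R x) \<partial>cube_measure) \<le> (\<integral>\<^sup>+x. f x \<partial>cube_measure)"
proof -
  have m: "(\<lambda>x. (1 - t) *\<^sub>R y + t *\<^sub>R x) \<in> borel \<rightarrow>\<^sub>M borel" by measurable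
  have "(\<integral>\<^sup>+x. f ((1 - t) *\<^sub>R y + t *\<^sub>R x) \<partial>cube_measure) =
      (\<integral>\<^sup>+x. f ((1 - t) *\<^sub>R y + t *\<^sub>R x) * indicator (cbox 0 One) x \<partial>lborel)"
    by (rule nn_integral_cube_measure) (rule measurable_compose[OF m f])
  also have "\<dots> \<le> (\<integral>\<^sup>+x. f ((1 - t) *\<^sub>R y + t *\<^sub>R x) * indicator (cbox 0 One) ((1 - t) *\<^sub>R y + t *\<^sub>R x) \<partial>lborel)"
  proof (intro nn_integral_mono mult_left_mono)
    fix x :: 'a
    have "(1 - t) *\<^sub>R y + t *\<^sub>R x \<in> cbox 0 One" if "x \<in> cbox 0 One"
      using convexD[OF convex_box(1) y that, of "1 - t" t] t by simp
    then show "indicator (cbox 0 One) x \<le> (indicator (cbox 0 One) ((1 - t) *\<^sub>R y + t *\<^sub>R x) :: ennreal)"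
      by (simp add: indicator_def)
  qed simp
  finally have "ennreal (t ^ DIM('a)) * (\<integral>\<^sup>+x. f ((1 - t) *\<^sub>R y + t *\<^sub>R x) \<partial>cube_measure) \<le>
     ennreal (\<bar>t\<bar> ^ DIM('a)) * (\<integral>\<^sup>+x. f ((1 - t) *\<^sub>R y + t *\<^sub>R x) * indicator (cbox 0 One) ((1 - t) *\<^sub>R y + t *\<^sub>R x) \<partial>lborel)"
    using t by (simp add: mult_left_mono)
  also have "\<dots> = (\<integral>\<^sup>+x. f x * indicator (cbox 0 One) x \<partial>lborel)"
    using f t by (intro nn_integral_lborel_affine[symmetric] borel_measurable_times_ennreal) auto
  also have "\<dots> = (\<integral>\<^sup>+x. f x \<partial>cube_measure)"
    by (rule nn_integral_cube_measure[OF f, symmetric])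
  finally show ?thesis .
qed

text \<open>
  Only the half of the segment next to \<open>x\<close> is used: there the Jacobian of \<open>x \<mapsto> (1 - t) y + t x\<close> is at least
  \<open>2\<^sup>-\<^sup>d\<close>. The other half of \<open>v x - v y\<close> is recovered by exchanging \<open>x\<close> and \<open>y\<close>.
\<close>

lemma difference_midpoint_bound:
  fixes v :: "'a::euclidean_space \<Rightarrow> real"
  assumes v: "v \<in> C1" and x: "x \<in> cbox 0 One" and y: "y \<in> cbox 0 One"
  shows "(v x - v ((1/2) *\<^sub>R y + (1/2) *\<^sub>R x))\<^sup>2 \<le>
    (\<integral>t. (DIM('a) / 2) * (\<Sum>b\<in>Basis. (partial_deriv b v ((1 - t) *\<^sub>R y + t *\<^sub>R x))\<^sup>2) \<partial>restrict_space lborel {1/2..1})"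
proof -
  let ?I = "restrict_space lborel {1/2..1} :: real measure"
  let ?z = "\<lambda>t. (1 - t) *\<^sub>R y + t *\<^sub>R x"
  let ?G = "\<lambda>z. \<Sum>b\<in>Basis. (partial_deriv b v z)\<^sup>2"
  define h where "h t = (\<Sum>b\<in>Basis. ((x - y) \<bullet> b) * partial_deriv b v (?z t))" for t
  interpret I: finite_measure ?I by (metis finite_measure_restrict_lborel_cbox box_real(2))
  have cp: "continuous_on UNIV (\<lambda>t. partial_deriv b v (?z t))" if "b \<in> Basis" for b
    by (rule continuous_on_compose2[OF C1_continuous_partial[OF v that]]) (auto intro!: continuous_intros)
  have ch: "continuous_on UNIV h"
    unfolding h_def by (intro continuous_intros cp)
  have cG: "continuous_on UNIV (\<lambda>t. (DIM('a) / 2) * ?G (?z t))"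
    by (intro continuous_intros cp)
  have L2I: "f \<in> L2 ?I" if f: "continuous_on UNIV f" for f :: "real \<Rightarrow> real"
  proof -
    have "compact (f ` {1/2..1})"
      by (intro compact_continuous_image continuous_on_subset[OF f]) auto
    then obtain K where "\<And>y. y \<in> f ` {1/2..1} \<Longrightarrow> norm y \<le> K"
      using compact_imp_bounded bounded_iff by metis
    then show ?thesis
      by (intro I.L2_bounded[where K = K] measurable_restrict_space1)
         (auto simp: space_restrict_space intro: borel_measurable_continuous_onI[OF f])
  qed
  have "(\<integral>t. h t \<partial>?I) = (\<integral>t. indicator {1/2..1} t *\<^sub>R h t \<partial>lborel)"
    by (rule integral_restrict_space) auto
  also have "\<dots> = v (?z 1) - v (?z (1/2))"
  proof (rule integral_FTC_atLeastAtMost)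
    show "continuous_on {1/2..1} h" by (rule continuous_on_subset[OF ch]) auto
    fix t :: real
    have "(?z has_derivative (\<lambda>s. s *\<^sub>R (x - y))) (at t within {1/2..1})"
      by (auto intro!: derivative_eq_intros simp: algebra_simps)
    from has_derivative_compose[OF this C1_has_derivative[OF v]]
    have "((\<lambda>t. v (?z t)) has_derivative (\<lambda>s. frechet_derivative v (at (?z t)) (s *\<^sub>R (x - y)))) (at t within {1/2..1})" .
    moreover have "frechet_derivative v (at (?z t)) (s *\<^sub>R (x - y)) = s *\<^sub>R h t" for s
    proof -
      have d: "v differentiable at (?z t)" using v by (simp add: C1_def)
      show ?thesis
        unfolding frechet_derivative_partial[OF d] h_def by (simp add: sum_distrib_left mult.assoc)
    qed
    ultimately show "((\<lambda>t. v (?z t)) has_vector_derivative h t) (at t within {1/2..1})"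
      by (simp add: has_vector_derivative_def)
  qed simp
  finally have "(v x - v ((1/2) *\<^sub>R y + (1/2) *\<^sub>R x))\<^sup>2 = (\<integral>t. 1 \<bullet> h t \<partial>?I)\<^sup>2" by simp
  also have "\<dots> = \<bar>\<integral>t. 1 \<bullet> h t \<partial>?I\<bar>\<^sup>2" by simp
  also have "\<dots> \<le> (L2_norm ?I (\<lambda>_. 1 :: real) * L2_norm ?I h)\<^sup>2"
    by (intro power_mono L2_Cauchy_Schwarz L2I ch continuous_intros) auto
  \<comment> \<open>The factor 1/2 is the length of the parameter interval.\<close>
  also have "\<dots> = (1/2) * (\<integral>t. (h t)\<^sup>2 \<partial>?I)"
  proof -
    have "measure ?I (space ?I) = 1/2"
      by (simp add: space_restrict_space measure_restrict_space)
    then show ?thesis unfolding power_mult_distrib L2_norm_power2 by simp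
  qed
  also have "\<dots> = (\<integral>t. (1/2) * (h t)\<^sup>2 \<partial>?I)" by simp
  also have "\<dots> \<le> (\<integral>t. (DIM('a) / 2) * ?G (?z t) \<partial>?I)"
  proof (rule integral_mono)
    have "integrable ?I f" if f: "continuous_on UNIV f" for f :: "real \<Rightarrow> real"
      using L2_mult_integrable[OF L2I[OF f] L2I[OF continuous_on_const[of UNIV 1]]] by simp
    from this[OF cG] this[of "\<lambda>t. (1/2) * (h t)\<^sup>2"]
    show "integrable ?I (\<lambda>t. (1/2) * (h t)\<^sup>2)" "integrable ?I (\<lambda>t. (DIM('a) / 2) * ?G (?z t))"
      using continuous_on_mult[OF continuous_on_const[of UNIV "1/2"] continuous_on_power[OF ch, of 2]] by auto
    fix t
    \<comment> \<open>Two points of the cube differ by at most 1 in each coordinate, so the squared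
      length of x - y is at most d.\<close>
    have "(h t)\<^sup>2 \<le> (\<Sum>b\<in>Basis. ((x - y) \<bullet> b)\<^sup>2) * ?G (?z t)"
      unfolding h_def by (rule Cauchy_Schwarz_ineq_sum)
    also have "\<dots> \<le> DIM('a) * ?G (?z t)"
    proof (rule mult_right_mono)
      have "((x - y) \<bullet> b)\<^sup>2 \<le> 1" if "b \<in> Basis" for b
        using x y that by (auto simp: mem_box inner_diff_left abs_square_le_1 abs_le_iff) (smt (verit) that)+
      then have "(\<Sum>b\<in>Basis. ((x - y) \<bullet> b)\<^sup>2) \<le> (\<Sum>b\<in>(Basis::'a set). 1)"
        by (intro sum_mono)
      then show "(\<Sum>b\<in>Basis. ((x - y) \<bullet> b)\<^sup>2) \<le> DIM('a)" by simp
    qed (simp add: sum_nonneg)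
    finally show "(1/2) * (h t)\<^sup>2 \<le> (DIM('a) / 2) * ?G (?z t)" by simp
  qed
  finally show ?thesis .
qed

text \<open>After exchanging the integrals, the segment parameter t is fixed and the contraction
  estimate applies in x. Since t is at least 1/2, the inverse Jacobian stays below
  \<open>2 ^ DIM('a)\<close>, uniformly in y.\<close>

lemma difference_midpoint_integral:
  fixes v :: "'a::euclidean_space \<Rightarrow> real"
  assumes v: "v \<in> C1" and y: "y \<in> cbox 0 One"
  shows "(\<integral>\<^sup>+x. ennreal ((v x - v ((1/2) *\<^sub>R y + (1/2) *\<^sub>R x))\<^sup>2) \<partial>cube_measure) \<le>
    ennreal (DIM('a) * 2 ^ DIM('a) * grad_norm2 v)"
proof -
  let ?I = "restrict_space lborel {1/2..1} :: real measure"
  let ?G = "\<lambda>z. (DIM('a) / 2) * (\<Sum>b\<in>Basis. (partial_deriv b v z)\<^sup>2)"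
  interpret I: finite_measure ?I by (metis finite_measure_restrict_lborel_cbox box_real(2))
  interpret P: pair_sigma_finite "cube_measure :: 'a measure" ?I ..
  have cG: "continuous_on UNIV ?G" by (intro continuous_intros C1_continuous_partial v)
  have G: "?G \<in> borel_measurable borel" by (rule borel_measurable_continuous_onI[OF cG])
  have G0: "0 \<le> ?G z" for z by (simp add: sum_nonneg)
  have gG: "(\<integral>\<^sup>+x. ennreal (?G x) \<partial>cube_measure) = ennreal (DIM('a) / 2 * grad_norm2 v)"
  proof -
    have "(\<integral>\<^sup>+x. ennreal (?G x) \<partial>cube_measure) = ennreal (\<integral>x. ?G x \<partial>cube_measure)"
      by (intro nn_integral_eq_integral integrable_cube_measure_continuous cG AE_I2 G0)
    also have "(\<integral>x. ?G x \<partial>cube_measure) = DIM('a) / 2 * (\<integral>x. (\<Sum>b\<in>Basis. (partial_deriv b v x)\<^sup>2) \<partial>cube_measure)"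
      by simp
    also have "(\<integral>x. (\<Sum>b\<in>Basis. (partial_deriv b v x)\<^sup>2) \<partial>cube_measure) =
        (\<Sum>b\<in>Basis. \<integral>x. (partial_deriv b v x)\<^sup>2 \<partial>cube_measure)"
      by (intro Bochner_Integration.integral_sum integrable_cube_measure_continuous continuous_intros
          C1_continuous_partial v)
    finally show ?thesis by (simp add: grad_norm2_def L2_norm_power2)
  qed
  have idI: "(\<lambda>x. x) \<in> ?I \<rightarrow>\<^sub>M borel" by (intro measurable_restrict_space1) simp
  have "(\<integral>\<^sup>+x. ennreal ((v x - v ((1/2) *\<^sub>R y + (1/2) *\<^sub>R x))\<^sup>2) \<partial>cube_measure) \<le>
      (\<integral>\<^sup>+x. (\<integral>\<^sup>+t. ennreal (?G ((1 - t) *\<^sub>R y + t *\<^sub>R x)) \<partial>?I) \<partial>cube_measure)"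
  proof (rule nn_integral_mono)
    fix x :: 'a assume "x \<in> space cube_measure"
    then have x: "x \<in> cbox 0 One" by simp
    have "ennreal ((v x - v ((1/2) *\<^sub>R y + (1/2) *\<^sub>R x))\<^sup>2) \<le> ennreal (\<integral>t. ?G ((1 - t) *\<^sub>R y + t *\<^sub>R x) \<partial>?I)"
      by (rule ennreal_leI[OF difference_midpoint_bound[OF v x y]])
    also have "\<dots> \<le> (\<integral>\<^sup>+t. ennreal (?G ((1 - t) *\<^sub>R y + t *\<^sub>R x)) \<partial>?I)"
    proof (cases "integrable ?I (\<lambda>t. ?G ((1 - t) *\<^sub>R y + t *\<^sub>R x))")
      case True
      then show ?thesis by (subst nn_integral_eq_integral) (auto intro!: AE_I2 mult_nonneg_nonneg sum_nonneg)
    next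
      \<comment> \<open>The Bochner integral defaults to 0 here, so the inequality is
        trivial.\<close>
      case False
      then show ?thesis by (subst not_integrable_integral_eq) auto
    qed
    finally show "ennreal ((v x - v ((1/2) *\<^sub>R y + (1/2) *\<^sub>R x))\<^sup>2) \<le>
      (\<integral>\<^sup>+t. ennreal (?G ((1 - t) *\<^sub>R y + t *\<^sub>R x)) \<partial>?I)" .
  qed
  also have "\<dots> = (\<integral>\<^sup>+t. (\<integral>\<^sup>+x. ennreal (?G ((1 - t) *\<^sub>R y + t *\<^sub>R x)) \<partial>cube_measure) \<partial>?I)"
  proof (rule P.Fubini'[symmetric], rule measurable_pair_borel[OF _ id_measurable_cube idI])
    have m: "(\<lambda>(x, t). (1 - t) *\<^sub>R y + t *\<^sub>R x) \<in> borel \<Otimes>\<^sub>M borel \<rightarrow>\<^sub>M (borel :: 'a measure)" by measurable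
    show "(\<lambda>(x, t). ennreal (?G ((1 - t) *\<^sub>R y + t *\<^sub>R x))) \<in> borel_measurable (borel \<Otimes>\<^sub>M borel)"
      using measurable_compose[OF measurable_compose[OF m G] measurable_ennreal] by (simp add: split_def)
  qed
  also have "\<dots> \<le> (\<integral>\<^sup>+t. ennreal (2 ^ DIM('a)) * ennreal (DIM('a) / 2 * grad_norm2 v) \<partial>?I)"
  proof (rule nn_integral_mono)
    fix t :: real assume "t \<in> space ?I"
    then have t: "1/2 \<le> t" "t \<le> 1" by (auto simp: space_restrict_space)
    let ?A = "\<integral>\<^sup>+x. ennreal (?G ((1 - t) *\<^sub>R y + t *\<^sub>R x)) \<partial>cube_measure"
    have "1 \<le> (2 * t) ^ DIM('a)" using t by (intro one_le_power) auto
    then have "1 * ?A \<le> ennreal (2 ^ DIM('a) * t ^ DIM('a)) * ?A"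
      by (intro mult_right_mono) (auto simp: power_mult_distrib)
    also have "\<dots> = ennreal (2 ^ DIM('a)) * (ennreal (t ^ DIM('a)) * ?A)"
      using t by (simp add: ennreal_mult mult.assoc)
    also have "\<dots> \<le> ennreal (2 ^ DIM('a)) * (\<integral>\<^sup>+x. ennreal (?G x) \<partial>cube_measure)"
      using t by (intro mult_left_mono nn_integral_cube_contraction y measurable_compose[OF G measurable_ennreal]) auto
    finally show "?A \<le> ennreal (2 ^ DIM('a)) * ennreal (DIM('a) / 2 * grad_norm2 v)"
      unfolding gG mult_1 .
  qed
  also have "\<dots> = ennreal (2 ^ DIM('a) * (DIM('a) / 2 * grad_norm2 v)) * ennreal (1/2)"
  proof -
    have "0 \<le> DIM('a) / 2 * grad_norm2 v" by (simp add: grad_norm2_def sum_nonneg)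
    moreover have "emeasure ?I (space ?I) = ennreal (1/2)"
      by (simp add: space_restrict_space emeasure_restrict_space)
    ultimately show ?thesis
      by (simp only: nn_integral_const ennreal_mult zero_le_power zero_le_numeral)
  qed
  \<comment> \<open>One factor 1/2 comes from \<open>?G\<close>, the other from the length of the
    interval.\<close>
  also have "\<dots> = ennreal (DIM('a) * 2 ^ DIM('a) * grad_norm2 v / 4)"
    by (subst ennreal_mult[symmetric]) (auto simp: grad_norm2_def sum_nonneg mult_ac)
  also have "\<dots> \<le> ennreal (DIM('a) * 2 ^ DIM('a) * grad_norm2 v)"
    by (intro ennreal_leI) (simp add: grad_norm2_def sum_nonneg)
  finally show ?thesis .
qed

text \<open>As the cube has volume 1, the mean of \<open>(v x - v y)\<^sup>2\<close> over all pairs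
  is twice the variance of v. Splitting the difference at the midpoint leaves two terms of the kind
  already bounded.\<close>

lemma poincare_inequality_C1:
  fixes v :: "'a::euclidean_space \<Rightarrow> real"
  assumes v: "v \<in> C1"
  shows "(L2_norm cube_measure v)\<^sup>2 \<le> 2 * DIM('a) * 2 ^ DIM('a) * grad_norm2 v + (\<integral>x. v x \<partial>cube_measure)\<^sup>2"
proof -
  let ?c = "cube_measure :: 'a measure"
  let ?m = "\<lambda>x y :: 'a. (1/2) *\<^sub>R y + (1/2) *\<^sub>R x"
  let ?D = "DIM('a) * 2 ^ DIM('a) * grad_norm2 v"
  define m where "m = (\<integral>x. v x \<partial>cube_measure)"
  define N where "N = (\<integral>x. (v x)\<^sup>2 \<partial>cube_measure)"
  interpret P: pair_sigma_finite ?c ?c ..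
  note cv = C1_continuous[OF v]
  have vm: "v \<in> borel_measurable borel" by (rule borel_measurable_continuous_onI[OF cv])
  have D0: "0 \<le> ?D" by (simp add: grad_norm2_def sum_nonneg)
  have one: "measure ?c (cbox 0 One) = 1"
    by (simp add: measure_def emeasure_cube_measure)
  have sq_meas: "(\<lambda>(x, y). ennreal (2 * (v x - v (?m x y))\<^sup>2)) \<in> borel_measurable (?c \<Otimes>\<^sub>M ?c)"
    "(\<lambda>(x, y). ennreal (2 * (v y - v (?m x y))\<^sup>2)) \<in> borel_measurable (?c \<Otimes>\<^sub>M ?c)"
  proof -
    have mm: "(\<lambda>p. ?m (fst p) (snd p)) \<in> borel \<Otimes>\<^sub>M borel \<rightarrow>\<^sub>M (borel :: 'a measure)" by measurable
    have [measurable]: "(\<lambda>p. v (fst p)) \<in> borel \<Otimes>\<^sub>M (borel :: 'a measure) \<rightarrow>\<^sub>M borel"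
      "(\<lambda>p. v (snd p)) \<in> (borel :: 'a measure) \<Otimes>\<^sub>M borel \<rightarrow>\<^sub>M borel"
      by (rule measurable_compose[OF measurable_fst vm] measurable_compose[OF measurable_snd vm])+
    note [measurable] = measurable_compose[OF mm vm]
    show "(\<lambda>(x, y). ennreal (2 * (v x - v (?m x y))\<^sup>2)) \<in> borel_measurable (?c \<Otimes>\<^sub>M ?c)"
      "(\<lambda>(x, y). ennreal (2 * (v y - v (?m x y))\<^sup>2)) \<in> borel_measurable (?c \<Otimes>\<^sub>M ?c)"
      by (rule measurable_pair_borel[OF _ id_measurable_cube id_measurable_cube], simp add: split_def, measurable)+
  qed
  have bound: "(\<integral>\<^sup>+y. \<integral>\<^sup>+x. ennreal (2 * (v x - v (?m x y))\<^sup>2) \<partial>?c \<partial>?c) \<le> ennreal (2 * ?D)"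
  proof -
    have "(\<integral>\<^sup>+y. \<integral>\<^sup>+x. ennreal (2 * (v x - v (?m x y))\<^sup>2) \<partial>?c \<partial>?c) \<le> (\<integral>\<^sup>+y. ennreal (2 * ?D) \<partial>?c)"
    proof (rule nn_integral_mono)
      fix y assume "y \<in> space ?c"
      then have y: "y \<in> cbox 0 One" by simp
      have "(\<integral>\<^sup>+x. ennreal (2 * (v x - v (?m x y))\<^sup>2) \<partial>?c) = (\<integral>\<^sup>+x. 2 * ennreal ((v x - v (?m x y))\<^sup>2) \<partial>?c)"
        by (simp add: ennreal_mult)
      also have "\<dots> = 2 * (\<integral>\<^sup>+x. ennreal ((v x - v (?m x y))\<^sup>2) \<partial>?c)"
      proof (rule nn_integral_cmult, rule borel_measurable_cube_measure)
        have mm: "(\<lambda>x. ?m x y) \<in> borel \<rightarrow>\<^sub>M (borel :: 'a measure)" by measurable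
        note [measurable] = measurable_compose[OF mm vm] vm
        show "(\<lambda>x. ennreal ((v x - v (?m x y))\<^sup>2)) \<in> borel_measurable borel" by measurable
      qed
      also have "\<dots> \<le> 2 * ennreal ?D"
        by (intro mult_left_mono difference_midpoint_integral v y) auto
      also have "\<dots> = ennreal (2 * ?D)" using D0 by (simp add: ennreal_mult)
      finally show "(\<integral>\<^sup>+x. ennreal (2 * (v x - v (?m x y))\<^sup>2) \<partial>?c) \<le> ennreal (2 * ?D)" .
    qed
    then show ?thesis by (simp add: emeasure_cube_measure)
  qed
  have sq: "(\<integral>x. (v x - v y)\<^sup>2 \<partial>?c) = N - 2 * v y * m + (v y)\<^sup>2" for y
  proof -
    have "(\<integral>x. (v x - v y)\<^sup>2 \<partial>?c) = (\<integral>x. (v x)\<^sup>2 - 2 * v y * v x + (v y)\<^sup>2 \<partial>?c)"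
      by (simp add: power2_diff algebra_simps)
    also have "\<dots> = (\<integral>x. (v x)\<^sup>2 - 2 * v y * v x \<partial>?c) + (\<integral>x. (v y)\<^sup>2 \<partial>?c)"
      by (intro Bochner_Integration.integral_add integrable_cube_measure_continuous continuous_intros cv)
    also have "(\<integral>x. (v x)\<^sup>2 - 2 * v y * v x \<partial>?c) = N - (\<integral>x. 2 * v y * v x \<partial>?c)"
      unfolding N_def
      by (intro Bochner_Integration.integral_diff integrable_cube_measure_continuous continuous_intros cv)
    finally show ?thesis by (simp add: one m_def)
  qed
  have inner: "(\<integral>\<^sup>+x. ennreal ((v x - v y)\<^sup>2) \<partial>?c) = ennreal (N - 2 * v y * m + (v y)\<^sup>2)" for y
    unfolding sq[symmetric]
    by (intro nn_integral_eq_integral integrable_cube_measure_continuous continuous_intros cv) auto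
  have nonneg: "0 \<le> N - 2 * v y * m + (v y)\<^sup>2" for y
    unfolding sq[symmetric] by simp
  have "ennreal (2 * N - 2 * m\<^sup>2) = ennreal (\<integral>y. N - 2 * v y * m + (v y)\<^sup>2 \<partial>?c)"
  proof -
    have "(\<integral>y. (N - 2 * v y * m) + (v y)\<^sup>2 \<partial>?c) = (\<integral>y. N - 2 * v y * m \<partial>?c) + N"
      unfolding N_def
      by (intro Bochner_Integration.integral_add integrable_cube_measure_continuous continuous_intros cv)
    also have "(\<integral>y. N - 2 * v y * m \<partial>?c) = (\<integral>y. N \<partial>?c) - (\<integral>y. 2 * v y * m \<partial>?c)"
      by (intro Bochner_Integration.integral_diff integrable_cube_measure_continuous continuous_intros cv)
    finally show ?thesis by (simp add: one power2_eq_square mult.assoc flip: m_def)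
  qed
  also have "\<dots> = (\<integral>\<^sup>+y. ennreal (N - 2 * v y * m + (v y)\<^sup>2) \<partial>?c)"
    by (intro nn_integral_eq_integral[symmetric] integrable_cube_measure_continuous continuous_intros cv AE_I2 nonneg)
  also have "\<dots> = (\<integral>\<^sup>+y. \<integral>\<^sup>+x. ennreal ((v x - v y)\<^sup>2) \<partial>?c \<partial>?c)"
    by (simp add: inner)
  also have "\<dots> \<le> (\<integral>\<^sup>+y. \<integral>\<^sup>+x. ennreal (2 * (v x - v (?m x y))\<^sup>2) + ennreal (2 * (v y - v (?m x y))\<^sup>2) \<partial>?c \<partial>?c)"
  proof (intro nn_integral_mono)
    fix x y :: 'a
    have "(v x - v y)\<^sup>2 \<le> 2 * (v x - v (?m x y))\<^sup>2 + 2 * (v y - v (?m x y))\<^sup>2"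
      using sum_squares_ge_zero[of "v x - v (?m x y) + (v y - v (?m x y))" 0]
      by (simp add: power2_eq_square algebra_simps)
    then have "ennreal ((v x - v y)\<^sup>2) \<le> ennreal (2 * (v x - v (?m x y))\<^sup>2 + 2 * (v y - v (?m x y))\<^sup>2)"
      by (rule ennreal_leI)
    also have "\<dots> = ennreal (2 * (v x - v (?m x y))\<^sup>2) + ennreal (2 * (v y - v (?m x y))\<^sup>2)"
      by (rule ennreal_plus) auto
    finally show "ennreal ((v x - v y)\<^sup>2) \<le> ennreal (2 * (v x - v (?m x y))\<^sup>2) + ennreal (2 * (v y - v (?m x y))\<^sup>2)" .
  qed
  also have "\<dots> = (\<integral>\<^sup>+p. ennreal (2 * (v (fst p) - v (?m (fst p) (snd p)))\<^sup>2) + ennreal (2 * (v (snd p) - v (?m (fst p) (snd p)))\<^sup>2) \<partial>(?c \<Otimes>\<^sub>M ?c))"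
    using sq_meas by (subst P.nn_integral_snd[symmetric]) (auto simp: split_def)
  also have "\<dots> = (\<integral>\<^sup>+p. ennreal (2 * (v (fst p) - v (?m (fst p) (snd p)))\<^sup>2) \<partial>(?c \<Otimes>\<^sub>M ?c))
       + (\<integral>\<^sup>+p. ennreal (2 * (v (snd p) - v (?m (fst p) (snd p)))\<^sup>2) \<partial>(?c \<Otimes>\<^sub>M ?c))"
    using sq_meas by (intro nn_integral_add) (auto simp: split_def)
  also have "\<dots> = (\<integral>\<^sup>+y. \<integral>\<^sup>+x. ennreal (2 * (v x - v (?m x y))\<^sup>2) \<partial>?c \<partial>?c)
       + (\<integral>\<^sup>+x. \<integral>\<^sup>+y. ennreal (2 * (v y - v (?m x y))\<^sup>2) \<partial>?c \<partial>?c)"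
    using sq_meas P.nn_integral_snd[of "\<lambda>p. ennreal (2 * (v (fst p) - v (?m (fst p) (snd p)))\<^sup>2)"]
      cube.nn_integral_fst[of "\<lambda>p. ennreal (2 * (v (snd p) - v (?m (fst p) (snd p)))\<^sup>2)" ?c]
    by (simp add: split_def)
  \<comment> \<open>The midpoint is symmetric in x and y, so the second double integral is the first
    one with the variables renamed.\<close>
  also have "\<dots> \<le> ennreal (2 * ?D) + ennreal (2 * ?D)"
    using bound by (intro add_mono) (auto simp: add.commute)
  also have "\<dots> = ennreal (4 * ?D)" using D0 by (subst ennreal_plus[symmetric]) (auto simp: mult_ac)
  finally have "2 * N - 2 * m\<^sup>2 \<le> 4 * ?D" using D0 by (simp add: ennreal_le_iff)
  then show ?thesis by (simp add: L2_norm_power2 N_def m_def)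
qed

section \<open>Mollification\<close>

lemma L2_norm_dominated_convergence:
  fixes f :: "nat \<Rightarrow> 'a \<Rightarrow> real"
  assumes [measurable]: "\<And>n. f n \<in> borel_measurable M" "g \<in> borel_measurable M"
    and w: "integrable M w"
    and lim: "AE x in M. (\<lambda>n. f n x) \<longlonglongrightarrow> g x"
    and dom: "\<And>n. AE x in M. (f n x - g x)\<^sup>2 \<le> w x"
  shows "(\<lambda>n. L2_norm M (\<lambda>x. f n x - g x)) \<longlonglongrightarrow> 0"
proof -
  have "(\<lambda>n. \<integral>x. (f n x - g x)\<^sup>2 \<partial>M) \<longlonglongrightarrow> (\<integral>x. 0 \<partial>M)"
  proof (rule integral_dominated_convergence[OF _ _ w])
    show "AE x in M. (\<lambda>n. (f n x - g x)\<^sup>2) \<longlonglongrightarrow> 0"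
      using lim
    proof eventually_elim
      case (elim x)
      from tendsto_power[OF tendsto_diff[OF elim tendsto_const[of "g x"]], of 2] show ?case by simp
    qed
    show "AE x in M. norm ((f n x - g x)\<^sup>2) \<le> w x" for n
      using dom[of n] by simp
  qed measurable
  from tendsto_real_sqrt[OF this] show ?thesis by (simp add: L2_norm_def)
qed

lemma L2_cube_truncate:
  fixes f :: "'a::euclidean_space \<Rightarrow> real"
  assumes f: "f \<in> L2 cube_measure"
  shows "(\<lambda>n. L2_norm cube_measure (\<lambda>x. max (- real n) (min (real n) (f x)) - f x)) \<longlonglongrightarrow> 0"
proof (rule L2_norm_dominated_convergence)
  note [measurable] = L2_measurable[OF f]
  show "(\<lambda>x. max (- real n) (min (real n) (f x))) \<in> borel_measurable cube_measure" for n by measurable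
  show "f \<in> borel_measurable cube_measure" by measurable
  show "integrable cube_measure (\<lambda>x. (norm (f x))\<^sup>2)" by (rule L2_integrable_power2[OF f])
  show "AE x in cube_measure. (\<lambda>n. max (- real n) (min (real n) (f x))) \<longlonglongrightarrow> f x"
  proof (rule AE_I2)
    fix x
    obtain N where N: "\<bar>f x\<bar> \<le> real N" using real_arch_simple by blast
    have "\<forall>\<^sub>F n in sequentially. f x = max (- real n) (min (real n) (f x))"
      using eventually_ge_at_top[of N]
    proof eventually_elim
      case (elim n)
      then have "real N \<le> real n" by simp
      with N show ?case by linarith
    qed
    then show "(\<lambda>n. max (- real n) (min (real n) (f x))) \<longlonglongrightarrow> f x"
      by (rule Lim_transform_eventually[OF tendsto_const])
  qed
  show "AE x in cube_measure. (max (- real n) (min (real n) (f x)) - f x)\<^sup>2 \<le> (norm (f x))\<^sup>2" for n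
  proof (rule AE_I2)
    fix x
    have "\<bar>max (- real n) (min (real n) (f x)) - f x\<bar> \<le> \<bar>f x\<bar>" by (simp add: max_def min_def)
    from power_mono[OF this, of 2]
    show "(max (- real n) (min (real n) (f x)) - f x)\<^sup>2 \<le> (norm (f x))\<^sup>2" by simp
  qed
qed

text \<open>A measurable function is almost everywhere a limit of continuous ones, but without
  control of their size. Truncating f and the approximants at the same level keeps continuity and
  supplies a constant dominating function.\<close>

lemma L2_cube_continuous_dense:
  fixes f :: "'a::euclidean_space \<Rightarrow> real"
  assumes f: "f \<in> L2 cube_measure" and e: "0 < e"
  obtains g where "continuous_on UNIV g" "L2_norm cube_measure (\<lambda>x. g x - f x) < e"
proof -
  note [measurable] = L2_measurable[OF f]
  have "f measurable_on cbox 0 One"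
    using L2_measurable[OF f] unfolding cube_measure_def
    by (subst measurable_on_iff_borel_measurable) auto
  then obtain N h where N: "negligible N" and h: "\<And>n. continuous_on UNIV (h n)"
    and lim: "\<And>x. x \<notin> N \<Longrightarrow> (\<lambda>n::nat. h n x) \<longlonglongrightarrow> (if x \<in> cbox 0 One then f x else 0)"
    unfolding measurable_on_def by blast
  have "N \<in> null_sets lebesgue" using N by (simp add: negligible_iff_null_sets)
  then have "AE x in lebesgue. x \<notin> N" by (rule AE_not_in)
  then have AEN: "AE x in cube_measure. x \<notin> N"
    unfolding cube_measure_def by (subst AE_restrict_space_iff) auto
  obtain k where k: "L2_norm cube_measure (\<lambda>x. max (- real k) (min (real k) (f x)) - f x) < e / 2"
    using LIMSEQ_D[OF L2_cube_truncate[OF f], of "e / 2"] e by auto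
  define T where "T t = max (- real k) (min (real k) t)" for t
  have cT: "continuous_on UNIV (\<lambda>x. T (h n x))" for n
    unfolding T_def by (intro continuous_intros h)
  have Tf: "(\<lambda>x. T (f x)) \<in> L2 cube_measure"
    by (rule cube.L2_bounded[where K = "real k"]) (auto simp: T_def)
  have "(\<lambda>n. L2_norm cube_measure (\<lambda>x. T (h n x) - T (f x))) \<longlonglongrightarrow> 0"
  proof (rule L2_norm_dominated_convergence)
    show "(\<lambda>x. T (h n x)) \<in> borel_measurable cube_measure" for n
      by (rule L2_measurable[OF continuous_L2_cube[OF cT]])
    show "(\<lambda>x. T (f x)) \<in> borel_measurable cube_measure" by (rule L2_measurable[OF Tf])
    show "integrable (cube_measure :: 'a measure) (\<lambda>x. (2 * real k)\<^sup>2)" by simp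
    show "AE x in cube_measure. (\<lambda>n. T (h n x)) \<longlonglongrightarrow> T (f x)"
      using AEN AE_space
    proof eventually_elim
      case (elim x)
      then have "(\<lambda>n. h n x) \<longlonglongrightarrow> f x" using lim[of x] by simp
      then show ?case unfolding T_def by (intro tendsto_max tendsto_min tendsto_const)
    qed
    show "AE x in cube_measure. (T (h n x) - T (f x))\<^sup>2 \<le> (2 * real k)\<^sup>2" for n
    proof (rule AE_I2)
      fix x
      have "\<bar>T t\<bar> \<le> real k" for t unfolding T_def by (simp add: max_def min_def abs_le_iff)
      from this[of "h n x"] this[of "f x"] have "\<bar>T (h n x) - T (f x)\<bar> \<le> 2 * real k" by linarith
      from power_mono[OF this, of 2] show "(T (h n x) - T (f x))\<^sup>2 \<le> (2 * real k)\<^sup>2" by simp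
    qed
  qed
  then obtain n where n: "L2_norm cube_measure (\<lambda>x. T (h n x) - T (f x)) < e / 2"
    using LIMSEQ_D[of _ 0 "e / 2"] e by fastforce
  have "L2_norm cube_measure (\<lambda>x. T (h n x) - f x) \<le>
      L2_norm cube_measure (\<lambda>x. T (h n x) - T (f x)) + L2_norm cube_measure (\<lambda>x. T (f x) - f x)"
    by (rule L2_norm_triangle3[OF continuous_L2_cube[OF cT] Tf f])
  also have "\<dots> < e" using n k by (simp add: T_def)
  finally show ?thesis using that cT by blast
qed

section \<open>The mollifying kernel\<close>

lemma has_derivative_quadratic:
  fixes f :: "'a::real_normed_vector \<Rightarrow> real"
  assumes L: "bounded_linear L"
    and bd: "\<And>h. norm h \<le> 1 \<Longrightarrow> \<bar>f (x + h) - f x - L h\<bar> \<le> K * (norm h)\<^sup>2"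
  shows "(f has_derivative L) (at x)"
  unfolding has_derivative_at_alt
proof (intro conjI allI impI L)
  fix e :: real assume e: "0 < e"
  let ?d = "min 1 (e / (\<bar>K\<bar> + 1))"
  show "\<exists>d>0. \<forall>y. norm (y - x) < d \<longrightarrow> norm (f y - f x - L (y - x)) \<le> e * norm (y - x)"
  proof (intro exI conjI allI impI)
    show "0 < ?d" using e by simp
    fix y assume y: "norm (y - x) < ?d"
    then have le: "norm (y - x) * (\<bar>K\<bar> + 1) \<le> e"
      by (simp add: pos_less_divide_eq)
    have "norm (f y - f x - L (y - x)) \<le> K * (norm (y - x))\<^sup>2"
      using bd[of "y - x"] y by simp
    also have "\<dots> \<le> (\<bar>K\<bar> + 1) * (norm (y - x))\<^sup>2" by (intro mult_right_mono) auto
    also have "\<dots> = (norm (y - x) * (\<bar>K\<bar> + 1)) * norm (y - x)" by (simp add: power2_eq_square)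
    also have "\<dots> \<le> e * norm (y - x)" by (intro mult_right_mono le) simp
    finally show "norm (f y - f x - L (y - x)) \<le> e * norm (y - x)" .
  qed
qed

text \<open>Taylor's formula for \<open>(max 0 t) ^ 3\<close>: half of the second derivative
  \<open>6 * max 0 t\<close> gives the constant 3. The switch of the formula at 0 is settled by the
  signs of s and t.\<close>

lemma cubic_part_taylor:
  fixes s t :: real
  shows "\<bar>(max 0 s) ^ 3 - (max 0 t) ^ 3 - 3 * (max 0 t)\<^sup>2 * (s - t)\<bar> \<le> 3 * max \<bar>s\<bar> \<bar>t\<bar> * (s - t)\<^sup>2"
proof -
  consider "0 \<le> s" "0 \<le> t" | "s < 0" "0 \<le> t" | "0 \<le> s" "t < 0" | "s < 0" "t < 0" by linarith
  then show ?thesis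
  proof cases
    case 1
    have "s ^ 3 - t ^ 3 - 3 * t\<^sup>2 * (s - t) = (s + 2 * t) * (s - t)\<^sup>2"
      by (simp add: power2_eq_square power3_eq_cube algebra_simps)
    moreover have "\<bar>(s + 2 * t) * (s - t)\<^sup>2\<bar> \<le> 3 * max \<bar>s\<bar> \<bar>t\<bar> * (s - t)\<^sup>2"
      unfolding abs_mult using 1 by (simp add: mult_right_mono)
    ultimately show ?thesis using 1 by simp
  next
    case 2
    define a where "a = - s"
    have a: "0 < a" using 2 by (simp add: a_def)
    have "t\<^sup>2 * (2 * t + 3 * a) \<le> 3 * max a t * (a + t)\<^sup>2"
    proof -
      have "t\<^sup>2 * (2 * t + 3 * a) \<le> 3 * t * (a + t)\<^sup>2"
        using a 2 by (simp add: power2_eq_square algebra_simps)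
      also have "\<dots> \<le> 3 * max a t * (a + t)\<^sup>2" by (intro mult_right_mono) auto
      finally show ?thesis .
    qed
    moreover have "(max 0 s) ^ 3 - (max 0 t) ^ 3 - 3 * (max 0 t)\<^sup>2 * (s - t) = t\<^sup>2 * (2 * t + 3 * a)"
      using 2 by (simp add: a_def power2_eq_square power3_eq_cube algebra_simps)
    moreover have "(s - t)\<^sup>2 = (a + t)\<^sup>2" by (simp add: a_def power2_eq_square algebra_simps)
    ultimately show ?thesis using a 2 by (simp add: a_def)
  next
    case 3
    have "s\<^sup>2 \<le> (s - t)\<^sup>2" using 3 by (intro power_mono) auto
    then have "s * s\<^sup>2 \<le> 3 * max \<bar>s\<bar> \<bar>t\<bar> * (s - t)\<^sup>2"
      using 3 by (intro mult_mono) auto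
    then show ?thesis using 3 by (simp add: power3_eq_cube power2_eq_square mult.assoc)
  next
    case 4
    then show ?thesis by simp
  qed
qed

text \<open>
  A kernel that is explicitly \<open>C\<^sup>1\<close> with a quadratic remainder, so that convolutions can be differentiated
  under the integral without any regularity of the other factor.
\<close>

definition bump :: "real \<Rightarrow> 'a::euclidean_space \<Rightarrow> real" where
  "bump e z = (max 0 (e\<^sup>2 - z \<bullet> z)) ^ 3"

definition bump_grad :: "real \<Rightarrow> 'a::euclidean_space \<Rightarrow> 'a" where
  "bump_grad e z = (- 6 * (max 0 (e\<^sup>2 - z \<bullet> z))\<^sup>2) *\<^sub>R z"

lemma bump_nonneg [simp]: "0 \<le> bump e z"
  by (simp add: bump_def)

lemma bump_continuous: "continuous_on UNIV (bump e)"
  unfolding bump_def by (intro continuous_intros)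

lemma bump_grad_continuous: "continuous_on UNIV (bump_grad e)"
  unfolding bump_grad_def by (intro continuous_intros)

lemma bump_measurable [measurable]: "bump e \<in> borel_measurable borel"
  by (rule borel_measurable_continuous_onI[OF bump_continuous])

lemma bump_support: "bump e z \<noteq> 0 \<Longrightarrow> norm z < e" if "0 < e"
proof (rule ccontr)
  assume b: "bump e z \<noteq> 0" and "\<not> norm z < e"
  then have "e\<^sup>2 \<le> (norm z)\<^sup>2" using that by (intro power_mono) auto
  then have "bump e z = 0" by (simp add: bump_def power2_norm_eq_inner)
  with b show False by simp
qed

lemma bump_le: "bump e z \<le> (e\<^sup>2) ^ 3"
  unfolding bump_def by (intro power_mono) auto

lemma bump_grad_bound: "norm (bump_grad e z) \<le> 6 * (e\<^sup>2)\<^sup>2 * e" if "0 < e"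
proof (cases "norm z < e")
  case True
  have "(max 0 (e\<^sup>2 - z \<bullet> z))\<^sup>2 \<le> (e\<^sup>2)\<^sup>2" by (intro power_mono) auto
  then have "6 * (max 0 (e\<^sup>2 - z \<bullet> z))\<^sup>2 * norm z \<le> 6 * (e\<^sup>2)\<^sup>2 * e"
    using True by (intro mult_mono) auto
  then show ?thesis by (simp add: bump_grad_def abs_mult)
next
  case False
  then have "e\<^sup>2 \<le> (norm z)\<^sup>2" using that by (intro power_mono) auto
  then show ?thesis using that by (simp add: bump_grad_def power2_norm_eq_inner)
qed

text \<open>The chain rule with remainder: \<open>s - t\<close> is the linear term
  \<open>- (2 * (z \<bullet> h))\<close>, which yields the gradient, minus
  \<open>h \<bullet> h\<close>, which yields the summand \<open>3 * (e\<^sup>2)\<^sup>2\<close>. The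
  constant depends on z only through W, so the estimate can be integrated over a bounded set of
  z.\<close>

lemma bump_taylor:
  fixes z h :: "'a::euclidean_space"
  assumes h: "norm h \<le> 1" and z: "norm z \<le> W"
  shows "\<bar>bump e (z + h) - bump e z - bump_grad e z \<bullet> h\<bar> \<le>
    (3 * (e\<^sup>2 + (W + 1)\<^sup>2) * (2 * W + 1)\<^sup>2 + 3 * (e\<^sup>2)\<^sup>2) * (norm h)\<^sup>2"
proof -
  define t where "t = e\<^sup>2 - z \<bullet> z"
  define s where "s = e\<^sup>2 - (z + h) \<bullet> (z + h)"
  have W: "0 \<le> W" using z norm_ge_zero[of z] by linarith
  have st: "s - t = - (2 * (z \<bullet> h)) - h \<bullet> h"
    by (simp add: s_def t_def inner_add algebra_simps inner_commute)
  have hh: "h \<bullet> h = (norm h)\<^sup>2" by (simp add: power2_norm_eq_inner)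
  have t_le: "\<bar>t\<bar> \<le> e\<^sup>2 + (W + 1)\<^sup>2"
  proof -
    have "(norm z)\<^sup>2 \<le> (W + 1)\<^sup>2" using z by (intro power_mono) auto
    then show ?thesis unfolding t_def power2_norm_eq_inner[symmetric] abs_le_iff
      using zero_le_power2[of e] zero_le_power2[of "norm z"] by linarith
  qed
  have s_le: "\<bar>s\<bar> \<le> e\<^sup>2 + (W + 1)\<^sup>2"
  proof -
    have "norm (z + h) \<le> W + 1" using norm_triangle_ineq[of z h] z h by linarith
    then have "(norm (z + h))\<^sup>2 \<le> (W + 1)\<^sup>2" by (intro power_mono) auto
    then show ?thesis unfolding s_def power2_norm_eq_inner[symmetric] abs_le_iff
      using zero_le_power2[of e] zero_le_power2[of "norm (z + h)"] by linarith
  qed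
  have d_le: "\<bar>s - t\<bar> \<le> (2 * W + 1) * norm h"
  proof -
    have "\<bar>z \<bullet> h\<bar> \<le> norm z * norm h" by (rule Cauchy_Schwarz_ineq2)
    also have "\<dots> \<le> W * norm h" using z by (intro mult_right_mono) auto
    finally have "\<bar>z \<bullet> h\<bar> \<le> W * norm h" .
    moreover have "(norm h)\<^sup>2 \<le> norm h" using h by (simp add: power2_eq_square mult_left_le)
    ultimately show ?thesis unfolding st hh abs_le_iff
      by (simp add: algebra_simps abs_le_iff) (use zero_le_power2[of "norm h"] in linarith)
  qed
  have "bump e (z + h) - bump e z - bump_grad e z \<bullet> h =
     ((max 0 s) ^ 3 - (max 0 t) ^ 3 - 3 * (max 0 t)\<^sup>2 * (s - t)) - 3 * (max 0 t)\<^sup>2 * (norm h)\<^sup>2"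
    unfolding bump_def bump_grad_def s_def[symmetric] t_def[symmetric] st hh
    by (simp add: algebra_simps)
  also have "\<bar>\<dots>\<bar> \<le> 3 * max \<bar>s\<bar> \<bar>t\<bar> * (s - t)\<^sup>2 + 3 * (max 0 t)\<^sup>2 * (norm h)\<^sup>2"
    using cubic_part_taylor[of s t] abs_triangle_ineq4[of "(max 0 s) ^ 3 - (max 0 t) ^ 3 - 3 * (max 0 t)\<^sup>2 * (s - t)" "3 * (max 0 t)\<^sup>2 * (norm h)\<^sup>2"]
    by (simp add: abs_mult)
  also have "\<dots> \<le> 3 * (e\<^sup>2 + (W + 1)\<^sup>2) * ((2 * W + 1) * norm h)\<^sup>2 + 3 * (e\<^sup>2)\<^sup>2 * (norm h)\<^sup>2"
  proof (intro add_mono mult_mono)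
    show "(s - t)\<^sup>2 \<le> ((2 * W + 1) * norm h)\<^sup>2"
      using power_mono[OF d_le, of 2] by simp
    show "(max 0 t)\<^sup>2 \<le> (e\<^sup>2)\<^sup>2"
      by (intro power_mono) (auto simp: t_def)
  qed (use s_le t_le in auto)
  finally show ?thesis unfolding power_mult_distrib by (simp add: distrib_right mult.assoc)
qed

lemma bump_has_derivative: "(bump e has_derivative (\<lambda>h. bump_grad e z \<bullet> h)) (at z)"
  by (rule has_derivative_quadratic[OF bounded_linear_inner_right bump_taylor[OF _ order_refl]])

text \<open>The image of the cube has distance \<open>2 e\<close> from the boundary, so balls of radius \<open>e\<close> around its points stay inside.\<close>

definition shrink :: "real \<Rightarrow> 'a::euclidean_space \<Rightarrow> 'a" where
  "shrink e x = (2 * e) *\<^sub>R One + (1 - 4 * e) *\<^sub>R x"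

lemma shrink_inner: "b \<in> Basis \<Longrightarrow> shrink e x \<bullet> b = 2 * e + (1 - 4 * e) * (x \<bullet> b)"
  by (simp add: shrink_def inner_add_left)

lemma ball_shrink_subset:
  fixes x :: "'a::euclidean_space"
  assumes e: "0 < e" "e \<le> 1/8" and x: "x \<in> cbox 0 One"
  shows "cball (shrink e x) e \<subseteq> box 0 One"
proof
  fix y assume y: "y \<in> cball (shrink e x) e"
  show "y \<in> box 0 One"
    unfolding mem_box
  proof
    fix b :: 'a assume b: "b \<in> Basis"
    have "\<bar>(shrink e x - y) \<bullet> b\<bar> \<le> norm (shrink e x - y)" by (rule Basis_le_norm[OF b])
    also have "\<dots> \<le> e" using y by (simp add: dist_norm)
    finally have d: "\<bar>shrink e x \<bullet> b - y \<bullet> b\<bar> \<le> e" by (simp add: inner_diff_left)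
    have "0 \<le> x \<bullet> b" "x \<bullet> b \<le> 1" using x b by (auto simp: mem_box)
    then have "0 \<le> (1 - 4 * e) * (x \<bullet> b)" "(1 - 4 * e) * (x \<bullet> b) \<le> (1 - 4 * e) * 1"
      using e by (auto intro!: mult_left_mono)
    then have "2 * e \<le> shrink e x \<bullet> b" "shrink e x \<bullet> b \<le> 1 - 2 * e"
      unfolding shrink_inner[OF b] by auto
    then show "0 \<bullet> b < y \<bullet> b \<and> y \<bullet> b < One \<bullet> b" using d e b by (simp add: abs_le_iff)
  qed
qed

text \<open>The point x ranges over the closed cube: even at the boundary the kernel centred at
  \<open>shrink e x\<close> is admissible, and so the derivatives of mollified functions are
  identified up to the boundary.\<close>

lemma bump_test_function:
  fixes x :: "'a::euclidean_space"
  assumes e: "0 < e" "e \<le> 1/8" and x: "x \<in> cbox 0 One"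
  shows "(\<lambda>y. bump e (y - shrink e x)) \<in> test_functions"
    and "partial_deriv b (\<lambda>y. bump e (y - shrink e x)) y = bump_grad e (y - shrink e x) \<bullet> b"
proof -
  have d: "((\<lambda>y. bump e (y - shrink e x)) has_derivative (\<lambda>h. bump_grad e (y - shrink e x) \<bullet> h)) (at y)" for y
  proof -
    have "((\<lambda>y. y - shrink e x) has_derivative (\<lambda>h. h)) (at y)" by (auto intro!: derivative_eq_intros)
    from has_derivative_compose[OF this bump_has_derivative] show ?thesis .
  qed
  show "partial_deriv b (\<lambda>y. bump e (y - shrink e x)) y = bump_grad e (y - shrink e x) \<bullet> b"
    by (rule partial_deriv_eqI[OF d])
  have "(\<lambda>y. bump e (y - shrink e x)) \<in> C1"
    by (rule C1I[OF d]) (intro continuous_intros continuous_on_compose2[OF bump_grad_continuous], auto)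
  moreover have "bump e (y - shrink e x) = 0" if "y \<notin> cball (shrink e x) e" for y
  proof (rule ccontr)
    assume "bump e (y - shrink e x) \<noteq> 0"
    from bump_support[OF e(1) this] that show False by (simp add: dist_norm norm_minus_commute)
  qed
  ultimately show "(\<lambda>y. bump e (y - shrink e x)) \<in> test_functions"
    using ball_shrink_subset[OF e x] by (auto simp: test_functions_def intro!: exI[of _ "cball (shrink e x) e"])
qed

section \<open>Mollified functions and their derivatives\<close>

definition mollify0 :: "real \<Rightarrow> ('a::euclidean_space \<Rightarrow> real) \<Rightarrow> 'a \<Rightarrow> real" where
  "mollify0 e f x = (\<integral>y. f y * bump e (y - shrink e x) \<partial>cube_measure)"

lemma L2_cube_integrable:
  fixes f :: "'a::euclidean_space \<Rightarrow> real"
  assumes "f \<in> L2 cube_measure"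
  shows "integrable cube_measure f"
  using L2_mult_integrable[OF assms cube.L2_const[of 1]] by simp

lemma integrable_mult_bounded:
  fixes f :: "'a \<Rightarrow> real" and g :: "'a \<Rightarrow> 'b::euclidean_space"
  assumes "integrable M f" "g \<in> borel_measurable M" "\<And>x. norm (g x) \<le> K"
  shows "integrable M (\<lambda>x. f x *\<^sub>R g x)"
proof (rule Bochner_Integration.integrable_bound)
  show "integrable M (\<lambda>x. K * f x)" using assms(1) by simp
  show "(\<lambda>x. f x *\<^sub>R g x) \<in> borel_measurable M"
    using assms(2) borel_measurable_integrable[OF assms(1)] by measurable
  have "norm (f x *\<^sub>R g x) \<le> norm (K * f x)" for x
  proof -
    have "norm (f x *\<^sub>R g x) \<le> \<bar>f x\<bar> * K" using assms(3)[of x] by (simp add: mult_left_mono)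
    also have "\<dots> \<le> \<bar>f x\<bar> * \<bar>K\<bar>" by (intro mult_left_mono) auto
    finally show ?thesis by (simp add: abs_mult mult.commute)
  qed
  then show "AE x in M. norm (f x *\<^sub>R g x) \<le> norm (K * f x)" by (intro AE_I2)
qed

lemma integrable_mollify:
  fixes f :: "'a::euclidean_space \<Rightarrow> real"
  assumes "integrable cube_measure f"
  shows "integrable cube_measure (\<lambda>y. f y * bump e (y - a))"
proof -
  have m: "(\<lambda>y. bump e (y - a)) \<in> borel_measurable cube_measure"
    by (intro borel_measurable_cube_measure borel_measurable_continuous_onI
        continuous_on_compose2[OF bump_continuous] continuous_intros) auto
  have "norm (bump e (y - a)) \<le> (e\<^sup>2) ^ 3" for y using bump_le[of e "y - a"] by simp
  from integrable_mult_bounded[OF assms m this] show ?thesis by simp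
qed

lemma integrable_mollify_grad:
  fixes f :: "'a::euclidean_space \<Rightarrow> real"
  assumes "integrable cube_measure f" "0 < e"
  shows "integrable cube_measure (\<lambda>y. f y *\<^sub>R bump_grad e (y - a))"
proof (rule integrable_mult_bounded[OF assms(1)])
  show "(\<lambda>y. bump_grad e (y - a)) \<in> borel_measurable cube_measure"
    by (intro borel_measurable_cube_measure borel_measurable_continuous_onI
        continuous_on_compose2[OF bump_grad_continuous] continuous_intros) auto
qed (rule bump_grad_bound[OF assms(2)])

text \<open>Differentiation under the integral for a merely integrable f: the quadratic remainder of
  the kernel, uniform in y on the cube, is multiplied by \<open>\<bar>f y\<bar>\<close> and
  integrated. The factor \<open>- (1 - 4 * e)\<close> is the derivative of
  \<open>y - shrink e x\<close> in x.\<close>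

lemma mollify0_has_derivative:
  fixes f :: "'a::euclidean_space \<Rightarrow> real"
  assumes f: "integrable cube_measure f" and e: "0 < e" "e \<le> 1/8"
  shows "(mollify0 e f has_derivative
    (\<lambda>h. (- (1 - 4 * e) *\<^sub>R (\<integral>y. f y *\<^sub>R bump_grad e (y - shrink e x) \<partial>cube_measure)) \<bullet> h)) (at x)"
proof -
  let ?s = "1 - 4 * e" and ?V = "\<integral>y. f y *\<^sub>R bump_grad e (y - shrink e x) \<partial>cube_measure"
  have s: "0 \<le> ?s" "?s \<le> 1" using e by auto
  have cd: "continuous_on UNIV (\<lambda>y :: 'a. y - shrink e x)" by (intro continuous_intros)
  obtain W where W: "\<And>y. y \<in> cbox 0 One \<Longrightarrow> norm (y - shrink e x) \<le> W"
    using continuous_bounded_on_cube[OF cd] by metis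
  define K where "K = 3 * (e\<^sup>2 + (W + 1)\<^sup>2) * (2 * W + 1)\<^sup>2 + 3 * (e\<^sup>2)\<^sup>2"
  have K0: "0 \<le> K" by (simp add: K_def)
  show ?thesis
  proof (rule has_derivative_quadratic[OF bounded_linear_inner_right])
    fix h :: 'a assume h: "norm h \<le> 1"
    \<comment> \<open>The change of the kernel argument when x moves by h.\<close>
    define k where "k = (- ?s) *\<^sub>R h"
    have kh: "norm k \<le> norm h" using s by (simp add: k_def mult_left_le_one_le)
    have sh: "y - shrink e (x + h) = (y - shrink e x) + k" for y
      by (simp add: shrink_def k_def algebra_simps)
    have pw: "\<bar>f y * bump e (y - shrink e (x + h)) - f y * bump e (y - shrink e x) - (f y *\<^sub>R bump_grad e (y - shrink e x)) \<bullet> k\<bar>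
        \<le> (K * (norm h)\<^sup>2) * \<bar>f y\<bar>" if "y \<in> cbox 0 One" for y
    proof -
      have "\<bar>bump e ((y - shrink e x) + k) - bump e (y - shrink e x) - bump_grad e (y - shrink e x) \<bullet> k\<bar> \<le> K * (norm k)\<^sup>2"
        unfolding K_def by (rule bump_taylor) (use kh h W[OF that] in auto)
      also have "\<dots> \<le> K * (norm h)\<^sup>2" by (intro mult_left_mono power_mono kh K0) auto
      finally have "\<bar>f y\<bar> * \<bar>bump e ((y - shrink e x) + k) - bump e (y - shrink e x) - bump_grad e (y - shrink e x) \<bullet> k\<bar> \<le> \<bar>f y\<bar> * (K * (norm h)\<^sup>2)"
        by (intro mult_left_mono) auto
      then show ?thesis unfolding abs_mult[symmetric] sh by (simp add: algebra_simps)
    qed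
    note i1 = integrable_mollify[OF f, of e "shrink e (x + h)"] integrable_mollify[OF f, of e "shrink e x"]
      integrable_inner_left[OF integrable_mollify_grad[OF f e(1), of "shrink e x"], of k]
    have Vk: "(- ?s *\<^sub>R ?V) \<bullet> h = (\<integral>y. (f y *\<^sub>R bump_grad e (y - shrink e x)) \<bullet> k \<partial>cube_measure)"
    proof -
      have "(\<integral>y. (f y *\<^sub>R bump_grad e (y - shrink e x)) \<bullet> k \<partial>cube_measure) = ?V \<bullet> k"
        by (rule integral_inner_left) (rule integrable_mollify_grad[OF f e(1)])
      then show ?thesis by (simp only: k_def inner_scaleR_left inner_scaleR_right)
    qed
    have eq: "mollify0 e f (x + h) - mollify0 e f x - (- ?s *\<^sub>R ?V) \<bullet> h =
      (\<integral>y. f y * bump e (y - shrink e (x + h)) - f y * bump e (y - shrink e x) - (f y *\<^sub>R bump_grad e (y - shrink e x)) \<bullet> k \<partial>cube_measure)"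
      unfolding mollify0_def Vk
      using i1 integrable_mollify_grad[OF f e(1), of "shrink e x"] by simp
    have "\<bar>mollify0 e f (x + h) - mollify0 e f x - (- ?s *\<^sub>R ?V) \<bullet> h\<bar> \<le> (\<integral>y. \<bar>f y * bump e (y - shrink e (x + h)) - f y * bump e (y - shrink e x) - (f y *\<^sub>R bump_grad e (y - shrink e x)) \<bullet> k\<bar> \<partial>cube_measure)"
      unfolding eq by (rule integral_abs_bound)
    also have "\<dots> \<le> (\<integral>y. (K * (norm h)\<^sup>2) * \<bar>f y\<bar> \<partial>cube_measure)"
    proof (rule integral_mono)
      show "integrable cube_measure (\<lambda>y. \<bar>f y * bump e (y - shrink e (x + h)) - f y * bump e (y - shrink e x) - (f y *\<^sub>R bump_grad e (y - shrink e x)) \<bullet> k\<bar>)"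
        using i1 integrable_mollify_grad[OF f e(1), of "shrink e x"]
        by (intro integrable_abs Bochner_Integration.integrable_diff integrable_inner_left) auto
      show "integrable cube_measure (\<lambda>y. (K * (norm h)\<^sup>2) * \<bar>f y\<bar>)" using f by simp
    qed (use pw in auto)
    also have "\<dots> = (K * (\<integral>y. \<bar>f y\<bar> \<partial>cube_measure)) * (norm h)\<^sup>2" by simp
    finally show "\<bar>mollify0 e f (x + h) - mollify0 e f x - (- ?s *\<^sub>R ?V) \<bullet> h\<bar> \<le> (K * (\<integral>y. \<bar>f y\<bar> \<partial>cube_measure)) * (norm h)\<^sup>2" .
  qed
qed

lemma mollify0_C1:
  fixes f :: "'a::euclidean_space \<Rightarrow> real"
  assumes f: "integrable cube_measure f" and e: "0 < e" "e \<le> 1/8"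
  shows "mollify0 e f \<in> C1"
proof (rule C1I[OF mollify0_has_derivative[OF f e]])
  fix b :: 'a
  let ?I = "\<lambda>x. \<integral>y. f y *\<^sub>R bump_grad e (y - shrink e x) \<partial>cube_measure"
  have "isCont ?I x" for x
    unfolding continuous_at_sequentially comp_def
  proof (intro allI impI)
    fix X assume X: "X \<longlonglongrightarrow> x"
    show "(\<lambda>n. ?I (X n)) \<longlonglongrightarrow> ?I x"
    proof (rule integral_dominated_convergence)
      show "integrable cube_measure (\<lambda>y. (6 * (e\<^sup>2)\<^sup>2 * e) * \<bar>f y\<bar>)" using f by simp
      show "AE y in cube_measure. norm (f y *\<^sub>R bump_grad e (y - shrink e (X n))) \<le> (6 * (e\<^sup>2)\<^sup>2 * e) * \<bar>f y\<bar>" for n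
        using mult_right_mono[OF bump_grad_bound[OF e(1)] abs_ge_zero]
        by (intro AE_I2) (simp add: mult.commute)
      show "AE y in cube_measure. (\<lambda>n. f y *\<^sub>R bump_grad e (y - shrink e (X n))) \<longlonglongrightarrow> f y *\<^sub>R bump_grad e (y - shrink e x)"
      proof (rule AE_I2)
        fix y
        have "isCont (bump_grad e) (y - shrink e x)"
          using bump_grad_continuous[of e] continuous_on_eq_continuous_at[OF open_UNIV] by blast
        moreover have "(\<lambda>n. y - shrink e (X n)) \<longlonglongrightarrow> y - shrink e x"
          unfolding shrink_def by (intro tendsto_intros X)
        ultimately have "(\<lambda>n. bump_grad e (y - shrink e (X n))) \<longlonglongrightarrow> bump_grad e (y - shrink e x)"
          by (rule isCont_tendsto_compose)
        then show "(\<lambda>n. f y *\<^sub>R bump_grad e (y - shrink e (X n))) \<longlonglongrightarrow> f y *\<^sub>R bump_grad e (y - shrink e x)"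
          by (intro tendsto_intros)
      qed
    qed (rule borel_measurable_integrable[OF integrable_mollify_grad[OF f e(1)]])+
  qed
  then have "continuous_on UNIV ?I" by (simp add: continuous_at_imp_continuous_on)
  then show "continuous_on UNIV (\<lambda>x. (- (1 - 4 * e) *\<^sub>R ?I x) \<bullet> b)"
    by (intro continuous_intros)
qed

text \<open>The kernel depends on x and y through \<open>y - shrink e x\<close>, so its x-derivative
  is \<open>- (1 - 4 * e)\<close> times its y-derivative; the minus sign cancels against the one in
  the definition of the weak derivative. The surviving factor tends to 1 with e.\<close>

lemma mollify0_partial_deriv:
  fixes u g :: "'a::euclidean_space \<Rightarrow> real"
  assumes u: "u \<in> L2 cube_measure" and g: "is_weak_deriv b u g" and e: "0 < e" "e \<le> 1/8"
    and x: "x \<in> cbox 0 One"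
  shows "partial_deriv b (mollify0 e u) x = (1 - 4 * e) * mollify0 e g x"
proof -
  let ?s = "1 - 4 * e"
  note int = L2_cube_integrable[OF u]
  have "partial_deriv b (mollify0 e u) x = (- ?s *\<^sub>R (\<integral>y. u y *\<^sub>R bump_grad e (y - shrink e x) \<partial>cube_measure)) \<bullet> b"
    by (rule partial_deriv_eqI[OF mollify0_has_derivative[OF int e]])
  also have "\<dots> = - ?s * (\<integral>y. u y * (bump_grad e (y - shrink e x) \<bullet> b) \<partial>cube_measure)"
    using integral_inner_left[of b cube_measure "\<lambda>y. u y *\<^sub>R bump_grad e (y - shrink e x)"]
      integrable_mollify_grad[OF int e(1), of "shrink e x"] by simp
  also have "(\<integral>y. u y * (bump_grad e (y - shrink e x) \<bullet> b) \<partial>cube_measure) = - (\<integral>y. g y * bump e (y - shrink e x) \<partial>cube_measure)"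
    using g bump_test_function(1)[OF e x] unfolding is_weak_deriv_def bump_test_function(2)[OF e x, symmetric]
    by blast
  finally show ?thesis unfolding mollify0_def[of e g x] by (simp only: mult_minus_left mult_minus_right minus_minus)
qed

section \<open>Normalisation and uniform bounds\<close>

definition bump_mass :: "'a::euclidean_space itself \<Rightarrow> real \<Rightarrow> real" where
  "bump_mass _ e = (\<integral>z. bump e (z :: 'a) \<partial>lborel)"

lemma bump_mass:
  assumes e: "0 < e"
  shows nn_integral_bump: "(\<integral>\<^sup>+z. ennreal (bump e (z :: 'a::euclidean_space)) \<partial>lborel) = ennreal (bump_mass TYPE('a) e)"
    and bump_mass_pos: "0 < bump_mass TYPE('a) e"
proof -
  have "integrable lborel (bump e :: 'a \<Rightarrow> real)"
  proof (rule Bochner_Integration.integrable_bound)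
    show "integrable lborel (\<lambda>z :: 'a. (e\<^sup>2) ^ 3 * indicator (cball 0 e) z)"
      using emeasure_bounded_finite[OF bounded_cball, of "0::'a" e] by simp
    show "AE z in lborel. norm (bump e (z :: 'a)) \<le> norm ((e\<^sup>2) ^ 3 * indicator (cball 0 e) z :: real)"
    proof (rule AE_I2)
      fix z :: 'a
      show "norm (bump e z) \<le> norm ((e\<^sup>2) ^ 3 * indicator (cball 0 e) z :: real)"
      proof (cases "bump e z = 0")
        case False
        from bump_support[OF e this] have "z \<in> cball 0 e" by simp
        then show ?thesis using bump_le[of e z] by simp
      qed simp
    qed
  qed simp
  then have int: "integrable lborel (bump e :: 'a \<Rightarrow> real)" .
  then show *: "(\<integral>\<^sup>+z. ennreal (bump e (z :: 'a)) \<partial>lborel) = ennreal (bump_mass TYPE('a) e)"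
    unfolding bump_mass_def by (intro nn_integral_eq_integral) auto
  \<comment> \<open>Zero mass would make the open set where the kernel is nonzero negligible,
    although it contains the origin.\<close>
  have "bump_mass TYPE('a) e \<noteq> 0"
  proof
    assume "bump_mass TYPE('a) e = 0"
    then have "AE z in lborel. bump e (z :: 'a) = 0"
      using integral_nonneg_eq_0_iff_AE[OF int] by (simp add: bump_mass_def)
    then have "{z :: 'a. bump e z \<noteq> 0} \<in> null_sets lborel"
      by (subst (asm) AE_iff_null) auto
    then have "negligible {z :: 'a. bump e z \<noteq> 0}"
      by (simp add: negligible_iff_null_sets null_sets_completionI)
    moreover have "open {z :: 'a. bump e z \<noteq> 0}"
      by (intro open_Collect_neq bump_continuous continuous_on_const)
    moreover have "(0 :: 'a) \<in> {z :: 'a. bump e z \<noteq> 0}" using e by (simp add: bump_def)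
    ultimately show False using open_not_negligible by blast
  qed
  moreover have "0 \<le> bump_mass TYPE('a) e" unfolding bump_mass_def by simp
  ultimately show "0 < bump_mass TYPE('a) e" by simp
qed

text \<open>The ball around \<open>shrink e x\<close> lies inside the cube, so no mass of the kernel
  is cut off, not even for x on the boundary.\<close>

lemma nn_integral_bump_shift:
  fixes x :: "'a::euclidean_space"
  assumes e: "0 < e" "e \<le> 1/8" and x: "x \<in> cbox 0 One"
  shows "(\<integral>\<^sup>+y. ennreal (bump e (y - shrink e x)) \<partial>cube_measure) = ennreal (bump_mass TYPE('a) e)"
proof -
  have m: "(\<lambda>y. ennreal (bump e (y - shrink e x))) \<in> borel_measurable borel"
    by (intro measurable_compose[OF _ measurable_ennreal] borel_measurable_continuous_onI
        continuous_on_compose2[OF bump_continuous] continuous_intros) auto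
  have "(\<integral>\<^sup>+y. ennreal (bump e (y - shrink e x)) \<partial>cube_measure) =
      (\<integral>\<^sup>+y. ennreal (bump e (y - shrink e x)) * indicator (cbox 0 One) y \<partial>lborel)"
    by (rule nn_integral_cube_measure[OF m])
  also have "\<dots> = (\<integral>\<^sup>+y. ennreal (bump e (y - shrink e x)) \<partial>lborel)"
  proof (intro nn_integral_cong)
    fix y :: 'a
    have "y \<in> cbox 0 One" if "bump e (y - shrink e x) \<noteq> 0"
    proof -
      have "y \<in> cball (shrink e x) e"
        using bump_support[OF e(1) that] by (simp add: dist_norm norm_minus_commute)
      then show ?thesis using ball_shrink_subset[OF e x] box_subset_cbox by blast
    qed
    then show "ennreal (bump e (y - shrink e x)) * indicator (cbox 0 One) y = ennreal (bump e (y - shrink e x))"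
      by (cases "bump e (y - shrink e x) = 0") (auto simp: indicator_def)
  qed
  also have "\<dots> = (\<integral>\<^sup>+y. ennreal (bump e (y :: 'a)) \<partial>lborel)"
    using nn_integral_lborel_affine[OF m, of 1 "shrink e x"] by simp
  also have "\<dots> = ennreal (bump_mass TYPE('a) e)" by (rule nn_integral_bump[OF e(1)])
  finally show ?thesis .
qed

text \<open>Integration over the centre instead of the argument costs the inverse Jacobian of
  \<open>shrink e\<close>. The restriction \<open>e \<le> 1/8\<close> keeps \<open>1 - 4 * e\<close>
  above 1/2, which bounds this cost independently of e.\<close>

lemma nn_integral_bump_dual:
  fixes y :: "'a::euclidean_space"
  assumes e: "0 < e" "e \<le> 1/8"
  shows "(\<integral>\<^sup>+x. ennreal (bump e (y - shrink e x)) \<partial>cube_measure) \<le> ennreal (2 ^ DIM('a) * bump_mass TYPE('a) e)"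
proof -
  let ?s = "1 - 4 * e"
  have m: "(\<lambda>x. ennreal (bump e (y - shrink e x))) \<in> borel_measurable borel"
    unfolding shrink_def
    by (intro measurable_compose[OF _ measurable_ennreal] borel_measurable_continuous_onI
        continuous_on_compose2[OF bump_continuous] continuous_intros) auto
  have "1 \<le> (2 * ?s) ^ DIM('a)" using e by (intro one_le_power) auto
  then have "1 \<le> 2 ^ DIM('a) * ?s ^ DIM('a)" by (simp only: power_mult_distrib)
  then have "1 * (\<integral>\<^sup>+x. ennreal (bump e (y - shrink e x)) \<partial>lborel) \<le>
      ennreal (2 ^ DIM('a) * ?s ^ DIM('a)) * (\<integral>\<^sup>+x. ennreal (bump e (y - shrink e x)) \<partial>lborel)"
    by (intro mult_right_mono) auto
  also have "\<dots> = ennreal (2 ^ DIM('a)) * (ennreal (?s ^ DIM('a)) * (\<integral>\<^sup>+x. ennreal (bump e (y - shrink e x)) \<partial>lborel))"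
    using e by (simp add: ennreal_mult mult.assoc)
  also have "ennreal (?s ^ DIM('a)) * (\<integral>\<^sup>+x. ennreal (bump e (y - shrink e x)) \<partial>lborel) =
      (\<integral>\<^sup>+z. ennreal (bump e (z :: 'a)) \<partial>lborel)"
    using nn_integral_lborel_affine[of "\<lambda>z. ennreal (bump e (z :: 'a))" "- ?s" "y - (2 * e) *\<^sub>R One"] e
    by (simp add: shrink_def algebra_simps)
  also have "\<dots> = ennreal (bump_mass TYPE('a) e)" by (rule nn_integral_bump[OF e(1)])
  finally have "(\<integral>\<^sup>+x. ennreal (bump e (y - shrink e x)) \<partial>lborel) \<le> ennreal (2 ^ DIM('a)) * ennreal (bump_mass TYPE('a) e)"
    by simp
  moreover have "(\<integral>\<^sup>+x. ennreal (bump e (y - shrink e x)) \<partial>cube_measure) \<le> (\<integral>\<^sup>+x. ennreal (bump e (y - shrink e x)) \<partial>lborel)"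
    unfolding nn_integral_cube_measure[OF m] by (intro nn_integral_mono) (simp add: indicator_def)
  ultimately show ?thesis
    using bump_mass_pos[OF e(1), where 'a='a] by (simp add: ennreal_mult)
qed

text \<open>The normalising factor is the same for every x because each kernel carries its full mass
  inside the cube; differentiation therefore passes through it.\<close>

definition mollify :: "real \<Rightarrow> ('a::euclidean_space \<Rightarrow> real) \<Rightarrow> 'a \<Rightarrow> real" where
  "mollify e f x = inverse (bump_mass TYPE('a) e) * mollify0 e f x"

lemma mollify_C1:
  fixes f :: "'a::euclidean_space \<Rightarrow> real"
  assumes "f \<in> L2 cube_measure" "0 < e" "e \<le> 1/8"
  shows "mollify e f \<in> C1"
    and "partial_deriv b (mollify e f) x = inverse (bump_mass TYPE('a) e) * partial_deriv b (mollify0 e f) x"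
proof -
  have m0: "mollify0 e f \<in> C1" by (rule mollify0_C1[OF L2_cube_integrable[OF assms(1)] assms(2,3)])
  have "(\<lambda>x. inverse (bump_mass TYPE('a) e) + 0 \<bullet> x) \<in> (C1 :: ('a \<Rightarrow> real) set)" by (rule C1_affine)
  then have c: "(\<lambda>x. inverse (bump_mass TYPE('a) e)) \<in> (C1 :: ('a \<Rightarrow> real) set)" by simp
  have c': "partial_deriv b (\<lambda>x :: 'a. inverse (bump_mass TYPE('a) e)) x = 0" for b x
    by (rule partial_deriv_eqI) simp
  have eq: "mollify e f = (\<lambda>x. inverse (bump_mass TYPE('a) e) * mollify0 e f x)"
    by (rule ext) (rule mollify_def)
  show "mollify e f \<in> C1" unfolding eq by (rule C1_mult(1)[OF c m0])
  show "partial_deriv b (mollify e f) x = inverse (bump_mass TYPE('a) e) * partial_deriv b (mollify0 e f) x"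
    unfolding eq C1_mult(2)[OF c m0] c' by simp
qed

lemma mollify_partial_deriv:
  fixes u g :: "'a::euclidean_space \<Rightarrow> real"
  assumes "u \<in> L2 cube_measure" "is_weak_deriv b u g" "0 < e" "e \<le> 1/8" "x \<in> cbox 0 One"
  shows "partial_deriv b (mollify e u) x = (1 - 4 * e) * mollify e g x"
  unfolding mollify_C1(2)[OF assms(1,3,4)] mollify0_partial_deriv[OF assms] mollify_def by simp

lemma mollify_diff:
  fixes f g :: "'a::euclidean_space \<Rightarrow> real"
  assumes "f \<in> L2 cube_measure" "g \<in> L2 cube_measure"
  shows "mollify e (\<lambda>x. f x - g x) x = mollify e f x - mollify e g x"
  using integrable_mollify[OF L2_cube_integrable[OF assms(1)], of e "shrink e x"]
    integrable_mollify[OF L2_cube_integrable[OF assms(2)], of e "shrink e x"]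
  unfolding mollify_def mollify0_def by (simp add: left_diff_distrib right_diff_distrib)

lemma integral_bump_shift:
  fixes x :: "'a::euclidean_space"
  assumes e: "0 < e" "e \<le> 1/8" and x: "x \<in> cbox 0 One"
  shows "(\<integral>y. bump e (y - shrink e x) \<partial>cube_measure) = bump_mass TYPE('a) e"
    and "integrable cube_measure (\<lambda>y. bump e (y - shrink e x))"
proof -
  show int: "integrable cube_measure (\<lambda>y. bump e (y - shrink e x))"
    by (intro integrable_cube_measure_continuous continuous_on_compose2[OF bump_continuous] continuous_intros) auto
  have "ennreal (\<integral>y. bump e (y - shrink e x) \<partial>cube_measure) = ennreal (bump_mass TYPE('a) e)"
    unfolding nn_integral_bump_shift[OF assms, symmetric]
    by (rule nn_integral_eq_integral[symmetric, OF int]) simp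
  then show "(\<integral>y. bump e (y - shrink e x) \<partial>cube_measure) = bump_mass TYPE('a) e"
    using bump_mass_pos[OF e(1), where 'a='a] by (subst (asm) ennreal_inj) auto
qed

text \<open>The kernel-weighted variance of f about its weighted mean \<open>mollify e f x\<close>
  is nonnegative.\<close>

lemma mollify_Jensen:
  fixes f :: "'a::euclidean_space \<Rightarrow> real"
  assumes f: "f \<in> L2 cube_measure" and e: "0 < e" "e \<le> 1/8" and x: "x \<in> cbox 0 One"
  shows "bump_mass TYPE('a) e * (mollify e f x)\<^sup>2 \<le> (\<integral>y. (f y)\<^sup>2 * bump e (y - shrink e x) \<partial>cube_measure)"
    and "integrable cube_measure (\<lambda>y. (f y)\<^sup>2 * bump e (y - shrink e x))"
proof -
  let ?Z = "bump_mass TYPE('a) e" and ?k = "\<lambda>y. bump e (y - shrink e x)" and ?m = "mollify e f x"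
  have i1: "integrable cube_measure (\<lambda>y. f y * ?k y)" by (rule integrable_mollify[OF L2_cube_integrable[OF f]])
  have "integrable cube_measure (\<lambda>y. (f y)\<^sup>2)" using L2_integrable_power2[OF f] by simp
  from integrable_mollify[OF this] show i2: "integrable cube_measure (\<lambda>y. (f y)\<^sup>2 * ?k y)" .
  note i0 = integral_bump_shift(2)[OF e x]
  have fk: "(\<integral>y. f y * ?k y \<partial>cube_measure) = ?m * ?Z"
    using bump_mass_pos[OF e(1), where 'a='a] unfolding mollify_def mollify0_def by simp
  have "0 \<le> (\<integral>y. (f y - ?m)\<^sup>2 * ?k y \<partial>cube_measure)" by simp
  also have "\<dots> = (\<integral>y. ((f y)\<^sup>2 * ?k y - (2 * ?m) * (f y * ?k y)) + ?m\<^sup>2 * ?k y \<partial>cube_measure)"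
    by (intro Bochner_Integration.integral_cong refl) (simp add: power2_eq_square algebra_simps)
  also have "\<dots> = (\<integral>y. (f y)\<^sup>2 * ?k y - (2 * ?m) * (f y * ?k y) \<partial>cube_measure) + (\<integral>y. ?m\<^sup>2 * ?k y \<partial>cube_measure)"
    by (intro Bochner_Integration.integral_add Bochner_Integration.integrable_diff integrable_mult_right i0 i1 i2)
  also have "(\<integral>y. (f y)\<^sup>2 * ?k y - (2 * ?m) * (f y * ?k y) \<partial>cube_measure) =
      (\<integral>y. (f y)\<^sup>2 * ?k y \<partial>cube_measure) - (\<integral>y. (2 * ?m) * (f y * ?k y) \<partial>cube_measure)"
    by (intro Bochner_Integration.integral_diff integrable_mult_right i1 i2)
  finally have "0 \<le> (\<integral>y. (f y)\<^sup>2 * ?k y \<partial>cube_measure) - 2 * ?m * (?m * ?Z) + ?m\<^sup>2 * ?Z"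
    by (simp add: fk integral_bump_shift(1)[OF e x])
  then show "?Z * ?m\<^sup>2 \<le> (\<integral>y. (f y)\<^sup>2 * ?k y \<partial>cube_measure)"
    by (simp add: power2_eq_square algebra_simps)
qed

text \<open>A Schur test: the pointwise Jensen bound is integrated in x, and after Fubini the dual
  kernel bound is applied for each y. The contraction turns the usual constant 1 into
  \<open>2 ^ DIM('a)\<close>; its independence of e is what the density argument requires.\<close>

lemma mollify_L2_bound:
  fixes f :: "'a::euclidean_space \<Rightarrow> real"
  assumes f: "f \<in> L2 cube_measure" and e: "0 < e" "e \<le> 1/8"
  shows "(L2_norm cube_measure (mollify e f))\<^sup>2 \<le> 2 ^ DIM('a) * (L2_norm cube_measure f)\<^sup>2"
proof -
  let ?c = "cube_measure :: 'a measure"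
  let ?Z = "bump_mass TYPE('a) e" and ?k = "\<lambda>x y :: 'a. bump e (y - shrink e x)"
  interpret P: pair_sigma_finite ?c ?c ..
  note Z = bump_mass_pos[OF e(1), where 'a='a]
  note fm = L2_measurable[OF f]
  have km: "(\<lambda>y. ennreal (?k x y)) \<in> borel_measurable ?c" "(\<lambda>x. ennreal (?k x y)) \<in> borel_measurable ?c" for x y
    unfolding shrink_def
    by (intro borel_measurable_cube_measure measurable_compose[OF _ measurable_ennreal] borel_measurable_continuous_onI
        continuous_on_compose2[OF bump_continuous] continuous_intros, simp)+
  have kp: "(\<lambda>(x, y). ennreal (?k x y)) \<in> borel_measurable (?c \<Otimes>\<^sub>M ?c)"
  proof (rule measurable_pair_borel[OF _ id_measurable_cube id_measurable_cube])
    have "(\<lambda>p. snd p - shrink e (fst p)) \<in> borel \<Otimes>\<^sub>M borel \<rightarrow>\<^sub>M (borel :: 'a measure)"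
      unfolding shrink_def by measurable
    from measurable_compose[OF measurable_compose[OF this bump_measurable] measurable_ennreal]
    show "(\<lambda>(x, y). ennreal (?k x y)) \<in> borel_measurable (borel \<Otimes>\<^sub>M borel)" by (simp add: split_def)
  qed
  have f2: "(\<lambda>y. ennreal ((f y)\<^sup>2)) \<in> borel_measurable ?c" using fm by measurable
  have pm: "(\<lambda>(x, y). ennreal ((f y)\<^sup>2) * ennreal (?k x y)) \<in> borel_measurable (?c \<Otimes>\<^sub>M ?c)"
    using kp measurable_compose[OF measurable_snd f2, of ?c]
    by (simp add: split_def borel_measurable_times_ennreal)
  have mL2: "mollify e f \<in> L2 ?c"
    by (rule continuous_L2_cube[OF C1_continuous[OF mollify_C1(1)[OF f e]]])
  have int2: "integrable ?c (\<lambda>x. (mollify e f x)\<^sup>2)" "integrable ?c (\<lambda>x. (f x)\<^sup>2)"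
    using L2_integrable_power2[OF mL2] L2_integrable_power2[OF f] by simp_all
  have "ennreal (?Z * (L2_norm ?c (mollify e f))\<^sup>2) = (\<integral>\<^sup>+x. ennreal (?Z * (mollify e f x)\<^sup>2) \<partial>?c)"
    using int2(1) Z by (subst nn_integral_eq_integral) (auto simp: L2_norm_power2)
  also have "\<dots> \<le> (\<integral>\<^sup>+x. \<integral>\<^sup>+y. ennreal ((f y)\<^sup>2) * ennreal (?k x y) \<partial>?c \<partial>?c)"
  proof (rule nn_integral_mono)
    fix x assume "x \<in> space ?c"
    then have x: "x \<in> cbox 0 One" by simp
    have "ennreal (?Z * (mollify e f x)\<^sup>2) \<le> ennreal (\<integral>y. (f y)\<^sup>2 * ?k x y \<partial>?c)"
      by (rule ennreal_leI[OF mollify_Jensen(1)[OF f e x]])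
    also have "\<dots> = (\<integral>\<^sup>+y. ennreal ((f y)\<^sup>2 * ?k x y) \<partial>?c)"
      by (rule nn_integral_eq_integral[symmetric, OF mollify_Jensen(2)[OF f e x]]) simp
    also have "\<dots> = (\<integral>\<^sup>+y. ennreal ((f y)\<^sup>2) * ennreal (?k x y) \<partial>?c)"
      by (simp add: ennreal_mult)
    finally show "ennreal (?Z * (mollify e f x)\<^sup>2) \<le> (\<integral>\<^sup>+y. ennreal ((f y)\<^sup>2) * ennreal (?k x y) \<partial>?c)" .
  qed
  also have "\<dots> = (\<integral>\<^sup>+y. \<integral>\<^sup>+x. ennreal ((f y)\<^sup>2) * ennreal (?k x y) \<partial>?c \<partial>?c)"
    by (rule P.Fubini'[symmetric, OF pm])
  also have "\<dots> = (\<integral>\<^sup>+y. ennreal ((f y)\<^sup>2) * (\<integral>\<^sup>+x. ennreal (?k x y) \<partial>?c) \<partial>?c)"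
    by (intro nn_integral_cong nn_integral_cmult km)
  also have "\<dots> \<le> (\<integral>\<^sup>+y. ennreal ((f y)\<^sup>2) * ennreal (2 ^ DIM('a) * ?Z) \<partial>?c)"
    by (intro nn_integral_mono mult_left_mono nn_integral_bump_dual e) simp
  also have "\<dots> = (\<integral>\<^sup>+y. ennreal ((f y)\<^sup>2) \<partial>?c) * ennreal (2 ^ DIM('a) * ?Z)"
    by (rule nn_integral_multc[OF f2])
  also have "\<dots> = ennreal ((L2_norm ?c f)\<^sup>2) * ennreal (2 ^ DIM('a) * ?Z)"
    using int2(2) by (subst nn_integral_eq_integral) (auto simp: L2_norm_power2)
  also have "\<dots> = ennreal ((L2_norm ?c f)\<^sup>2 * (2 ^ DIM('a) * ?Z))"
    using Z by (intro ennreal_mult[symmetric]) auto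
  finally have "?Z * (L2_norm ?c (mollify e f))\<^sup>2 \<le> (L2_norm ?c f)\<^sup>2 * (2 ^ DIM('a) * ?Z)"
    using Z by (subst (asm) ennreal_le_iff) auto
  then have "?Z * (L2_norm ?c (mollify e f))\<^sup>2 \<le> ?Z * (2 ^ DIM('a) * (L2_norm ?c f)\<^sup>2)"
    by (simp only: mult_ac)
  then show ?thesis using Z by (rule mult_left_le_imp_le)
qed

text \<open>A mollified value averages g over points close to x, so uniform continuity on the cube
  gives convergence that is uniform up to the boundary.\<close>

lemma mollify_uniform:
  fixes g :: "'a::euclidean_space \<Rightarrow> real"
  assumes g: "continuous_on UNIV g" and d: "0 < d"
  obtains e0 where "0 < e0"
    "\<And>e x. 0 < e \<Longrightarrow> e \<le> 1/8 \<Longrightarrow> e < e0 \<Longrightarrow> x \<in> cbox 0 One \<Longrightarrow> \<bar>mollify e g x - g x\<bar> \<le> d"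
proof -
  have "uniformly_continuous_on (cbox 0 One) g"
    by (intro compact_uniformly_continuous continuous_on_subset[OF g]) auto
  then obtain \<delta> where \<delta>: "0 < \<delta>"
    "\<And>x y. x \<in> cbox 0 One \<Longrightarrow> y \<in> cbox 0 One \<Longrightarrow> dist y x < \<delta> \<Longrightarrow> dist (g y) (g x) < d"
    unfolding uniformly_continuous_on_def using d by metis
  \<comment> \<open>The support of the kernel has radius e, and its centre is displaced from x by at
    most \<open>2 * e\<close> in each coordinate.\<close>
  let ?e0 = "\<delta> / (1 + 2 * DIM('a))"
  show ?thesis
  proof (rule that[of ?e0])
    show "0 < ?e0" using \<delta> by (simp add: add_pos_nonneg)
    fix e and x :: 'a assume e: "0 < e" "e \<le> 1/8" and e0: "e < ?e0" and x: "x \<in> cbox 0 One"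
    let ?Z = "bump_mass TYPE('a) e" and ?k = "\<lambda>y. bump e (y - shrink e x)"
    note Z = bump_mass_pos[OF e(1), where 'a='a]
    have eD: "e * (1 + 2 * DIM('a)) < \<delta>"
      using e0 by (simp add: pos_less_divide_eq add_pos_nonneg)
    have sx: "norm (shrink e x - x) \<le> 2 * e * DIM('a)"
    proof -
      have "norm (shrink e x - x) \<le> (\<Sum>b\<in>Basis. \<bar>(shrink e x - x) \<bullet> b\<bar>)" by (rule norm_le_l1)
      also have "\<dots> \<le> (\<Sum>b\<in>(Basis::'a set). 2 * e)"
      proof (rule sum_mono)
        fix b :: 'a assume b: "b \<in> Basis"
        have "0 \<le> x \<bullet> b" "x \<bullet> b \<le> 1" using x b by (auto simp: mem_box)
        then have "0 \<le> 4 * e * (x \<bullet> b)" "4 * e * (x \<bullet> b) \<le> 4 * e * 1"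
          using e by (auto intro!: mult_left_mono)
        then show "\<bar>(shrink e x - x) \<bullet> b\<bar> \<le> 2 * e"
          unfolding inner_diff_left shrink_inner[OF b] by (simp add: algebra_simps abs_le_iff)
      qed
      finally show ?thesis by (simp add: mult_ac)
    qed
    have gk: "\<bar>(g y - g x) * ?k y\<bar> \<le> d * ?k y" if y: "y \<in> cbox 0 One" for y
    proof (cases "?k y = 0")
      case False
      from bump_support[OF e(1) this] have "norm (y - shrink e x) < e" .
      then have "dist y x < e + 2 * e * DIM('a)"
        using sx norm_triangle_ineq[of "y - shrink e x" "shrink e x - x"] by (simp add: dist_norm)
      then have "dist y x < \<delta>" using eD by (simp add: algebra_simps)
      from \<delta>(2)[OF x y this] have "\<bar>g y - g x\<bar> \<le> d" by (simp add: dist_real_def)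
      then show ?thesis by (simp add: abs_mult mult_right_mono)
    qed simp
    note i1 = integrable_mollify[OF integrable_cube_measure_continuous[OF g], of e "shrink e x"]
    note i0 = integral_bump_shift[OF e x]
    have "?Z * (mollify e g x - g x) = (\<integral>y. g y * ?k y \<partial>cube_measure) - (\<integral>y. g x * ?k y \<partial>cube_measure)"
      using Z i0(1) unfolding mollify_def mollify0_def by (simp add: right_diff_distrib)
    also have "\<dots> = (\<integral>y. (g y - g x) * ?k y \<partial>cube_measure)"
      unfolding left_diff_distrib using i1 i0(2) by (intro Bochner_Integration.integral_diff[symmetric]) auto
    finally have eq: "?Z * (mollify e g x - g x) = (\<integral>y. (g y - g x) * ?k y \<partial>cube_measure)" .
    have "\<bar>?Z * (mollify e g x - g x)\<bar> \<le> (\<integral>y. \<bar>(g y - g x) * ?k y\<bar> \<partial>cube_measure)"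
      unfolding eq by (rule integral_abs_bound)
    also have "\<dots> \<le> (\<integral>y. d * ?k y \<partial>cube_measure)"
    proof (rule integral_mono)
      show "integrable cube_measure (\<lambda>y. \<bar>(g y - g x) * ?k y\<bar>)"
        unfolding left_diff_distrib using i1 i0(2) by (intro integrable_abs Bochner_Integration.integrable_diff) auto
    qed (use i0(2) gk in auto)
    also have "\<dots> = ?Z * d" by (simp add: i0(1))
    finally have "?Z * \<bar>mollify e g x - g x\<bar> \<le> ?Z * d" using Z by (simp add: abs_mult)
    then show "\<bar>mollify e g x - g x\<bar> \<le> d" using Z by (rule mult_left_le_imp_le)
  qed
qed

text \<open>Uniform convergence on continuous functions extends to all of \<open>L2\<close> by
  density, since the mollifiers are bounded uniformly in e.\<close>

lemma mollify_tendsto: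
  fixes f :: "'a::euclidean_space \<Rightarrow> real"
  assumes f: "f \<in> L2 cube_measure" and e: "\<And>m. 0 < e m" "\<And>m. e m \<le> 1/8" and e0: "e \<longlonglongrightarrow> 0"
  shows "(\<lambda>m. L2_norm cube_measure (\<lambda>x. mollify (e m) f x - f x)) \<longlonglongrightarrow> 0"
proof (rule LIMSEQ_I)
  let ?c = "cube_measure :: 'a measure"
  fix r :: real assume r: "0 < r"
  define S where "S = sqrt (2 ^ DIM('a))"
  have S: "0 < S + 1" by (simp add: S_def add_nonneg_pos)
  \<comment> \<open>Replacing f by g costs at most \<open>S * d\<close> under the mollifier and d
    outside it, together r / 3; another r / 3 is the uniform error for g.\<close>
  define d where "d = r / (3 * (S + 1))"
  have d: "0 < d" "d * (S + 1) = r / 3"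
    unfolding d_def times_divide_eq_left using r S by (simp, subst mult_divide_mult_cancel_right, auto)
  obtain g where g: "continuous_on UNIV g" and gf: "L2_norm ?c (\<lambda>x. g x - f x) < d"
    using L2_cube_continuous_dense[OF f d(1)] by blast
  note gL = continuous_L2_cube[OF g]
  obtain \<delta> where \<delta>: "0 < \<delta>"
    "\<And>e x. 0 < e \<Longrightarrow> e \<le> 1/8 \<Longrightarrow> e < \<delta> \<Longrightarrow> x \<in> cbox 0 One \<Longrightarrow> \<bar>mollify e g x - g x\<bar> \<le> r / 3"
    using mollify_uniform[OF g, of "r / 3"] r by (metis divide_pos_pos zero_less_numeral)
  obtain M where M: "\<And>m. m \<ge> M \<Longrightarrow> e m < \<delta>"
  proof -
    from LIMSEQ_D[OF e0 \<delta>(1)] obtain M where M: "\<And>m. m \<ge> M \<Longrightarrow> norm (e m - 0) < \<delta>" by blast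
    show ?thesis
    proof (rule that)
      fix m assume "M \<le> m"
      from M[OF this] show "e m < \<delta>" by simp
    qed
  qed
  show "\<exists>M. \<forall>m\<ge>M. norm (L2_norm ?c (\<lambda>x. mollify (e m) f x - f x) - 0) < r"
  proof (intro exI allI impI)
    fix m assume m: "M \<le> m"
    let ?A = "mollify (e m)"
    have AL: "?A h \<in> L2 ?c" if "h \<in> L2 ?c" for h
      by (rule continuous_L2_cube[OF C1_continuous[OF mollify_C1(1)[OF that e]]])
    have 1: "L2_norm ?c (\<lambda>x. ?A f x - ?A g x) \<le> S * d"
    proof -
      have "L2_norm ?c (\<lambda>x. ?A f x - ?A g x) = L2_norm ?c (?A (\<lambda>x. f x - g x))"
        by (rule L2_norm_cong) (simp add: mollify_diff[OF f gL])
      also have "\<dots> \<le> S * L2_norm ?c (\<lambda>x. f x - g x)"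
      proof (rule power2_le_imp_le)
        show "(L2_norm ?c (?A (\<lambda>x. f x - g x)))\<^sup>2 \<le> (S * L2_norm ?c (\<lambda>x. f x - g x))\<^sup>2"
          using mollify_L2_bound[OF L2_diff[OF f gL] e] by (simp add: S_def power_mult_distrib)
      qed (simp add: S_def)
      also have "\<dots> \<le> S * d" using gf by (intro mult_left_mono) (auto simp: L2_norm_minus_commute[of ?c f g] S_def)
      finally show ?thesis .
    qed
    have 2: "L2_norm ?c (\<lambda>x. ?A g x - g x) \<le> r / 3"
    proof -
      have "L2_norm ?c (\<lambda>x. ?A g x - g x) \<le> (r / 3) * L2_norm ?c (\<lambda>x. 1 :: real)"
      proof (rule L2_norm_bound[OF cube.L2_const])
        show "(\<lambda>x. ?A g x - g x) \<in> borel_measurable ?c"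
          by (rule L2_measurable[OF L2_diff[OF AL[OF gL] gL]])
        show "norm (?A g x - g x) \<le> (r / 3) * norm (1 :: real)" if "x \<in> space ?c" for x
          using \<delta>(2)[OF e M[OF m], of x] that by simp
      qed (use r in simp)
      then show ?thesis by (simp add: L2_norm_def measure_def emeasure_cube_measure)
    qed
    have 3: "L2_norm ?c (\<lambda>x. ?A f x - f x) \<le> L2_norm ?c (\<lambda>x. ?A f x - ?A g x) + L2_norm ?c (\<lambda>x. ?A g x - f x)"
      by (rule L2_norm_triangle3[OF AL[OF f] AL[OF gL] f])
    have 4: "L2_norm ?c (\<lambda>x. ?A g x - f x) \<le> L2_norm ?c (\<lambda>x. ?A g x - g x) + L2_norm ?c (\<lambda>x. g x - f x)"
      by (rule L2_norm_triangle3[OF AL[OF gL] gL f])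
    have "L2_norm ?c (\<lambda>x. ?A f x - f x) < d * (S + 1) + r / 3"
      using 1 2 3 4 gf by (simp add: algebra_simps)
    also have "\<dots> < r" using d(2) r by simp
    finally show "norm (L2_norm ?c (\<lambda>x. ?A f x - f x) - 0) < r" by simp
  qed
qed

section \<open>Density of continuously differentiable functions in the Sobolev space\<close>

lemma is_weak_deriv_weak_deriv:
  assumes "u \<in> H1" "b \<in> Basis"
  shows "is_weak_deriv b u (weak_deriv b u)"
  using assms unfolding H1_def weak_deriv_def by (metis (mono_tags, lifting) mem_Collect_eq someI_ex)

lemma H1_L2: "u \<in> H1 \<Longrightarrow> u \<in> L2 cube_measure"
  by (simp add: H1_def)

lemma weak_deriv_L2: "u \<in> H1 \<Longrightarrow> b \<in> Basis \<Longrightarrow> weak_deriv b u \<in> L2 cube_measure"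
  using is_weak_deriv_weak_deriv by (auto simp: is_weak_deriv_def)

lemma H1_C1_dense:
  fixes u :: "'a::euclidean_space \<Rightarrow> real"
  assumes u: "u \<in> H1"
  obtains v where "\<And>m::nat. v m \<in> C1"
    "(\<lambda>m. L2_norm cube_measure (\<lambda>x. v m x - u x)) \<longlonglongrightarrow> 0"
    "\<And>b. b \<in> Basis \<Longrightarrow> (\<lambda>m. L2_norm cube_measure (\<lambda>x. partial_deriv b (v m) x - weak_deriv b u x)) \<longlonglongrightarrow> 0"
proof -
  let ?c = "cube_measure :: 'a measure"
  define e where "e m = inverse (real (Suc (m + 7)))" for m :: nat
  have e: "0 < e m" "e m \<le> 1/8" for m by (auto simp: e_def field_simps)
  have e0: "e \<longlonglongrightarrow> 0"
    unfolding e_def by (rule LIMSEQ_ignore_initial_segment[OF LIMSEQ_inverse_real_of_nat])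
  note uL = H1_L2[OF u]
  show ?thesis
  proof (rule that[of "\<lambda>m. mollify (e m) u"])
    show "mollify (e m) u \<in> C1" for m by (rule mollify_C1(1)[OF uL e])
    show "(\<lambda>m. L2_norm ?c (\<lambda>x. mollify (e m) u x - u x)) \<longlonglongrightarrow> 0"
      by (rule mollify_tendsto[OF uL e e0])
    fix b :: 'a assume b: "b \<in> Basis"
    let ?g = "weak_deriv b u"
    note gL = weak_deriv_L2[OF u b]
    have AL: "mollify (e m) ?g \<in> L2 ?c" for m
      by (rule continuous_L2_cube[OF C1_continuous[OF mollify_C1(1)[OF gL e]]])
    \<comment> \<open>The derivative of the mollified u is \<open>1 - 4 * e m\<close> times the
      mollified weak derivative; the deviation of that factor from 1 is the second error
      term.\<close>
    have le: "L2_norm ?c (\<lambda>x. partial_deriv b (mollify (e m) u) x - ?g x) \<le>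
        L2_norm ?c (\<lambda>x. mollify (e m) ?g x - ?g x) + 4 * e m * L2_norm ?c ?g" for m
    proof -
      let ?s = "1 - 4 * e m"
      have s: "0 \<le> ?s" "?s \<le> 1" using e[of m] by auto
      have "L2_norm ?c (\<lambda>x. partial_deriv b (mollify (e m) u) x - ?g x) =
          L2_norm ?c (\<lambda>x. ?s *\<^sub>R (mollify (e m) ?g x - ?g x) + (- (4 * e m)) *\<^sub>R ?g x)"
        by (rule L2_norm_cong)
           (simp add: mollify_partial_deriv[OF uL is_weak_deriv_weak_deriv[OF u b] e] algebra_simps)
      also have "\<dots> \<le> L2_norm ?c (\<lambda>x. ?s *\<^sub>R (mollify (e m) ?g x - ?g x)) + L2_norm ?c (\<lambda>x. (- (4 * e m)) *\<^sub>R ?g x)"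
        by (intro L2_norm_triangle L2_scaleR L2_diff AL gL)
      also have "\<dots> = ?s * L2_norm ?c (\<lambda>x. mollify (e m) ?g x - ?g x) + 4 * e m * L2_norm ?c ?g"
        unfolding L2_norm_scaleR using s e[of m] by simp
      also have "\<dots> \<le> L2_norm ?c (\<lambda>x. mollify (e m) ?g x - ?g x) + 4 * e m * L2_norm ?c ?g"
        using mult_left_le_one_le[OF L2_norm_nonneg s] by simp
      finally show ?thesis .
    qed
    have "(\<lambda>m. L2_norm ?c (\<lambda>x. mollify (e m) ?g x - ?g x) + 4 * e m * L2_norm ?c ?g) \<longlonglongrightarrow> 0 + 4 * 0 * L2_norm ?c ?g"
      by (intro tendsto_intros mollify_tendsto[OF gL e e0] e0)
    then have "(\<lambda>m. L2_norm ?c (\<lambda>x. mollify (e m) ?g x - ?g x) + 4 * e m * L2_norm ?c ?g) \<longlonglongrightarrow> 0" by simp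
    then show "(\<lambda>m. L2_norm ?c (\<lambda>x. partial_deriv b (mollify (e m) u) x - ?g x)) \<longlonglongrightarrow> 0"
      by (rule real_tendsto_sandwich[OF _ _ tendsto_const, rotated 2]) (auto intro: always_eventually le)
  qed
qed

section \<open>Traces and Green's formula in the Sobolev space\<close>

definition grad_norm2_weak :: "('a::euclidean_space \<Rightarrow> real) \<Rightarrow> real" where
  "grad_norm2_weak u = (\<Sum>b\<in>Basis. (L2_norm cube_measure (weak_deriv b u))\<^sup>2)"

text \<open>The trace inequality applied to differences makes the boundary values of an
  approximating sequence Cauchy. Every property of \<open>bdry_trace\<close> depends on this, since
  \<open>SOME\<close> says nothing before existence is known.\<close>

lemma trace_exists:
  fixes u :: "'a::euclidean_space \<Rightarrow> real"
  assumes u: "u \<in> H1"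
  shows "\<exists>g. is_trace u g"
proof -
  let ?c = "cube_measure :: 'a measure" and ?s = "surface_measure :: 'a measure"
  obtain v where v: "\<And>m::nat. v m \<in> C1"
    and lim: "(\<lambda>m. L2_norm ?c (\<lambda>x. v m x - u x)) \<longlonglongrightarrow> 0"
    and dlim: "\<And>b. b \<in> Basis \<Longrightarrow> (\<lambda>m. L2_norm ?c (\<lambda>x. partial_deriv b (v m) x - weak_deriv b u x)) \<longlonglongrightarrow> 0"
    using H1_C1_dense[OF u] by blast
  define D where "D m = L2_norm ?c (\<lambda>x. v m x - u x) +
    (\<Sum>b\<in>Basis. L2_norm ?c (\<lambda>x. partial_deriv b (v m) x - weak_deriv b u x))" for m
  have "D \<longlonglongrightarrow> 0 + (\<Sum>b\<in>(Basis::'a set). 0)"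
    unfolding D_def by (intro tendsto_add tendsto_sum lim dlim)
  then have D: "D \<longlonglongrightarrow> 0" by simp
  have D0: "0 \<le> D m" for m unfolding D_def by (intro add_nonneg_nonneg sum_nonneg L2_norm_nonneg)
  have vL: "v m \<in> L2 ?c" for m by (rule continuous_L2_cube[OF C1_continuous[OF v]])
  have dL: "partial_deriv b (v m) \<in> L2 ?c" if "b \<in> Basis" for b m
    by (rule continuous_L2_cube[OF C1_continuous_partial[OF v that]])
  have sL: "v m \<in> L2 ?s" for m by (rule continuous_L2_surface[OF C1_continuous[OF v]])
  \<comment> \<open>The constant of the trace inequality times the number of squares to bound: one
    for the function and one for each partial derivative.\<close>
  let ?K = "3 * DIM('a) * (1 + DIM('a)) :: real"
  have diff: "L2_norm ?s (\<lambda>x. v m x - v n x) \<le> sqrt ?K * (D m + D n)" for m n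
  proof (rule power2_le_imp_le)
    have 1: "L2_norm ?c (\<lambda>x. v m x - v n x) \<le> D m + D n"
    proof -
      have "L2_norm ?c (\<lambda>x. v k x - u x) \<le> D k" for k
        unfolding D_def by (simp add: sum_nonneg)
      from this[of m] this[of n] show ?thesis
        using L2_norm_triangle3[OF vL H1_L2[OF u] vL, of m n] L2_norm_minus_commute[of ?c u "v n"] by linarith
    qed
    have 2: "L2_norm ?c (\<lambda>x. partial_deriv b (v m) x - partial_deriv b (v n) x) \<le> D m + D n" if b: "b \<in> Basis" for b
    proof -
      have "L2_norm ?c (\<lambda>x. partial_deriv b (v k) x - weak_deriv b u x) \<le> D k" for k
        unfolding D_def
        using member_le_sum[OF b, of "\<lambda>b. L2_norm ?c (\<lambda>x. partial_deriv b (v k) x - weak_deriv b u x)"]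
        by (simp add: add_increasing)
      from this[of m] this[of n] show ?thesis
        using L2_norm_triangle3[OF dL[OF b] weak_deriv_L2[OF u b] dL[OF b], of m n]
          L2_norm_minus_commute[of ?c "weak_deriv b u" "partial_deriv b (v n)"] by linarith
    qed
    have eq: "partial_deriv b (\<lambda>x. v m x - v n x) = (\<lambda>x. partial_deriv b (v m) x - partial_deriv b (v n) x)" for b
      by (rule ext) (rule C1_diff(2)[OF v v])
    have g: "grad_norm2 (\<lambda>x. v m x - v n x) \<le> (\<Sum>b\<in>(Basis :: 'a set). (D m + D n)\<^sup>2)"
      unfolding grad_norm2_def eq by (intro sum_mono power_mono 2 L2_norm_nonneg)
    have "(L2_norm ?s (\<lambda>x. v m x - v n x))\<^sup>2 \<le>
        3 * DIM('a) * ((L2_norm ?c (\<lambda>x. v m x - v n x))\<^sup>2 + grad_norm2 (\<lambda>x. v m x - v n x))"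
      by (rule trace_inequality_C1[OF C1_diff(1)[OF v v]])
    also have "\<dots> \<le> 3 * DIM('a) * ((D m + D n)\<^sup>2 + (\<Sum>b\<in>(Basis :: 'a set). (D m + D n)\<^sup>2))"
      by (intro mult_left_mono add_mono g power_mono 1) auto
    also have "\<dots> = ?K * (D m + D n)\<^sup>2" by (simp add: algebra_simps)
    also have "\<dots> = (sqrt ?K * (D m + D n))\<^sup>2" by (simp add: power_mult_distrib)
    finally show "(L2_norm ?s (\<lambda>x. v m x - v n x))\<^sup>2 \<le> (sqrt ?K * (D m + D n))\<^sup>2" .
  qed (simp add: D0)
  have "\<exists>N. \<forall>m\<ge>N. \<forall>n\<ge>N. L2_norm ?s (\<lambda>x. v m x - v n x) < e" if e: "0 < e" for e
  proof -
    define d where "d = e / (2 * (sqrt ?K + 1))"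
    have K: "0 < sqrt ?K + 1" by (simp add: add_nonneg_pos)
    have d: "0 < d" using e K by (simp add: d_def)
    obtain N where N: "\<And>m. m \<ge> N \<Longrightarrow> norm (D m - 0) < d" using LIMSEQ_D[OF D d] by blast
    show ?thesis
    proof (intro exI allI impI)
      fix m n assume "N \<le> m" "N \<le> n"
      from N[OF this(1)] N[OF this(2)] have lt: "D m + D n < 2 * d" by simp
      have "L2_norm ?s (\<lambda>x. v m x - v n x) \<le> sqrt ?K * (D m + D n)" by (rule diff)
      also have "\<dots> \<le> (sqrt ?K + 1) * (D m + D n)" using D0 by (intro mult_right_mono) auto
      also have "\<dots> < (sqrt ?K + 1) * (2 * d)" using lt K by (rule mult_strict_left_mono)
      also have "\<dots> = e" using K unfolding d_def by (simp add: field_simps)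
      finally show "L2_norm ?s (\<lambda>x. v m x - v n x) < e" .
    qed
  qed
  from surface.L2_complete[OF sL this] obtain g
    where "g \<in> L2 ?s" "(\<lambda>m. L2_norm ?s (\<lambda>x. v m x - g x)) \<longlonglongrightarrow> 0" by blast
  with v lim dlim show ?thesis unfolding is_trace_def by blast
qed

text \<open>The sequence is taken from \<open>is_trace\<close> for the chosen representative, so
  that interior and boundary convergence hold for one sequence and the boundary limit is
  \<open>bdry_trace u\<close> itself.\<close>

lemma H1_approximation:
  fixes u :: "'a::euclidean_space \<Rightarrow> real"
  assumes u: "u \<in> H1"
  obtains v where "\<And>m::nat. v m \<in> C1"
    "(\<lambda>m. L2_norm cube_measure (\<lambda>x. v m x - u x)) \<longlonglongrightarrow> 0"
    "\<And>b. b \<in> Basis \<Longrightarrow> (\<lambda>m. L2_norm cube_measure (\<lambda>x. partial_deriv b (v m) x - weak_deriv b u x)) \<longlonglongrightarrow> 0"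
    "(\<lambda>m. L2_norm surface_measure (\<lambda>x. v m x - bdry_trace u x)) \<longlonglongrightarrow> 0"
proof -
  have "is_trace u (bdry_trace u)"
    unfolding bdry_trace_def by (rule someI_ex[OF trace_exists[OF u]])
  then show ?thesis using that unfolding is_trace_def by blast
qed

lemma bdry_trace_L2: "u \<in> H1 \<Longrightarrow> bdry_trace u \<in> L2 surface_measure"
  using someI_ex[OF trace_exists] unfolding bdry_trace_def is_trace_def by blast

text \<open>All the quantities in the trace, Friedrichs and Poincare inequalities converge along one
  sequence, so each inequality passes to the limit termwise.\<close>

lemma H1_limits:
  fixes u :: "'a::euclidean_space \<Rightarrow> real"
  assumes u: "u \<in> H1"
  obtains v :: "nat \<Rightarrow> 'a \<Rightarrow> real" where "\<And>m. v m \<in> C1"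
    "(\<lambda>m. (L2_norm cube_measure (v m))\<^sup>2) \<longlonglongrightarrow> (L2_norm cube_measure u)\<^sup>2"
    "(\<lambda>m. grad_norm2 (v m)) \<longlonglongrightarrow> grad_norm2_weak u"
    "(\<lambda>m. (L2_norm surface_measure (v m))\<^sup>2) \<longlonglongrightarrow> (L2_norm surface_measure (bdry_trace u))\<^sup>2"
    "(\<lambda>m. \<integral>x. v m x \<partial>cube_measure) \<longlonglongrightarrow> (\<integral>x. u x \<partial>cube_measure)"
proof -
  let ?c = "cube_measure :: 'a measure" and ?s = "surface_measure :: 'a measure"
  obtain v where v: "\<And>m::nat. v m \<in> C1"
    and l: "(\<lambda>m. L2_norm ?c (\<lambda>x. v m x - u x)) \<longlonglongrightarrow> 0"
    and d: "\<And>b. b \<in> Basis \<Longrightarrow> (\<lambda>m. L2_norm ?c (\<lambda>x. partial_deriv b (v m) x - weak_deriv b u x)) \<longlonglongrightarrow> 0"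
    and s: "(\<lambda>m. L2_norm ?s (\<lambda>x. v m x - bdry_trace u x)) \<longlonglongrightarrow> 0"
    using H1_approximation[OF u] by blast
  have vL: "v m \<in> L2 ?c" for m by (rule continuous_L2_cube[OF C1_continuous[OF v]])
  have dL: "partial_deriv b (v m) \<in> L2 ?c" if "b \<in> Basis" for b m
    by (rule continuous_L2_cube[OF C1_continuous_partial[OF v that]])
  have sL: "v m \<in> L2 ?s" for m by (rule continuous_L2_surface[OF C1_continuous[OF v]])
  show ?thesis
  proof (rule that[OF v])
    show "(\<lambda>m. (L2_norm ?c (v m))\<^sup>2) \<longlonglongrightarrow> (L2_norm ?c u)\<^sup>2"
      by (rule tendsto_power[OF tendsto_L2_norm[OF vL H1_L2[OF u] l]])
    show "(\<lambda>m. grad_norm2 (v m)) \<longlonglongrightarrow> grad_norm2_weak u"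
      unfolding grad_norm2_def grad_norm2_weak_def
      by (rule tendsto_sum, rule tendsto_power, rule tendsto_L2_norm) (auto intro: dL weak_deriv_L2 u d)
    show "(\<lambda>m. (L2_norm ?s (v m))\<^sup>2) \<longlonglongrightarrow> (L2_norm ?s (bdry_trace u))\<^sup>2"
      by (rule tendsto_power[OF tendsto_L2_norm[OF sL bdry_trace_L2[OF u] s]])
    have "(\<lambda>m. \<integral>x. v m x * 1 \<partial>?c) \<longlonglongrightarrow> (\<integral>x. u x * 1 \<partial>?c)"
      by (rule tendsto_L2_mult[OF vL H1_L2[OF u] l cube.L2_const cube.L2_const]) (simp add: L2_norm_def)
    then show "(\<lambda>m. \<integral>x. v m x \<partial>?c) \<longlonglongrightarrow> (\<integral>x. u x \<partial>?c)" by simp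
  qed
qed

lemma trace_inequality:
  fixes u :: "'a::euclidean_space \<Rightarrow> real"
  assumes "u \<in> H1"
  shows "(L2_norm surface_measure (bdry_trace u))\<^sup>2 \<le>
    3 * DIM('a) * ((L2_norm cube_measure u)\<^sup>2 + grad_norm2_weak u)"
proof -
  obtain v :: "nat \<Rightarrow> 'a \<Rightarrow> real" where v: "\<And>m. v m \<in> C1"
    "(\<lambda>m. (L2_norm cube_measure (v m))\<^sup>2) \<longlonglongrightarrow> (L2_norm cube_measure u)\<^sup>2"
    "(\<lambda>m. grad_norm2 (v m)) \<longlonglongrightarrow> grad_norm2_weak u"
    "(\<lambda>m. (L2_norm surface_measure (v m))\<^sup>2) \<longlonglongrightarrow> (L2_norm surface_measure (bdry_trace u))\<^sup>2"
    by (rule H1_limits[OF assms]) (rule that)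
  show ?thesis
    by (rule LIMSEQ_le[OF v(4) tendsto_mult[OF tendsto_const tendsto_add[OF v(2,3)]]])
       (intro exI allI impI, rule trace_inequality_C1[OF v(1)])
qed

lemma friedrichs_inequality:
  fixes u :: "'a::euclidean_space \<Rightarrow> real"
  assumes "u \<in> H1"
  shows "(L2_norm cube_measure u)\<^sup>2 \<le> 4 * grad_norm2_weak u + 2 * (L2_norm surface_measure (bdry_trace u))\<^sup>2"
proof -
  obtain v :: "nat \<Rightarrow> 'a \<Rightarrow> real" where v: "\<And>m. v m \<in> C1"
    "(\<lambda>m. (L2_norm cube_measure (v m))\<^sup>2) \<longlonglongrightarrow> (L2_norm cube_measure u)\<^sup>2"
    "(\<lambda>m. grad_norm2 (v m)) \<longlonglongrightarrow> grad_norm2_weak u"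
    "(\<lambda>m. (L2_norm surface_measure (v m))\<^sup>2) \<longlonglongrightarrow> (L2_norm surface_measure (bdry_trace u))\<^sup>2"
    by (rule H1_limits[OF assms]) (rule that)
  show ?thesis
    by (rule LIMSEQ_le[OF v(2) tendsto_add[OF tendsto_mult[OF tendsto_const v(3)] tendsto_mult[OF tendsto_const v(4)]]])
       (intro exI allI impI, rule friedrichs_inequality_C1[OF v(1)])
qed

lemma poincare_inequality:
  fixes u :: "'a::euclidean_space \<Rightarrow> real"
  assumes "u \<in> H1"
  shows "(L2_norm cube_measure u)\<^sup>2 \<le>
    2 * DIM('a) * 2 ^ DIM('a) * grad_norm2_weak u + (\<integral>x. u x \<partial>cube_measure)\<^sup>2"
proof -
  obtain v :: "nat \<Rightarrow> 'a \<Rightarrow> real" where v: "\<And>m. v m \<in> C1"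
    "(\<lambda>m. (L2_norm cube_measure (v m))\<^sup>2) \<longlonglongrightarrow> (L2_norm cube_measure u)\<^sup>2"
    "(\<lambda>m. grad_norm2 (v m)) \<longlonglongrightarrow> grad_norm2_weak u"
    "(\<lambda>m. \<integral>x. v m x \<partial>cube_measure) \<longlonglongrightarrow> (\<integral>x. u x \<partial>cube_measure)"
    by (rule H1_limits[OF assms]) (rule that)
  show ?thesis
    by (rule LIMSEQ_le[OF v(2) tendsto_add[OF tendsto_mult[OF tendsto_const v(3)] tendsto_power[OF v(4), of 2]]])
       (intro exI allI impI, rule poincare_inequality_C1[OF v(1)])
qed

lemma outer_normal_component_bound:
  assumes "b \<in> Basis"
  shows "\<bar>outer_normal x \<bullet> b\<bar> \<le> 1"
  using assms by (simp add: outer_normal_inner)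

lemma normal_mult_L2:
  fixes g :: "'a::euclidean_space \<Rightarrow> real"
  assumes g: "g \<in> L2 surface_measure" and b: "b \<in> Basis"
  shows "(\<lambda>x. (outer_normal x \<bullet> b) * g x) \<in> L2 surface_measure"
    and "L2_norm surface_measure (\<lambda>x. (outer_normal x \<bullet> b) * g x) \<le> L2_norm surface_measure g"
proof -
  have [measurable]: "g \<in> borel_measurable borel" using L2_measurable[OF g] by simp
  have m: "(\<lambda>x. (outer_normal x \<bullet> b) * g x) \<in> borel_measurable surface_measure" by simp
  have le: "norm ((outer_normal x \<bullet> b) * g x) \<le> 1 * norm (g x)" for x
    using mult_right_mono[OF outer_normal_component_bound[OF b] abs_ge_zero[of "g x"]] by (simp add: abs_mult)
  show "(\<lambda>x. (outer_normal x \<bullet> b) * g x) \<in> L2 surface_measure" by (rule L2_bound[OF g m le])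
  show "L2_norm surface_measure (\<lambda>x. (outer_normal x \<bullet> b) * g x) \<le> L2_norm surface_measure g"
    using L2_norm_bound[OF g m le] by simp
qed

lemma tendsto_normal_mult:
  fixes u :: "'a::euclidean_space \<Rightarrow> real"
  assumes v: "\<And>m. v m \<in> L2 surface_measure" and g: "g \<in> L2 surface_measure" and b: "b \<in> Basis"
    and lim: "(\<lambda>m. L2_norm surface_measure (\<lambda>x :: 'a. v m x - g x)) \<longlonglongrightarrow> 0"
  shows "(\<lambda>m. L2_norm surface_measure (\<lambda>x. (outer_normal x \<bullet> b) * v m x - (outer_normal x \<bullet> b) * g x)) \<longlonglongrightarrow> 0"
  unfolding right_diff_distrib[symmetric]
  by (rule real_tendsto_sandwich[OF _ _ tendsto_const lim])
     (intro always_eventually allI L2_norm_nonneg normal_mult_L2(2) L2_diff v g b)+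

text \<open>Both factors are approximated separately, and every integrand is a product of two
  L2-convergent factors. On the boundary the bounded normal component is attached to the first
  factor.\<close>

lemma green_H1:
  fixes u w :: "'a::euclidean_space \<Rightarrow> real"
  assumes u: "u \<in> H1" and w: "w \<in> H1" and b: "b \<in> Basis"
  shows "(\<integral>x. u x * weak_deriv b w x \<partial>cube_measure) + (\<integral>x. weak_deriv b u x * w x \<partial>cube_measure)
    = (\<integral>x. (outer_normal x \<bullet> b) * bdry_trace u x * bdry_trace w x \<partial>surface_measure)"
proof -
  obtain v where v: "\<And>m::nat. v m \<in> C1"
    and vl: "(\<lambda>m. L2_norm cube_measure (\<lambda>x. v m x - u x)) \<longlonglongrightarrow> 0"
    and vd: "\<And>b. b \<in> Basis \<Longrightarrow> (\<lambda>m. L2_norm cube_measure (\<lambda>x. partial_deriv b (v m) x - weak_deriv b u x)) \<longlonglongrightarrow> 0"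
    and vs: "(\<lambda>m. L2_norm surface_measure (\<lambda>x. v m x - bdry_trace u x)) \<longlonglongrightarrow> 0"
    using H1_approximation[OF u] by blast
  obtain z where z: "\<And>m::nat. z m \<in> C1"
    and zl: "(\<lambda>m. L2_norm cube_measure (\<lambda>x. z m x - w x)) \<longlonglongrightarrow> 0"
    and zd: "\<And>b. b \<in> Basis \<Longrightarrow> (\<lambda>m. L2_norm cube_measure (\<lambda>x. partial_deriv b (z m) x - weak_deriv b w x)) \<longlonglongrightarrow> 0"
    and zs: "(\<lambda>m. L2_norm surface_measure (\<lambda>x. z m x - bdry_trace w x)) \<longlonglongrightarrow> 0"
    using H1_approximation[OF w] by blast
  have c: "f \<in> L2 cube_measure" "f \<in> L2 surface_measure" if "f \<in> C1" for f :: "'a \<Rightarrow> real"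
    using continuous_L2_cube continuous_L2_surface C1_continuous[OF that] by blast+
  have d: "partial_deriv b f \<in> L2 cube_measure" if "f \<in> C1" for f :: "'a \<Rightarrow> real"
    by (rule continuous_L2_cube[OF C1_continuous_partial[OF that b]])
  have "(\<lambda>m. (\<integral>x. v m x * partial_deriv b (z m) x \<partial>cube_measure) + (\<integral>x. partial_deriv b (v m) x * z m x \<partial>cube_measure))
    \<longlonglongrightarrow> (\<integral>x. u x * weak_deriv b w x \<partial>cube_measure) + (\<integral>x. weak_deriv b u x * w x \<partial>cube_measure)"
    by (rule tendsto_add[OF
        tendsto_L2_mult[OF c(1)[OF v] H1_L2[OF u] vl d[OF z] weak_deriv_L2[OF w b] zd[OF b]]
        tendsto_L2_mult[OF d[OF v] weak_deriv_L2[OF u b] vd[OF b] c(1)[OF z] H1_L2[OF w] zl]])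
  moreover have "(\<lambda>m. \<integral>x. ((outer_normal x \<bullet> b) * v m x) * z m x \<partial>surface_measure)
    \<longlonglongrightarrow> (\<integral>x. ((outer_normal x \<bullet> b) * bdry_trace u x) * bdry_trace w x \<partial>surface_measure)"
    by (rule tendsto_L2_mult[OF normal_mult_L2(1)[OF c(2)[OF v] b] normal_mult_L2(1)[OF bdry_trace_L2[OF u] b]
        tendsto_normal_mult[OF c(2)[OF v] bdry_trace_L2[OF u] b vs] c(2)[OF z] bdry_trace_L2[OF w] zs])
  ultimately show ?thesis
    unfolding green_C1[OF v z b] by (rule LIMSEQ_unique)
qed

text \<open>The constant 1 enters as second factor at the level of C1 functions, where its
  derivative is literally 0. In \<open>green_H1\<close> its weak derivative and trace would be
  representatives selected by \<open>SOME\<close>.\<close>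

lemma integral_weak_deriv:
  fixes u :: "'a::euclidean_space \<Rightarrow> real"
  assumes u: "u \<in> H1" and b: "b \<in> Basis"
  shows "(\<integral>x. weak_deriv b u x \<partial>cube_measure) = (\<integral>x. (outer_normal x \<bullet> b) * bdry_trace u x \<partial>surface_measure)"
proof -
  obtain v where v: "\<And>m::nat. v m \<in> C1"
    and vd: "\<And>b. b \<in> Basis \<Longrightarrow> (\<lambda>m. L2_norm cube_measure (\<lambda>x. partial_deriv b (v m) x - weak_deriv b u x)) \<longlonglongrightarrow> 0"
    and vs: "(\<lambda>m. L2_norm surface_measure (\<lambda>x. v m x - bdry_trace u x)) \<longlonglongrightarrow> 0"
    by (rule H1_approximation[OF u]) (rule that)
  have c: "v m \<in> L2 surface_measure" for m
    using continuous_L2_surface C1_continuous[OF v] by blast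
  have d: "partial_deriv b (v m) \<in> L2 cube_measure" for m
    by (rule continuous_L2_cube[OF C1_continuous_partial[OF v b]])
  have one: "(\<lambda>x. 1) \<in> (C1 :: ('a \<Rightarrow> real) set)" "partial_deriv b (\<lambda>x. 1) x = 0" for x :: 'a
    using C1_affine(1)[of 1 "0 :: 'a"] C1_affine(2)[of b 1 "0 :: 'a" x] by simp_all
  have z: "(\<lambda>m. L2_norm M (\<lambda>x. 1 - 1 :: real)) \<longlonglongrightarrow> 0" for M :: "'a measure" by (simp add: L2_norm_def)
  have 1: "(\<lambda>m. \<integral>x. partial_deriv b (v m) x * 1 \<partial>cube_measure) \<longlonglongrightarrow> (\<integral>x. weak_deriv b u x * 1 \<partial>cube_measure)"
    by (rule tendsto_L2_mult[OF d weak_deriv_L2[OF u b] vd[OF b] cube.L2_const cube.L2_const z])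
  have 2: "(\<lambda>m. \<integral>x. ((outer_normal x \<bullet> b) * v m x) * 1 \<partial>surface_measure)
    \<longlonglongrightarrow> (\<integral>x. ((outer_normal x \<bullet> b) * bdry_trace u x) * 1 \<partial>surface_measure)"
    by (rule tendsto_L2_mult[OF normal_mult_L2(1)[OF c b] normal_mult_L2(1)[OF bdry_trace_L2[OF u] b]
          tendsto_normal_mult[OF c bdry_trace_L2[OF u] b vs] surface.L2_const surface.L2_const z])
  have "(\<integral>x. ((outer_normal x \<bullet> b) * v m x) * 1 \<partial>surface_measure) = (\<integral>x. partial_deriv b (v m) x * 1 \<partial>cube_measure)" for m
    using green_C1[OF v one(1) b, of m] by (simp add: one(2))
  then have "(\<lambda>m. \<integral>x. partial_deriv b (v m) x * 1 \<partial>cube_measure)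
    \<longlonglongrightarrow> (\<integral>x. ((outer_normal x \<bullet> b) * bdry_trace u x) * 1 \<partial>surface_measure)"
    using 2 by simp
  from LIMSEQ_unique[OF 1 this] show ?thesis by simp
qed

section \<open>Gradients, vector fields and normal traces\<close>

lemma weak_grad_inner: "b \<in> Basis \<Longrightarrow> weak_grad u x \<bullet> b = weak_deriv b u x"
  by (simp add: weak_grad_def)

lemma sum_Basis_L2:
  fixes f :: "'a::euclidean_space \<Rightarrow> 'b \<Rightarrow> real"
  assumes "\<And>b. b \<in> Basis \<Longrightarrow> f b \<in> L2 M"
  shows "(\<lambda>x. \<Sum>b\<in>Basis. f b x *\<^sub>R b) \<in> L2 M"
proof (rule L2_sum)
  fix b :: 'a assume b: "b \<in> Basis"
  have "(\<lambda>x. f b x *\<^sub>R b) \<in> borel_measurable M" using L2_measurable[OF assms[OF b]] by measurable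
  then show "(\<lambda>x. f b x *\<^sub>R b) \<in> L2 M" by (rule L2_bound[OF assms[OF b], where K = 1]) (simp add: b)
qed

lemma weak_grad_L2: "u \<in> H1 \<Longrightarrow> weak_grad u \<in> L2 cube_measure"
  unfolding weak_grad_def by (intro sum_Basis_L2 weak_deriv_L2)

lemma L2_norm_components:
  fixes f :: "'b \<Rightarrow> 'a::euclidean_space"
  assumes "\<And>b. b \<in> Basis \<Longrightarrow> (\<lambda>x. f x \<bullet> b) \<in> L2 M"
  shows "(L2_norm M f)\<^sup>2 = (\<Sum>b\<in>Basis. (L2_norm M (\<lambda>x. f x \<bullet> b))\<^sup>2)"
proof -
  have "(L2_norm M f)\<^sup>2 = (\<integral>x. (\<Sum>b\<in>Basis. (norm (f x \<bullet> b))\<^sup>2) \<partial>M)"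
    unfolding L2_norm_power2 power2_norm_eq_inner
    by (subst euclidean_inner) (simp add: power2_eq_square)
  also have "\<dots> = (\<Sum>b\<in>Basis. \<integral>x. (norm (f x \<bullet> b))\<^sup>2 \<partial>M)"
    by (intro Bochner_Integration.integral_sum L2_integrable_power2 assms)
  finally show ?thesis by (simp add: L2_norm_power2)
qed

lemma L2_norm_weak_grad: "u \<in> H1 \<Longrightarrow> (L2_norm cube_measure (weak_grad u))\<^sup>2 = grad_norm2_weak u"
  by (subst L2_norm_components) (auto simp: weak_grad_inner grad_norm2_weak_def weak_deriv_L2)

lemma H1_vec_component: "v \<in> H1_vec \<Longrightarrow> b \<in> Basis \<Longrightarrow> (\<lambda>x. v x \<bullet> b) \<in> H1"
  by (simp add: H1_vec_def)

lemma H1_vec_L2: "v \<in> H1_vec \<Longrightarrow> v \<in> L2 cube_measure"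
proof -
  assume v: "v \<in> H1_vec"
  have "(\<lambda>x. \<Sum>b\<in>Basis. (v x \<bullet> b) *\<^sub>R b) \<in> L2 cube_measure"
    by (rule sum_Basis_L2) (rule H1_L2[OF H1_vec_component[OF v]])
  then show ?thesis by (simp add: euclidean_representation)
qed

lemma weak_div_L2: "v \<in> H1_vec \<Longrightarrow> weak_div v \<in> L2 cube_measure"
  unfolding weak_div_def by (intro L2_sum weak_deriv_L2 H1_vec_component)

lemma bdry_trace_vec_L2: "v \<in> H1_vec \<Longrightarrow> bdry_trace_vec v \<in> L2 surface_measure"
  unfolding bdry_trace_vec_def by (intro sum_Basis_L2 bdry_trace_L2 H1_vec_component)

lemma normal_trace_expand:
  "outer_normal x \<bullet> bdry_trace_vec v x = (\<Sum>b\<in>Basis. (outer_normal x \<bullet> b) * bdry_trace (\<lambda>y. v y \<bullet> b) x)"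
  by (simp add: bdry_trace_vec_def inner_sum_right mult.commute)

lemma normal_trace_L2: "v \<in> H1_vec \<Longrightarrow> (\<lambda>x. outer_normal x \<bullet> bdry_trace_vec v x) \<in> L2 surface_measure"
  unfolding normal_trace_expand by (intro L2_sum normal_mult_L2 bdry_trace_L2 H1_vec_component)

lemma normal_trace_bound:
  fixes v :: "'a::euclidean_space \<Rightarrow> 'a"
  assumes v: "v \<in> H1_vec"
  shows "L2_norm surface_measure (\<lambda>x. outer_normal x \<bullet> bdry_trace_vec v x) \<le>
    sqrt (DIM('a)) * L2_norm surface_measure (bdry_trace_vec v)"
proof (rule L2_norm_bound[OF bdry_trace_vec_L2[OF v] L2_measurable[OF normal_trace_L2[OF v]]])
  fix x :: 'a
  have "norm (outer_normal x \<bullet> bdry_trace_vec v x) \<le> norm (outer_normal x) * norm (bdry_trace_vec v x)"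
    unfolding real_norm_def by (rule Cauchy_Schwarz_ineq2)
  \<comment> \<open>Where several faces meet, \<open>outer_normal\<close> is a sum of signed basis
    vectors of length up to the square root of d; the bound holds at those points too.\<close>
  also have "\<dots> \<le> sqrt (DIM('a)) * norm (bdry_trace_vec v x)"
    using norm_outer_normal[of x] by (intro mult_right_mono real_le_rsqrt) auto
  finally show "norm (outer_normal x \<bullet> bdry_trace_vec v x) \<le> sqrt (DIM('a)) * norm (bdry_trace_vec v x)" .
qed simp

lemma green_vec:
  fixes v :: "'a::euclidean_space \<Rightarrow> 'a" and u :: "'a \<Rightarrow> real"
  assumes v: "v \<in> H1_vec" and u: "u \<in> H1"
  shows "(\<integral>x. v x \<bullet> weak_grad u x \<partial>cube_measure) + (\<integral>x. weak_div v x * u x \<partial>cube_measure)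
    = (\<integral>x. (outer_normal x \<bullet> bdry_trace_vec v x) * bdry_trace u x \<partial>surface_measure)"
proof -
  let ?v = "\<lambda>b x. v x \<bullet> b"
  note vb = H1_vec_component[OF v]
  have "(\<integral>x. v x \<bullet> weak_grad u x \<partial>cube_measure) = (\<integral>x. (\<Sum>b\<in>Basis. ?v b x * weak_deriv b u x) \<partial>cube_measure)"
    by (subst euclidean_inner) (simp add: weak_grad_inner)
  also have "\<dots> = (\<Sum>b\<in>Basis. \<integral>x. ?v b x * weak_deriv b u x \<partial>cube_measure)"
    by (intro Bochner_Integration.integral_sum L2_mult_integrable weak_deriv_L2 H1_L2 vb u)
  finally have 1: "(\<integral>x. v x \<bullet> weak_grad u x \<partial>cube_measure) = (\<Sum>b\<in>Basis. \<integral>x. ?v b x * weak_deriv b u x \<partial>cube_measure)" .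
  have "(\<integral>x. weak_div v x * u x \<partial>cube_measure) = (\<integral>x. (\<Sum>b\<in>Basis. weak_deriv b (?v b) x * u x) \<partial>cube_measure)"
    by (simp add: weak_div_def sum_distrib_right)
  also have "\<dots> = (\<Sum>b\<in>Basis. \<integral>x. weak_deriv b (?v b) x * u x \<partial>cube_measure)"
    by (intro Bochner_Integration.integral_sum L2_mult_integrable weak_deriv_L2 H1_L2 vb u)
  finally have 2: "(\<integral>x. weak_div v x * u x \<partial>cube_measure) = (\<Sum>b\<in>Basis. \<integral>x. weak_deriv b (?v b) x * u x \<partial>cube_measure)" .
  have "(\<integral>x. (outer_normal x \<bullet> bdry_trace_vec v x) * bdry_trace u x \<partial>surface_measure)
    = (\<integral>x. (\<Sum>b\<in>Basis. ((outer_normal x \<bullet> b) * bdry_trace (?v b) x) * bdry_trace u x) \<partial>surface_measure)"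
    unfolding normal_trace_expand sum_distrib_right ..
  also have "\<dots> = (\<Sum>b\<in>Basis. \<integral>x. ((outer_normal x \<bullet> b) * bdry_trace (?v b) x) * bdry_trace u x \<partial>surface_measure)"
    by (intro Bochner_Integration.integral_sum L2_mult_integrable normal_mult_L2 bdry_trace_L2 vb u)
  also have "\<dots> = (\<Sum>b\<in>Basis. (\<integral>x. ?v b x * weak_deriv b u x \<partial>cube_measure) + (\<integral>x. weak_deriv b (?v b) x * u x \<partial>cube_measure))"
    by (intro sum.cong refl green_H1[symmetric] vb u)
  finally show ?thesis unfolding 1 2 by (simp add: sum.distrib)
qed

lemma integral_weak_div:
  fixes v :: "'a::euclidean_space \<Rightarrow> 'a"
  assumes v: "v \<in> H1_vec"
  shows "(\<integral>x. weak_div v x \<partial>cube_measure) = (\<integral>x. outer_normal x \<bullet> bdry_trace_vec v x \<partial>surface_measure)"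
proof -
  note vb = H1_vec_component[OF v]
  have int: "integrable surface_measure g" if "g \<in> L2 surface_measure" for g :: "'a \<Rightarrow> real"
    using L2_mult_integrable[OF that surface.L2_const[of 1]] by simp
  have "(\<integral>x. weak_div v x \<partial>cube_measure) = (\<Sum>b\<in>Basis. \<integral>x. weak_deriv b (\<lambda>y. v y \<bullet> b) x \<partial>cube_measure)"
    unfolding weak_div_def by (intro Bochner_Integration.integral_sum L2_cube_integrable weak_deriv_L2 vb)
  also have "\<dots> = (\<Sum>b\<in>Basis. \<integral>x. (outer_normal x \<bullet> b) * bdry_trace (\<lambda>y. v y \<bullet> b) x \<partial>surface_measure)"
    by (intro sum.cong refl integral_weak_deriv vb)
  also have "\<dots> = (\<integral>x. outer_normal x \<bullet> bdry_trace_vec v x \<partial>surface_measure)"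
    unfolding normal_trace_expand
    by (intro Bochner_Integration.integral_sum[symmetric] int normal_mult_L2 bdry_trace_L2 vb)
  finally show ?thesis .
qed

section \<open>Coercivity\<close>

text \<open>Continuing the tuple by 0 beyond its last entry gives the final divergence equation the
  same shape as the others and provides the starting value of the downward chain.\<close>

definition next_phi :: "nat \<Rightarrow> 'a::euclidean_space tuple_field \<Rightarrow> nat \<Rightarrow> 'a \<Rightarrow> real" where
  "next_phi n u k x = (if Suc k < n then phi u (Suc k) x else 0)"

definition grad_residual :: "'a::euclidean_space tuple_field \<Rightarrow> nat \<Rightarrow> 'a \<Rightarrow> 'a" where
  "grad_residual u k x = weak_grad (phi u k) x - psi u k x"

definition div_residual :: "nat \<Rightarrow> 'a::euclidean_space tuple_field \<Rightarrow> nat \<Rightarrow> 'a \<Rightarrow> real" where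
  "div_residual n u k x = weak_div (psi u k) x - next_phi n u k x"

definition normal_trace :: "'a::euclidean_space tuple_field \<Rightarrow> nat \<Rightarrow> 'a \<Rightarrow> real" where
  "normal_trace u k x = outer_normal x \<bullet> bdry_trace_vec (psi u k) x"

lemma H1_tuplesD:
  assumes "u \<in> H1_tuples n" "k < n"
  shows "phi u k \<in> H1" "psi u k \<in> H1_vec"
  using assms by (auto simp: H1_tuples_def)

lemma next_phi_L2: "u \<in> H1_tuples n \<Longrightarrow> next_phi n u k \<in> L2 cube_measure"
  unfolding next_phi_def using H1_L2[OF H1_tuplesD(1), of u n "Suc k"] L2_zero
  by (cases "Suc k < n") auto

lemma residuals_L2:
  assumes "u \<in> H1_tuples n" "k < n"
  shows "grad_residual u k \<in> L2 cube_measure" "div_residual n u k \<in> L2 cube_measure"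
    "normal_trace u k \<in> L2 surface_measure"
proof -
  note u = H1_tuplesD[OF assms]
  show "grad_residual u k \<in> L2 cube_measure"
    unfolding grad_residual_def by (rule L2_diff[OF weak_grad_L2[OF u(1)] H1_vec_L2[OF u(2)]])
  show "div_residual n u k \<in> L2 cube_measure"
    unfolding div_residual_def by (rule L2_diff[OF weak_div_L2[OF u(2)] next_phi_L2[OF assms(1)]])
  show "normal_trace u k \<in> L2 surface_measure"
    unfolding normal_trace_def by (rule normal_trace_L2[OF u(2)])
qed

lemma bilin_self:
  fixes u :: "'a::euclidean_space tuple_field"
  assumes u: "u \<in> H1_tuples n"
  shows "bilin \<alpha> n lam mu u u =
    (\<Sum>k<n. (L2_norm cube_measure (grad_residual u k))\<^sup>2 + (L2_norm cube_measure (div_residual n u k))\<^sup>2)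
    + lam * (\<Sum>k<n. (L2_norm surface_measure (bdry_op \<alpha> u k))\<^sup>2)
    + (if \<alpha> = Neumann then mu * (\<integral>x. phi u 0 x \<partial>cube_measure)\<^sup>2 else 0)"
proof -
  have "L2_inner cube_measure (sys_op n u k) (sys_op n u k) =
      (L2_norm cube_measure (grad_residual u k))\<^sup>2 + (L2_norm cube_measure (div_residual n u k))\<^sup>2"
    if k: "k < n" for k
  proof -
    have eq: "sys_op n u k x = (grad_residual u k x, div_residual n u k x)" for x
      by (simp add: sys_op_def grad_residual_def div_residual_def next_phi_def)
    have "L2_inner cube_measure (sys_op n u k) (sys_op n u k) =
      (\<integral>x. grad_residual u k x \<bullet> grad_residual u k x + div_residual n u k x \<bullet> div_residual n u k x \<partial>cube_measure)"
      by (simp add: L2_inner_def eq)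
    also have "\<dots> = L2_inner cube_measure (grad_residual u k) (grad_residual u k)
        + L2_inner cube_measure (div_residual n u k) (div_residual n u k)"
      unfolding L2_inner_def
      by (intro Bochner_Integration.integral_add L2_inner_integrable residuals_L2[OF u k])
    finally show ?thesis by (simp add: L2_inner_self)
  qed
  then show ?thesis
    by (simp add: bilin_def L2_inner_self power2_eq_square[of "\<integral>x. phi u 0 x \<partial>cube_measure"] mult.assoc)
qed

lemma bilin_bounds:
  fixes u :: "'a::euclidean_space tuple_field"
  assumes u: "u \<in> H1_tuples n" and lam: "0 < lam" and mu: "0 < mu" and k: "k < n"
  shows "(L2_norm cube_measure (grad_residual u k))\<^sup>2 \<le> bilin \<alpha> n lam mu u u"
    and "(L2_norm cube_measure (div_residual n u k))\<^sup>2 \<le> bilin \<alpha> n lam mu u u"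
    and "lam * (L2_norm surface_measure (bdry_op \<alpha> u k))\<^sup>2 \<le> bilin \<alpha> n lam mu u u"
    and "\<alpha> = Neumann \<Longrightarrow> mu * (\<integral>x. phi u 0 x \<partial>cube_measure)\<^sup>2 \<le> bilin \<alpha> n lam mu u u"
    and "0 \<le> bilin \<alpha> n lam mu u u"
proof -
  let ?F = "\<lambda>k. (L2_norm cube_measure (grad_residual u k))\<^sup>2 + (L2_norm cube_measure (div_residual n u k))\<^sup>2"
  let ?S = "\<lambda>k. (L2_norm surface_measure (bdry_op \<alpha> u k))\<^sup>2"
  let ?M = "if \<alpha> = Neumann then mu * (\<integral>x. phi u 0 x \<partial>cube_measure)\<^sup>2 else 0"
  have F: "?F k \<le> (\<Sum>k<n. ?F k)" using k by (intro member_le_sum) auto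
  have "?S k \<le> (\<Sum>k<n. ?S k)" using k by (intro member_le_sum) auto
  then have S: "lam * ?S k \<le> lam * (\<Sum>k<n. ?S k)" using lam by (intro mult_left_mono) auto
  have M: "0 \<le> ?M" using mu by simp
  have F0: "0 \<le> (\<Sum>k<n. ?F k)" by (intro sum_nonneg) auto
  have S0: "0 \<le> lam * (\<Sum>k<n. ?S k)" using lam by (intro mult_nonneg_nonneg sum_nonneg) auto
  note b = bilin_self[OF u, of \<alpha> lam mu]
  have p: "0 \<le> (L2_norm cube_measure (grad_residual u k))\<^sup>2" "0 \<le> (L2_norm cube_measure (div_residual n u k))\<^sup>2"
    by simp_all
  show "(L2_norm cube_measure (grad_residual u k))\<^sup>2 \<le> bilin \<alpha> n lam mu u u"
    unfolding b using F S0 M p by linarith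
  show "(L2_norm cube_measure (div_residual n u k))\<^sup>2 \<le> bilin \<alpha> n lam mu u u"
    unfolding b using F S0 M p by linarith
  show "lam * (L2_norm surface_measure (bdry_op \<alpha> u k))\<^sup>2 \<le> bilin \<alpha> n lam mu u u"
    unfolding b using F0 S M by linarith
  show "0 \<le> bilin \<alpha> n lam mu u u"
    unfolding b using F0 S0 M by linarith
  assume "\<alpha> = Neumann"
  then have "mu * (\<integral>x. phi u 0 x \<partial>cube_measure)\<^sup>2 = ?M" by simp
  then show "mu * (\<integral>x. phi u 0 x \<partial>cube_measure)\<^sup>2 \<le> bilin \<alpha> n lam mu u u"
    unfolding b using F0 S0 by linarith
qed

section \<open>Estimate for one pair and its iteration\<close>

lemma H1_norm_power2:
  "u \<in> H1 \<Longrightarrow> (H1_norm u)\<^sup>2 = (L2_norm cube_measure u)\<^sup>2 + grad_norm2_weak u"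
  by (simp add: H1_norm_def L2_norm_weak_grad grad_norm2_weak_def sum_nonneg)

lemma H1_norm_nonneg: "0 \<le> H1_norm u"
  by (simp add: H1_norm_def)

lemma H1_norm_ge:
  "L2_norm cube_measure u \<le> H1_norm u" "L2_norm cube_measure (weak_grad u) \<le> H1_norm u"
  unfolding H1_norm_def by (intro real_le_rsqrt; simp)+

text \<open>Testing the first equation with \<open>\<nabla>\<phi>\<^sub>k\<close> and eliminating \<open>\<psi>\<^sub>k\<close> by Green's formula.\<close>

lemma energy_estimate:
  fixes u :: "'a::euclidean_space tuple_field"
  assumes u: "u \<in> H1_tuples n" and k: "k < n"
  shows "grad_norm2_weak (phi u k) \<le>
    (L2_norm cube_measure (grad_residual u k) + L2_norm cube_measure (div_residual n u k)
      + L2_norm cube_measure (next_phi n u k)) * H1_norm (phi u k)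
    + (\<integral>x. normal_trace u k x * bdry_trace (phi u k) x \<partial>surface_measure)"
proof -
  let ?c = "cube_measure :: 'a measure"
  let ?f = "grad_residual u k" and ?g = "div_residual n u k" and ?q = "next_phi n u k"
  let ?\<phi> = "phi u k" and ?\<psi> = "psi u k"
  note t = H1_tuplesD[OF u k]
  note fL = residuals_L2(1)[OF u k] and gL = residuals_L2(2)[OF u k] and qL = next_phi_L2[OF u, of k]
  note pL = H1_L2[OF t(1)] and dL = weak_grad_L2[OF t(1)] and vL = H1_vec_L2[OF t(2)]
  have "grad_norm2_weak ?\<phi> = (\<integral>x. weak_grad ?\<phi> x \<bullet> weak_grad ?\<phi> x \<partial>?c)"
    using L2_inner_self[of ?c "weak_grad ?\<phi>"] by (simp add: L2_inner_def L2_norm_weak_grad[OF t(1)])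
  also have "\<dots> = (\<integral>x. ?f x \<bullet> weak_grad ?\<phi> x + ?\<psi> x \<bullet> weak_grad ?\<phi> x \<partial>?c)"
    by (simp add: grad_residual_def inner_diff_left)
  also have "\<dots> = (\<integral>x. ?f x \<bullet> weak_grad ?\<phi> x \<partial>?c) + (\<integral>x. ?\<psi> x \<bullet> weak_grad ?\<phi> x \<partial>?c)"
    by (intro Bochner_Integration.integral_add L2_inner_integrable fL dL vL)
  finally have 1: "grad_norm2_weak ?\<phi> = (\<integral>x. ?f x \<bullet> weak_grad ?\<phi> x \<partial>?c) + (\<integral>x. ?\<psi> x \<bullet> weak_grad ?\<phi> x \<partial>?c)" .
  have "(\<integral>x. weak_div ?\<psi> x * ?\<phi> x \<partial>?c) = (\<integral>x. ?g x * ?\<phi> x + ?q x * ?\<phi> x \<partial>?c)"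
    by (simp add: div_residual_def left_diff_distrib)
  also have "\<dots> = (\<integral>x. ?g x * ?\<phi> x \<partial>?c) + (\<integral>x. ?q x * ?\<phi> x \<partial>?c)"
    by (intro Bochner_Integration.integral_add L2_mult_integrable gL pL qL)
  finally have 2: "(\<integral>x. weak_div ?\<psi> x * ?\<phi> x \<partial>?c) = (\<integral>x. ?g x * ?\<phi> x \<partial>?c) + (\<integral>x. ?q x * ?\<phi> x \<partial>?c)" .
  have "\<bar>\<integral>x. ?f x \<bullet> weak_grad ?\<phi> x \<partial>?c\<bar> \<le> L2_norm ?c ?f * L2_norm ?c (weak_grad ?\<phi>)"
    by (rule L2_Cauchy_Schwarz[OF fL dL])
  also have "\<dots> \<le> L2_norm ?c ?f * H1_norm ?\<phi>" by (intro mult_left_mono H1_norm_ge) simp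
  finally have 3: "(\<integral>x. ?f x \<bullet> weak_grad ?\<phi> x \<partial>?c) \<le> L2_norm ?c ?f * H1_norm ?\<phi>" by linarith
  have cs: "- (\<integral>x. h x * ?\<phi> x \<partial>?c) \<le> L2_norm ?c h * H1_norm ?\<phi>" if h: "h \<in> L2 ?c" for h
  proof -
    have "\<bar>\<integral>x. h x * ?\<phi> x \<partial>?c\<bar> \<le> L2_norm ?c h * L2_norm ?c ?\<phi>"
      using L2_Cauchy_Schwarz[OF h pL] by simp
    also have "\<dots> \<le> L2_norm ?c h * H1_norm ?\<phi>" by (intro mult_left_mono H1_norm_ge) simp
    finally show ?thesis by linarith
  qed
  show ?thesis
    using 1 2 3 cs[OF gL] cs[OF qL] green_vec[OF t(2,1)]
    by (simp add: normal_trace_def distrib_right)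
qed

text \<open>Young's inequality moves half of \<open>N\<^sup>2\<close> to the left. \<open>X\<close>
  is kept apart from \<open>\<beta>\<^sup>2\<close> because in the Dirichlet case the term with
  \<open>M\<close> is bounded only by the larger mixed product.\<close>

lemma absorb:
  fixes N :: real
  assumes le: "N\<^sup>2 \<le> A * (c * \<beta> + Q) * N + M * X" and X: "\<beta>\<^sup>2 \<le> X" and M: "0 \<le> M"
  shows "N\<^sup>2 \<le> (2 * A\<^sup>2 * (c\<^sup>2 + 1) + 2 * M) * (X + Q\<^sup>2)"
proof -
  have X0: "0 \<le> X" using X zero_le_power2[of \<beta>] by linarith
  define y where "y = A * (c * \<beta> + Q)"
  have 1: "2 * (y * N) \<le> y\<^sup>2 + N\<^sup>2"
    using sum_squares_bound[of y N] by (simp only: mult.assoc)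
  have "(c * \<beta> + Q)\<^sup>2 \<le> 2 * (c\<^sup>2 * \<beta>\<^sup>2 + Q\<^sup>2)"
    using sum_squares_bound[of "c * \<beta>" Q] by (simp add: power2_sum power_mult_distrib algebra_simps)
  from mult_left_mono[OF this zero_le_power2[of A]]
  have 2: "y\<^sup>2 \<le> 2 * A\<^sup>2 * (c\<^sup>2 * \<beta>\<^sup>2 + Q\<^sup>2)"
    unfolding y_def by (simp only: power_mult_distrib mult.assoc mult.left_commute[of 2])
  have 3: "N\<^sup>2 \<le> y * N + M * X" using le by (simp only: y_def)
  have "N\<^sup>2 \<le> 2 * A\<^sup>2 * (c\<^sup>2 * \<beta>\<^sup>2 + Q\<^sup>2) + 2 * M * X"
    unfolding mult.assoc[of 2 M X] using 1 2 3 by linarith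
  also have "\<dots> \<le> 2 * A\<^sup>2 * ((c\<^sup>2 + 1) * (X + Q\<^sup>2)) + 2 * M * (X + Q\<^sup>2)"
  proof (intro add_mono mult_left_mono)
    have "c\<^sup>2 * \<beta>\<^sup>2 \<le> c\<^sup>2 * X" by (intro mult_left_mono X) simp
    moreover have "0 \<le> c\<^sup>2 * Q\<^sup>2" by simp
    ultimately show "c\<^sup>2 * \<beta>\<^sup>2 + Q\<^sup>2 \<le> (c\<^sup>2 + 1) * (X + Q\<^sup>2)"
      unfolding distrib_left distrib_right using X0 by linarith
  qed (use M in auto)
  finally show ?thesis by (simp add: algebra_simps)
qed

text \<open>A discrete Gronwall argument from the end of the chain. Both X and the bound for the
  successor are at most \<open>?b ^ i * X\<close>, so a step multiplies by at most
  \<open>2 * K\<close>; the base \<open>2 * (K + 1)\<close> is taken instead to be at least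
  1.\<close>

lemma downward_recursion:
  fixes N :: "nat \<Rightarrow> real"
  assumes step: "\<And>k. k < n \<Longrightarrow> N k \<le> K * (X + (if Suc k < n then N (Suc k) else 0))"
    and K: "0 \<le> K" and X: "0 \<le> X" and k: "k < n"
  shows "N k \<le> (2 * (K + 1)) ^ n * X"
proof -
  let ?b = "2 * (K + 1)"
  have b: "1 \<le> ?b" using K by simp
  \<comment> \<open>Here i is the distance from the index \<open>k + j\<close> to n. The case i = 0
    is vacuous; at i = 1 the successor is missing and contributes 0.\<close>
  have "k + j < n \<longrightarrow> n = k + j + i \<longrightarrow> N (k + j) \<le> ?b ^ i * X" for i j
  proof (induction i arbitrary: j)
    case (Suc i)
    show ?case
    proof (intro impI)
      assume kj: "k + j < n" "n = k + j + Suc i"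
      have pw: "1 \<le> ?b ^ i" using b by (rule one_le_power)
      have rest: "(if Suc (k + j) < n then N (Suc (k + j)) else 0) \<le> ?b ^ i * X"
        using Suc.IH[of "Suc j"] kj X pw by (auto intro: mult_nonneg_nonneg)
      have "X \<le> ?b ^ i * X" using mult_right_mono[OF pw X] by simp
      then have "K * (X + (if Suc (k + j) < n then N (Suc (k + j)) else 0)) \<le> K * (?b ^ i * X + ?b ^ i * X)"
        using rest K by (intro mult_left_mono add_mono)
      also have "\<dots> \<le> (K + 1) * (?b ^ i * X + ?b ^ i * X)"
        using X pw by (intro mult_right_mono) auto
      also have "\<dots> = ?b ^ Suc i * X" by (simp add: algebra_simps)
      finally show "N (k + j) \<le> ?b ^ Suc i * X" using step[OF kj(1)] by linarith
    qed
  qed simp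
  from this[of 0 "n - k"] have "N k \<le> ?b ^ (n - k) * X" using k by simp
  also have "\<dots> \<le> ?b ^ n * X" using b X by (intro mult_right_mono power_increasing) auto
  finally show ?thesis .
qed

text \<open>The common frame for the three boundary conditions, with \<open>X\<close> as the
  quantity to be bounded from below. Once \<phi> is bounded in H1 along the chain, \<psi> is the
  gradient minus a residual and its divergence is the next \<phi> plus a residual.\<close>

lemma coercive_from_step:
  fixes X :: "'a::euclidean_space tuple_field \<Rightarrow> real"
  assumes n: "1 \<le> n" and K: "0 \<le> K"
    and step: "\<And>u k. u \<in> H1_tuples n \<Longrightarrow> k < n \<Longrightarrow>
      (H1_norm (phi u k))\<^sup>2 \<le> K * (X u + (L2_norm cube_measure (next_phi n u k))\<^sup>2)"
    and f: "\<And>u k. u \<in> H1_tuples n \<Longrightarrow> k < n \<Longrightarrow> (L2_norm cube_measure (grad_residual u k))\<^sup>2 \<le> X u"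
    and g: "\<And>u k. u \<in> H1_tuples n \<Longrightarrow> k < n \<Longrightarrow> (L2_norm cube_measure (div_residual n u k))\<^sup>2 \<le> X u"
  shows "\<exists>C>0. \<forall>u. u \<in> H1_tuples n \<longrightarrow>
    C * (\<Sum>k<n. (Hdiv_norm (psi u k))\<^sup>2 + (H1_norm (phi u k))\<^sup>2) \<le> X u"
proof -
  define L where "L = (2 * (K + 1)) ^ n"
  have L: "1 \<le> L" unfolding L_def using K by (intro one_le_power) simp
  \<comment> \<open>Per index, \<psi> and its divergence contribute \<open>2 + 2 * L\<close> each
    and \<phi> contributes L; there are n indices.\<close>
  let ?D = "real n * (4 + 5 * L)"
  have D: "0 < ?D" using n L by (intro mult_pos_pos) auto
  show ?thesis
  proof (intro exI conjI allI impI)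
    show "0 < 1 / ?D" using D by simp
    fix u :: "'a tuple_field" assume u: "u \<in> H1_tuples n"
    let ?c = "cube_measure :: 'a measure"
    have X0: "0 \<le> X u" using f[OF u, of 0] n by (meson less_le_trans order_trans zero_le_power2 zero_less_one)
    have nx: "(L2_norm ?c (next_phi n u k))\<^sup>2 \<le> (if Suc k < n then (H1_norm (phi u (Suc k)))\<^sup>2 else 0)" for k
    proof (cases "Suc k < n")
      case True
      then have "next_phi n u k = phi u (Suc k)" by (auto simp: next_phi_def)
      then show ?thesis using True by (auto intro!: power_mono H1_norm_ge)
    next
      case False
      then have "next_phi n u k = (\<lambda>x. 0)" by (auto simp: next_phi_def)
      then show ?thesis using False by (simp add: L2_norm_def)
    qed
    have N: "(H1_norm (phi u k))\<^sup>2 \<le> L * X u" if "k < n" for k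
      unfolding L_def
    proof (rule downward_recursion[OF _ K X0 that])
      fix k assume k: "k < n"
      have "(H1_norm (phi u k))\<^sup>2 \<le> K * (X u + (L2_norm ?c (next_phi n u k))\<^sup>2)" by (rule step[OF u k])
      also have "\<dots> \<le> K * (X u + (if Suc k < n then (H1_norm (phi u (Suc k)))\<^sup>2 else 0))"
        by (intro mult_left_mono add_left_mono nx K)
      finally show "(H1_norm (phi u k))\<^sup>2 \<le> K * (X u + (if Suc k < n then (H1_norm (phi u (Suc k)))\<^sup>2 else 0))" .
    qed
    have "(Hdiv_norm (psi u k))\<^sup>2 + (H1_norm (phi u k))\<^sup>2 \<le> (4 + 5 * L) * X u" if k: "k < n" for k
    proof -
      note t = H1_tuplesD[OF u k]
      have sq: "x\<^sup>2 \<le> 2 * a\<^sup>2 + 2 * b\<^sup>2" if "0 \<le> x" "x \<le> a + b" for x a b :: real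
      proof -
        have "x\<^sup>2 \<le> (a + b)\<^sup>2" using that by (intro power_mono) auto
        then show ?thesis using sum_squares_bound[of a b] by (simp add: power2_sum)
      qed
      have "L2_norm ?c (psi u k) \<le> L2_norm ?c (weak_grad (phi u k)) + L2_norm ?c (grad_residual u k)"
        using L2_norm_triangle[OF weak_grad_L2[OF t(1)] L2_scaleR[OF residuals_L2(1)[OF u k], of "-1"]]
        unfolding L2_norm_scaleR by (simp add: grad_residual_def[abs_def])
      then have 1: "(L2_norm ?c (psi u k))\<^sup>2 \<le> 2 * (L2_norm ?c (weak_grad (phi u k)))\<^sup>2 + 2 * (L2_norm ?c (grad_residual u k))\<^sup>2"
        by (intro sq) auto
      have "L2_norm ?c (weak_div (psi u k)) \<le> L2_norm ?c (div_residual n u k) + L2_norm ?c (next_phi n u k)"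
        using L2_norm_triangle[OF residuals_L2(2)[OF u k] next_phi_L2[OF u, of k]]
        by (simp add: div_residual_def)
      then have 2: "(L2_norm ?c (weak_div (psi u k)))\<^sup>2 \<le> 2 * (L2_norm ?c (div_residual n u k))\<^sup>2 + 2 * (L2_norm ?c (next_phi n u k))\<^sup>2"
        by (intro sq) auto
      have 3: "(L2_norm ?c (weak_grad (phi u k)))\<^sup>2 \<le> L * X u"
        using power_mono[OF H1_norm_ge(2) L2_norm_nonneg, of "phi u k" 2] N[OF k] by linarith
      have 4: "(L2_norm ?c (next_phi n u k))\<^sup>2 \<le> L * X u"
        using nx[of k] N[of "Suc k"] L X0 by (auto split: if_splits intro: order_trans)
      have "(Hdiv_norm (psi u k))\<^sup>2 = (L2_norm ?c (psi u k))\<^sup>2 + (L2_norm ?c (weak_div (psi u k)))\<^sup>2"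
        by (simp add: Hdiv_norm_def)
      then show ?thesis using 1 2 3 4 f[OF u k] g[OF u k] N[OF k] by (simp add: distrib_right)
    qed
    then have "(\<Sum>k<n. (Hdiv_norm (psi u k))\<^sup>2 + (H1_norm (phi u k))\<^sup>2) \<le> (\<Sum>k<n. (4 + 5 * L) * X u)"
      by (intro sum_mono) auto
    also have "\<dots> = ?D * X u" by simp
    finally show "1 / ?D * (\<Sum>k<n. (Hdiv_norm (psi u k))\<^sup>2 + (H1_norm (phi u k))\<^sup>2) \<le> X u"
      using D by (simp add: pos_divide_le_eq mult.commute)
  qed
qed

section \<open>The three boundary conditions\<close>

lemma le_sqrt_of_scaled:
  assumes "lam * t\<^sup>2 \<le> B" "0 < lam" "0 \<le> t"
  shows "t \<le> sqrt B / sqrt lam"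
proof -
  have "t\<^sup>2 \<le> B / lam" using assms by (simp add: pos_le_divide_eq mult.commute)
  then show ?thesis by (simp add: real_le_rsqrt real_sqrt_divide[symmetric])
qed

lemma trace_le_H1_norm:
  fixes v :: "'a::euclidean_space \<Rightarrow> real"
  assumes "v \<in> H1"
  shows "L2_norm surface_measure (bdry_trace v) \<le> sqrt (3 * DIM('a)) * H1_norm v"
proof -
  have "(L2_norm surface_measure (bdry_trace v))\<^sup>2 \<le> 3 * DIM('a) * (H1_norm v)\<^sup>2"
    using trace_inequality[OF assms] by (simp add: H1_norm_power2[OF assms])
  from real_le_rsqrt[OF this] show ?thesis by (simp add: real_sqrt_mult H1_norm_nonneg)
qed

lemma bdry_integral_le:
  fixes v w :: "'a::euclidean_space \<Rightarrow> real"
  assumes "v \<in> L2 surface_measure" "w \<in> L2 surface_measure"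
  shows "(\<integral>x. v x * w x \<partial>surface_measure) \<le> L2_norm surface_measure v * L2_norm surface_measure w"
  using L2_Cauchy_Schwarz[OF assms] by simp

text \<open>The normal trace is the Robin residual minus the trace of \<phi>. The boundary integral
  thus contains a negative square, which moves to the left and becomes exactly the boundary term
  that Friedrichs requires.\<close>

lemma coercive_Robin:
  fixes n :: nat and lam mu :: real
  assumes n: "1 \<le> n" and lam: "0 < lam" and mu: "0 < mu"
  shows "\<exists>C>0. \<forall>u :: 'a::euclidean_space tuple_field. u \<in> H1_tuples n \<longrightarrow>
    C * (\<Sum>k<n. (Hdiv_norm (psi u k))\<^sup>2 + (H1_norm (phi u k))\<^sup>2) \<le> bilin Robin n lam mu u u"
proof -
  \<comment> \<open>The 2 counts the two interior residuals; the rest is the trace constant times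
    the bound of the boundary residual by the form.\<close>
  define c where "c = 2 + sqrt (3 * DIM('a)) / sqrt lam"
  show ?thesis
  proof (rule coercive_from_step[OF n, where K = "2 * 5\<^sup>2 * (c\<^sup>2 + 1) + 2 * 0"])
    fix u :: "'a tuple_field" and k assume u: "u \<in> H1_tuples n" and k: "k < n"
    note b = bilin_bounds[OF u lam mu k, of Robin]
    let ?c = "cube_measure :: 'a measure" and ?s = "surface_measure :: 'a measure"
    let ?\<beta> = "sqrt (bilin Robin n lam mu u u)" and ?N = "H1_norm (phi u k)"
      and ?Q = "L2_norm ?c (next_phi n u k)"
    show "(L2_norm ?c (grad_residual u k))\<^sup>2 \<le> bilin Robin n lam mu u u"
      "(L2_norm ?c (div_residual n u k))\<^sup>2 \<le> bilin Robin n lam mu u u" by (rule b)+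
    note t = H1_tuplesD[OF u k]
    let ?\<tau> = "bdry_trace (phi u k)" and ?r = "bdry_op Robin u k"
    note \<tau>L = bdry_trace_L2[OF t(1)] and sL = residuals_L2(3)[OF u k]
    have r: "?r = (\<lambda>x. ?\<tau> x + normal_trace u k x)"
      by (auto simp: bdry_op_def normal_trace_def)
    have rL: "?r \<in> L2 ?s" unfolding r by (rule L2_add[OF \<tau>L sL])
    have "(\<integral>x. normal_trace u k x * ?\<tau> x \<partial>?s) = (\<integral>x. ?r x * ?\<tau> x - ?\<tau> x * ?\<tau> x \<partial>?s)"
      by (simp add: r distrib_right)
    also have "\<dots> = (\<integral>x. ?r x * ?\<tau> x \<partial>?s) - (\<integral>x. ?\<tau> x * ?\<tau> x \<partial>?s)"
      by (intro Bochner_Integration.integral_diff L2_mult_integrable rL \<tau>L)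
    also have "(\<integral>x. ?\<tau> x * ?\<tau> x \<partial>?s) = (L2_norm ?s ?\<tau>)\<^sup>2"
      unfolding L2_norm_power2 by (simp add: power2_eq_square)
    finally have eq: "(\<integral>x. normal_trace u k x * ?\<tau> x \<partial>?s) = (\<integral>x. ?r x * ?\<tau> x \<partial>?s) - (L2_norm ?s ?\<tau>)\<^sup>2" .
    have "(\<integral>x. ?r x * ?\<tau> x \<partial>?s) \<le> L2_norm ?s ?r * L2_norm ?s ?\<tau>" by (rule bdry_integral_le[OF rL \<tau>L])
    also have "\<dots> \<le> (?\<beta> / sqrt lam) * (sqrt (3 * DIM('a)) * ?N)"
      using b(5) lam by (intro mult_mono le_sqrt_of_scaled[OF b(3)] trace_le_H1_norm t) auto
    finally have 1: "(\<integral>x. ?r x * ?\<tau> x \<partial>?s) \<le> (sqrt (3 * DIM('a)) / sqrt lam) * ?\<beta> * ?N"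
      by (simp add: mult_ac)
    have 2: "(L2_norm ?c (grad_residual u k) + L2_norm ?c (div_residual n u k) + ?Q) * ?N \<le> (?\<beta> + ?\<beta> + ?Q) * ?N"
      using b by (intro mult_right_mono add_mono real_le_rsqrt H1_norm_nonneg) auto
    have 3: "grad_norm2_weak (phi u k) + (L2_norm ?s ?\<tau>)\<^sup>2 \<le> (c * ?\<beta> + ?Q) * ?N"
      using energy_estimate[OF u k] 1 2 unfolding eq by (simp add: c_def algebra_simps)
    \<comment> \<open>The Friedrichs constant 4 plus 1 for the gradient inside the H1 norm; 5 also
      dominates the boundary coefficient 2.\<close>
    have "?N\<^sup>2 \<le> 5 * grad_norm2_weak (phi u k) + 2 * (L2_norm ?s ?\<tau>)\<^sup>2"
      using friedrichs_inequality[OF t(1)] by (simp add: H1_norm_power2[OF t(1)])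
    also have "\<dots> \<le> 5 * (grad_norm2_weak (phi u k) + (L2_norm ?s ?\<tau>)\<^sup>2)" by simp
    also have "\<dots> \<le> 5 * ((c * ?\<beta> + ?Q) * ?N)" by (rule mult_left_mono[OF 3]) simp
    finally have "?N\<^sup>2 \<le> 5 * (c * ?\<beta> + ?Q) * ?N + 0 * bilin Robin n lam mu u u"
      by (simp only: mult.assoc mult_zero_left add_0_right)
    then show "?N\<^sup>2 \<le> (2 * 5\<^sup>2 * (c\<^sup>2 + 1) + 2 * 0) * (bilin Robin n lam mu u u + ?Q\<^sup>2)"
      by (rule absorb) (use b(5) in auto)
  qed simp
qed

text \<open>The form controls the normal trace directly, and the trace of \<phi> costs a factor of
  its H1 norm, to be absorbed. What remains is the mean: for constant \<open>phi u 0\<close> and all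
  other entries 0 only the mu-term of the form is nonzero.\<close>

lemma coercive_Neumann:
  fixes n :: nat and lam mu :: real
  assumes n: "1 \<le> n" and lam: "0 < lam" and mu: "0 < mu"
  shows "\<exists>C>0. \<forall>u :: 'a::euclidean_space tuple_field. u \<in> H1_tuples n \<longrightarrow>
    C * (\<Sum>k<n. (Hdiv_norm (psi u k))\<^sup>2 + (H1_norm (phi u k))\<^sup>2) \<le> bilin Neumann n lam mu u u"
proof -
  let ?c = "cube_measure :: 'a measure" and ?s = "surface_measure :: 'a measure"
  define c where "c = 2 + sqrt (3 * DIM('a)) / sqrt lam"
  \<comment> \<open>The Poincare constant plus 1, because the H1 norm contains the gradient as
    well.\<close>
  define P where "P = 2 * DIM('a) * 2 ^ DIM('a) + (1 :: real)"
  \<comment> \<open>Bounds the mean of a later \<phi> by \<beta>: the quotient comes from the flux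
    through the boundary, the 1 from the divergence residual.\<close>
  define m0 where "m0 = L2_norm ?s (\<lambda>x. 1 :: real) / sqrt lam + 1"
  define M where "M = 1 / mu + m0\<^sup>2"
  have P: "1 \<le> P" by (simp add: P_def)
  have M: "0 \<le> M" "m0\<^sup>2 \<le> M" "1 / mu \<le> M" using mu by (simp_all add: M_def)
  show ?thesis
  proof (rule coercive_from_step[OF n, where K = "2 * P\<^sup>2 * (c\<^sup>2 + 1) + 2 * M"])
    show "0 \<le> 2 * P\<^sup>2 * (c\<^sup>2 + 1) + 2 * M" using M by simp
    fix u :: "'a tuple_field" and k assume u: "u \<in> H1_tuples n" and k: "k < n"
    let ?B = "bilin Neumann n lam mu u u"
    note b = bilin_bounds[OF u lam mu k, of Neumann]
    let ?\<beta> = "sqrt ?B" and ?N = "H1_norm (phi u k)" and ?Q = "L2_norm ?c (next_phi n u k)"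
    show "(L2_norm ?c (grad_residual u k))\<^sup>2 \<le> ?B" "(L2_norm ?c (div_residual n u k))\<^sup>2 \<le> ?B" by (rule b)+
    note t = H1_tuplesD[OF u k]
    let ?\<tau> = "bdry_trace (phi u k)"
    note \<tau>L = bdry_trace_L2[OF t(1)] and sL = residuals_L2(3)[OF u k]
    have op: "bdry_op Neumann u j = normal_trace u j" for j
      by (rule ext) (simp add: bdry_op_def normal_trace_def)
    have s: "L2_norm ?s (normal_trace u j) \<le> ?\<beta> / sqrt lam" if "j < n" for j
      using bilin_bounds(3)[OF u lam mu that, of Neumann] lam unfolding op by (intro le_sqrt_of_scaled) auto
    have "(\<integral>x. normal_trace u k x * ?\<tau> x \<partial>?s) \<le> L2_norm ?s (normal_trace u k) * L2_norm ?s ?\<tau>"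
      by (rule bdry_integral_le[OF sL \<tau>L])
    also have "\<dots> \<le> (?\<beta> / sqrt lam) * (sqrt (3 * DIM('a)) * ?N)"
      using b(5) lam by (intro mult_mono s k trace_le_H1_norm t) auto
    finally have 1: "(\<integral>x. normal_trace u k x * ?\<tau> x \<partial>?s) \<le> (sqrt (3 * DIM('a)) / sqrt lam) * ?\<beta> * ?N"
      by (simp add: mult_ac)
    have 2: "(L2_norm ?c (grad_residual u k) + L2_norm ?c (div_residual n u k) + ?Q) * ?N \<le> (?\<beta> + ?\<beta> + ?Q) * ?N"
      using b by (intro mult_right_mono add_mono real_le_rsqrt H1_norm_nonneg) auto
    have 3: "grad_norm2_weak (phi u k) \<le> (c * ?\<beta> + ?Q) * ?N"
      using energy_estimate[OF u k] 1 2 by (simp add: c_def algebra_simps)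
    \<comment> \<open>The first \<phi> occurs in no divergence equation, so its mean is reached only
      through the mu-term; every later mean is the total divergence of the preceding \<psi> minus
      the integral of a residual.\<close>
    have mean: "(\<integral>x. phi u k x \<partial>?c)\<^sup>2 \<le> M * ?B"
    proof (cases k)
      case 0
      have "(\<integral>x. phi u 0 x \<partial>?c)\<^sup>2 \<le> (1 / mu) * ?B"
        using b(4) mu by (simp add: pos_le_divide_eq mult.commute)
      also have "\<dots> \<le> M * ?B" by (rule mult_right_mono[OF M(3) b(5)])
      finally show ?thesis using 0 by simp
    next
      case (Suc j)
      then have j: "j < n" "next_phi n u j = phi u k" using k by (auto simp: next_phi_def)
      note tj = H1_tuplesD[OF u j(1)]
      note gL = residuals_L2(2)[OF u j(1)] and sjL = residuals_L2(3)[OF u j(1)]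
      have one_c: "L2_norm ?c (\<lambda>x. 1 :: real) = 1"
        by (simp add: L2_norm_def measure_def emeasure_cube_measure)
      have "(\<integral>x. phi u k x \<partial>?c) = (\<integral>x. weak_div (psi u j) x - div_residual n u j x \<partial>?c)"
        by (simp add: div_residual_def j(2))
      also have "\<dots> = (\<integral>x. weak_div (psi u j) x \<partial>?c) - (\<integral>x. div_residual n u j x \<partial>?c)"
        by (intro Bochner_Integration.integral_diff L2_cube_integrable weak_div_L2 tj gL)
      also have "(\<integral>x. weak_div (psi u j) x \<partial>?c) = (\<integral>x. normal_trace u j x \<partial>?s)"
        unfolding normal_trace_def by (rule integral_weak_div[OF tj(2)])
      finally have eq: "(\<integral>x. phi u k x \<partial>?c) = (\<integral>x. normal_trace u j x \<partial>?s) - (\<integral>x. div_residual n u j x \<partial>?c)" .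
      have "\<bar>\<integral>x. normal_trace u j x \<partial>?s\<bar> \<le> L2_norm ?s (normal_trace u j) * L2_norm ?s (\<lambda>x. 1 :: real)"
        using L2_Cauchy_Schwarz[OF sjL surface.L2_const[of 1]] by simp
      also have "\<dots> \<le> (?\<beta> / sqrt lam) * L2_norm ?s (\<lambda>x. 1 :: real)"
        by (intro mult_right_mono s j) simp
      finally have 4: "\<bar>\<integral>x. normal_trace u j x \<partial>?s\<bar> \<le> (?\<beta> / sqrt lam) * L2_norm ?s (\<lambda>x. 1 :: real)" .
      have "\<bar>\<integral>x. div_residual n u j x \<partial>?c\<bar> \<le> L2_norm ?c (div_residual n u j)"
        using L2_Cauchy_Schwarz[OF gL cube.L2_const[of 1]] one_c by simp
      also have "\<dots> \<le> ?\<beta>" by (rule real_le_rsqrt[OF bilin_bounds(2)[OF u lam mu j(1)]])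
      finally have "\<bar>\<integral>x. phi u k x \<partial>?c\<bar> \<le> m0 * ?\<beta>"
        using 4 unfolding eq m0_def by (simp add: algebra_simps)
      from power_mono[OF this abs_ge_zero, of 2]
      have "(\<integral>x. phi u k x \<partial>?c)\<^sup>2 \<le> m0\<^sup>2 * ?B" using b(5) by (simp add: power_mult_distrib)
      also have "\<dots> \<le> M * ?B" by (rule mult_right_mono[OF M(2) b(5)])
      finally show ?thesis .
    qed
    have "?N\<^sup>2 \<le> P * grad_norm2_weak (phi u k) + (\<integral>x. phi u k x \<partial>?c)\<^sup>2"
      using poincare_inequality[OF t(1)] by (simp add: H1_norm_power2[OF t(1)] P_def algebra_simps)
    also have "\<dots> \<le> P * ((c * ?\<beta> + ?Q) * ?N) + M * ?B"
      using P by (intro add_mono mult_left_mono 3 mean) auto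
    finally have "?N\<^sup>2 \<le> P * (c * ?\<beta> + ?Q) * ?N + M * ?B" by (simp only: mult.assoc)
    then show "?N\<^sup>2 \<le> (2 * P\<^sup>2 * (c\<^sup>2 + 1) + 2 * M) * (?B + ?Q\<^sup>2)"
      by (rule absorb) (use b(5) M in auto)
  qed
qed

text \<open>On the boundary the form sees the traces of \<phi> alone. The normal trace in the
  boundary integral is therefore left as it is, which produces the product of \<open>\<Psi>\<close>
  and \<beta> and explains why \<open>X\<close> is the mixed product instead of the form.\<close>

lemma coercive_Dirichlet:
  fixes n :: nat and lam mu :: real
  assumes n: "1 \<le> n" and lam: "0 < lam" and mu: "0 < mu"
  shows "\<exists>C>0. \<forall>u :: 'a::euclidean_space tuple_field. u \<in> H1_tuples n \<longrightarrow>
    C * (\<Sum>k<n. (Hdiv_norm (psi u k))\<^sup>2 + (H1_norm (phi u k))\<^sup>2) \<le>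
      (sqrt (bilin Dirichlet n lam mu u u)
               + (\<Sum>k<n. L2_norm surface_measure (bdry_trace_vec (psi u k))))
             * sqrt (bilin Dirichlet n lam mu u u)"
proof -
  let ?c = "cube_measure :: 'a measure" and ?s = "surface_measure :: 'a measure"
  define c where "c = sqrt (DIM('a)) / sqrt lam"
  \<comment> \<open>The boundary integral, bounded by \<open>c * X\<close>, is multiplied by the
    factor 5 of the Friedrichs step; \<open>2 / lam\<close> comes from the trace term of that
    inequality.\<close>
  define M where "M = 5 * c + 2 / lam"
  have c: "0 \<le> c" using lam by (simp add: c_def)
  have M: "0 \<le> M" using lam c by (simp add: M_def)
  show ?thesis
  proof (rule coercive_from_step[OF n, where K = "2 * 5\<^sup>2 * (2\<^sup>2 + 1) + 2 * M"])
    show "0 \<le> 2 * 5\<^sup>2 * (2\<^sup>2 + 1) + 2 * M" using M by simp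
    fix u :: "'a tuple_field" and k assume u: "u \<in> H1_tuples n" and k: "k < n"
    let ?B = "bilin Dirichlet n lam mu u u"
    note b = bilin_bounds[OF u lam mu k, of Dirichlet]
    let ?\<beta> = "sqrt ?B" and ?N = "H1_norm (phi u k)" and ?Q = "L2_norm ?c (next_phi n u k)"
    let ?\<Psi> = "\<Sum>k<n. L2_norm ?s (bdry_trace_vec (psi u k))"
    let ?X = "(?\<beta> + ?\<Psi>) * ?\<beta>"
    have \<Psi>0: "0 \<le> ?\<Psi>" by (intro sum_nonneg) simp
    have \<beta>: "?\<beta> * ?\<beta> = ?B" "0 \<le> ?\<beta>" using b(5) by simp_all
    have BX: "?B \<le> ?X" "?\<Psi> * ?\<beta> \<le> ?X"
      using mult_nonneg_nonneg[OF \<Psi>0 \<beta>(2)] b(5) unfolding distrib_right \<beta>(1) by linarith+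
    show "(L2_norm ?c (grad_residual u k))\<^sup>2 \<le> ?X" "(L2_norm ?c (div_residual n u k))\<^sup>2 \<le> ?X"
      using b(1,2) BX(1) by linarith+
    note t = H1_tuplesD[OF u k]
    let ?\<tau> = "bdry_trace (phi u k)"
    note \<tau>L = bdry_trace_L2[OF t(1)] and sL = residuals_L2(3)[OF u k]
    have op: "bdry_op Dirichlet u k = ?\<tau>" by (rule ext) (simp add: bdry_op_def)
    have \<tau>: "L2_norm ?s ?\<tau> \<le> ?\<beta> / sqrt lam"
      using b(3) lam unfolding op by (intro le_sqrt_of_scaled) auto
    have \<tau>2: "(L2_norm ?s ?\<tau>)\<^sup>2 \<le> (1 / lam) * ?X"
    proof -
      have "(L2_norm ?s ?\<tau>)\<^sup>2 \<le> (1 / lam) * ?B"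
        using b(3) lam unfolding op by (simp add: pos_le_divide_eq mult.commute)
      also have "\<dots> \<le> (1 / lam) * ?X" using lam by (intro mult_left_mono BX) simp
      finally show ?thesis .
    qed
    have "(\<integral>x. normal_trace u k x * ?\<tau> x \<partial>?s) \<le> L2_norm ?s (normal_trace u k) * L2_norm ?s ?\<tau>"
      by (rule bdry_integral_le[OF sL \<tau>L])
    also have "\<dots> \<le> (sqrt (DIM('a)) * ?\<Psi>) * (?\<beta> / sqrt lam)"
    proof (intro mult_mono \<tau>)
      have "L2_norm ?s (normal_trace u k) \<le> sqrt (DIM('a)) * L2_norm ?s (bdry_trace_vec (psi u k))"
        unfolding normal_trace_def by (rule normal_trace_bound[OF t(2)])
      also have "\<dots> \<le> sqrt (DIM('a)) * ?\<Psi>"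
        using k by (intro mult_left_mono member_le_sum) auto
      finally show "L2_norm ?s (normal_trace u k) \<le> sqrt (DIM('a)) * ?\<Psi>" .
    qed (use \<Psi>0 in auto)
    also have "\<dots> = c * (?\<Psi> * ?\<beta>)" by (simp add: c_def)
    also have "\<dots> \<le> c * ?X" by (intro mult_left_mono BX c)
    finally have 1: "(\<integral>x. normal_trace u k x * ?\<tau> x \<partial>?s) \<le> c * ?X" .
    have 2: "(L2_norm ?c (grad_residual u k) + L2_norm ?c (div_residual n u k) + ?Q) * ?N \<le> (?\<beta> + ?\<beta> + ?Q) * ?N"
      using b by (intro mult_right_mono add_mono real_le_rsqrt H1_norm_nonneg) auto
    \<comment> \<open>Only the two interior residuals multiply the H1 norm here, hence the
      coefficient 2; the boundary integral goes into the term with \<open>X\<close>.\<close>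
    have 3: "grad_norm2_weak (phi u k) \<le> (2 * ?\<beta> + ?Q) * ?N + c * ?X"
      using energy_estimate[OF u k] 1 2 unfolding mult_2 by linarith
    have "?N\<^sup>2 \<le> 5 * grad_norm2_weak (phi u k) + 2 * (L2_norm ?s ?\<tau>)\<^sup>2"
      using friedrichs_inequality[OF t(1)] by (simp add: H1_norm_power2[OF t(1)])
    also have "\<dots> \<le> 5 * ((2 * ?\<beta> + ?Q) * ?N + c * ?X) + 2 * ((1 / lam) * ?X)"
      by (intro add_mono mult_left_mono 3 \<tau>2) auto
    also have "\<dots> = 5 * (2 * ?\<beta> + ?Q) * ?N + M * ?X"
      unfolding M_def distrib_right[of "5 * c"] by simp
    finally have "?N\<^sup>2 \<le> 5 * (2 * ?\<beta> + ?Q) * ?N + M * ?X" .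
    then show "?N\<^sup>2 \<le> (2 * 5\<^sup>2 * (2\<^sup>2 + 1) + 2 * M) * (?X + ?Q\<^sup>2)"
      by (rule absorb) (use b(5) M BX in auto)
  qed
qed

theorem lemma4p1:
  fixes n :: nat and lam mu :: real
  assumes "n \<ge> 1" and "lam > 0" and "mu > 0"
  shows "(\<forall>\<alpha>\<in>{Neumann, Robin}. \<exists>C>0. \<forall>u :: 'a::euclidean_space tuple_field. u \<in> H1_tuples n \<longrightarrow>
            bilin \<alpha> n lam mu u u
              \<ge> C * (\<Sum>k<n. (Hdiv_norm (psi u k))\<^sup>2 + (H1_norm (phi u k))\<^sup>2))
       \<and> (\<exists>C>0. \<forall>u :: 'a tuple_field. u \<in> H1_tuples n \<longrightarrow>
            (sqrt (bilin Dirichlet n lam mu u u)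
               + (\<Sum>k<n. L2_norm surface_measure (bdry_trace_vec (psi u k))))
             * sqrt (bilin Dirichlet n lam mu u u)
              \<ge> C * (\<Sum>k<n. (Hdiv_norm (psi u k))\<^sup>2 + (H1_norm (phi u k))\<^sup>2))"
  using coercive_Neumann[OF assms, where 'a='a] coercive_Robin[OF assms, where 'a='a]
    coercive_Dirichlet[OF assms, where 'a='a] by simp

end
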